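(* Let $H$ be a positive Hankel operator on $H^2(\mathbb{C}_+)$ with Carleson measure $\mu_H$, and let $h_H(p) := \frac{i}{\pi}\int_{\mathbb{R}_+} \frac{p}{\lambda^2+p^2}\, d\mu_H(\lambda)$ for $p \in \mathbb{R}$. Then, for every $c \in \mathbb{R}\setminus\{0\}$, the function $\delta := h_H + c\mathbf{1}$ satisfies $$\delta \in L^\infty(\mathbb{R},\mathbb{C}) \quad\text{and}\quad \frac{1}{\delta} \in L^\infty(\mathbb{R},\mathbb{C}).$$ Further, $H_\delta = H$, and there exists an outer function $g \in H^\infty(\mathbb{C}_+)^\times$ such that $|g^*|^2 = |\delta|$ (almost everywhere on $\mathbb{R}$).
   Context: $\mathbb{R}_+ = (0,\infty)$ and $\mathbb{C}_+ = \{z \in \mathbb{C} : \operatorname{Im} z > 0\}$. $H^2(\mathbb{C}_+)$ is the Hardy space of the upper half plane, identified via non-tangential boundary values $f \mapsto f^*$ with a closed subspace of $L^2(\mathbb{R})$; scalar products are antilinear in the first argument. $P_+ : L^2(\mathbb{R}) \to H^2(\mathbb{C}_+)$ is the orthogonal projection and $(Rf)(x) := f(-x)$. For $h \in L^\infty(\mathbb{R})$ put $H_h := P_+ h R P_+^*$ (apply $R$, multiply by $h$, project). A Hankel operator on $H^2(\mathbb{C}_+)$ is a bounded operator of the form $H_h$, $h \in L^\infty(\mathbb{R})$. The Carleson measure $\mu_H$ of a positive Hankel operator $H$ is the unique positive Borel measure on $\mathbb{R}_+$ with $\langle f, Hg\rangle = \int_{\mathbb{R}_+} \overline{f(i\lambda)}\,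 g(i\lambda)\, d\mu_H(\lambda)$ for all $f,g \in H^2(\mathbb{C}_+)$. $H^\infty(\mathbb{C}_+)$ is the Banach algebra of bounded holomorphic functions on $\mathbb{C}_+$, $H^\infty(\mathbb{C}_+)^\times$ is its group of invertible elements, and $g^*$ denotes the non-tangential boundary value function on $\mathbb{R}$ of $g$. An outer function on $\mathbb{C}_+$ is a holomorphic function of the form $$z \mapsto C\exp\Big(\frac{1}{\pi i}\int_{\mathbb{R}} \Big[\frac{1}{p-z} - \frac{p}{1+p^2}\Big]\log(k(p))\, dp\Big),$$ where $C \in \mathbb{C}$, $|C|=1$, and $k : \mathbb{R} \to \mathbb{R}_+$ satisfies $\int_{\mathbb{R}} \frac{|\log k(p)|}{1+p^2}\, dp < \infty$. *)

theory Defs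
  imports "HOL-Complex_Analysis.Complex_Analysis"
begin

definition upper_half_plane :: "complex set" where
  "upper_half_plane = {z. Im z > 0}"

text \<open>
  A function on the upper half plane is represented by a total function that is \<open>0\<close> elsewhere,
  so that two such functions coincide iff they coincide on the upper half plane.
\<close>

definition holo_upper :: "(complex \<Rightarrow> complex) set" where
  "holo_upper = {F. F holomorphic_on upper_half_plane \<and> (\<forall>z. z \<notin> upper_half_plane \<longrightarrow> F z = 0)}"

definition stolz_angle :: "real \<Rightarrow> real \<Rightarrow> complex set" where
  "stolz_angle a x = {z. Im z > 0 \<and> \<bar>Re z - x\<bar> < a * Im z}"

definition nt_limit :: "(complex \<Rightarrow> complex) \<Rightarrow> real \<Rightarrow> complex \<Rightarrow> bool" where
  "nt_limit F x l \<longleftrightarrow>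
     (\<forall>a>0. (F \<longlongrightarrow> l) (at (complex_of_real x) within stolz_angle a x))"

text \<open>The non-tangential boundary value function; unspecified where there is no such limit.\<close>

definition nt_boundary :: "(complex \<Rightarrow> complex) \<Rightarrow> real \<Rightarrow> complex" where
  "nt_boundary F x = (THE l. nt_limit F x l)"

text \<open>
  Elements of $L^2$ and $L^\infty$ are represented by Lebesgue measurable functions; these are
  never compared by equality, only almost everywhere.
\<close>

definition L2_inner :: "(real \<Rightarrow> complex) \<Rightarrow> (real \<Rightarrow> complex) \<Rightarrow> complex" where
  "L2_inner f g = (LINT x|lebesgue. cnj (f x) * g x)"

definition Linf :: "(real \<Rightarrow> complex) set" where
  "Linf = {h. h \<in> borel_measurable lebesgue \<and> (\<exists>B. AE x in lebesgue. cmod (h x) \<le> B)}"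

definition H2 :: "(complex \<Rightarrow> complex) set" where
  "H2 = {F \<in> holo_upper. \<exists>M. \<forall>y>0.
           integrable lebesgue (\<lambda>x. (cmod (F (Complex x y)))\<^sup>2) \<and>
           (LINT x|lebesgue. (cmod (F (Complex x y)))\<^sup>2) \<le> M}"

definition H2_inner :: "(complex \<Rightarrow> complex) \<Rightarrow> (complex \<Rightarrow> complex) \<Rightarrow> complex" where
  "H2_inner F G = L2_inner (nt_boundary F) (nt_boundary G)"

definition H2_norm :: "(complex \<Rightarrow> complex) \<Rightarrow> real" where
  "H2_norm F = sqrt (Re (H2_inner F F))"

text \<open>
  The orthogonal projection of $L^2$ onto the subspace of boundary functions of \<open>H2\<close>, with
  values understood as holomorphic functions.
\<close>

definition P_plus :: "(real \<Rightarrow> complex) \<Rightarrow> (complex \<Rightarrow> complex)" where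
  "P_plus f = (THE F. F \<in> H2 \<and>
     (\<forall>G\<in>H2. L2_inner (nt_boundary G) (\<lambda>x. f x - nt_boundary F x) = 0))"

definition reflect :: "(real \<Rightarrow> complex) \<Rightarrow> (real \<Rightarrow> complex)" where
  "reflect f = (\<lambda>x. f (- x))"

definition hankel :: "(real \<Rightarrow> complex) \<Rightarrow> (complex \<Rightarrow> complex) \<Rightarrow> (complex \<Rightarrow> complex)" where
  "hankel h F = P_plus (\<lambda>x. h x * reflect (nt_boundary F) x)"

text \<open>Operators on \<open>H2\<close> are total functions of which only the values on \<open>H2\<close> matter.\<close>

definition H2_bounded_operator :: "((complex \<Rightarrow> complex) \<Rightarrow> (complex \<Rightarrow> complex)) \<Rightarrow> bool" where
  "H2_bounded_operator T \<longleftrightarrow>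
     (\<forall>F\<in>H2. T F \<in> H2) \<and>
     (\<forall>F\<in>H2. \<forall>G\<in>H2. T (\<lambda>z. F z + G z) = (\<lambda>z. T F z + T G z)) \<and>
     (\<forall>F\<in>H2. \<forall>a. T (\<lambda>z. a * F z) = (\<lambda>z. a * T F z)) \<and>
     (\<exists>B. \<forall>F\<in>H2. H2_norm (T F) \<le> B * H2_norm F)"

definition hankel_operator :: "((complex \<Rightarrow> complex) \<Rightarrow> (complex \<Rightarrow> complex)) \<Rightarrow> bool" where
  "hankel_operator H \<longleftrightarrow>
     H2_bounded_operator H \<and> (\<exists>h\<in>Linf. \<forall>F\<in>H2. H F = hankel h F)"

definition positive_operator :: "((complex \<Rightarrow> complex) \<Rightarrow> (complex \<Rightarrow> complex)) \<Rightarrow> bool" where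
  "positive_operator T \<longleftrightarrow> (\<forall>F\<in>H2. H2_inner F (T F) \<in> \<real>\<^sub>\<ge>\<^sub>0)"

text \<open>
  Integrability is stated explicitly because the Bochner integral of a non-integrable function
  is \<open>0\<close>.
\<close>

definition carleson_measure ::
    "((complex \<Rightarrow> complex) \<Rightarrow> (complex \<Rightarrow> complex)) \<Rightarrow> real measure \<Rightarrow> bool" where
  "carleson_measure H \<mu> \<longleftrightarrow>
     sets \<mu> = sets (restrict_space borel {0<..}) \<and>
     (\<forall>F\<in>H2. \<forall>G\<in>H2.
        integrable \<mu> (\<lambda>t. cnj (F (\<i> * complex_of_real t)) * G (\<i> * complex_of_real t)) \<and>
        H2_inner F (H G) =
          (LINT t|\<mu>. cnj (F (\<i> * complex_of_real t)) * G (\<i> * complex_of_real t)))"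

definition hankel_symbol :: "real measure \<Rightarrow> real \<Rightarrow> complex" where
  "hankel_symbol \<mu> p =
     \<i> / complex_of_real pi * complex_of_real (LINT t|\<mu>. p / (t\<^sup>2 + p\<^sup>2))"

definition Hinf :: "(complex \<Rightarrow> complex) set" where
  "Hinf = {F \<in> holo_upper. \<exists>B. \<forall>z\<in>upper_half_plane. cmod (F z) \<le> B}"

definition Hinf_units :: "(complex \<Rightarrow> complex) set" where
  "Hinf_units = {g \<in> Hinf. \<exists>q\<in>Hinf. \<forall>z\<in>upper_half_plane. g z * q z = 1}"

text \<open>Measurability of \<open>k\<close> does not follow from integrability of \<open>\<bar>ln (k p)\<bar> / (1 + p\<^sup>2)\<close>.\<close>

definition outer_function :: "(complex \<Rightarrow> complex) \<Rightarrow> bool" where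
  "outer_function g \<longleftrightarrow>
     g holomorphic_on upper_half_plane \<and>
     (\<exists>C k. cmod C = 1 \<and> k \<in> borel_measurable lebesgue \<and> (\<forall>p. k p > 0) \<and>
        integrable lebesgue (\<lambda>p. \<bar>ln (k p)\<bar> / (1 + p\<^sup>2)) \<and>
        (\<forall>z\<in>upper_half_plane. g z =
           C * exp (1 / (complex_of_real pi * \<i>) *
             (LINT p|lebesgue.
                (1 / (complex_of_real p - z) - complex_of_real (p / (1 + p\<^sup>2)))
                  * complex_of_real (ln (k p))))))"

end

theory Submission
  imports Defs
begin

text \<open>
  The horizontal restrictions \<open>F\<^sub>y\<close> of \<open>F \<in> H2\<close> have scalar products depending only on the sum of the two
  heights, so their squared norms are midpoint convex and bounded, hence monotone, and \<open>F\<^sub>y\<close> converges in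
  \<open>L\<^sup>2\<close> to some \<open>f\<close>. Cauchy's formula passes to the limit and expresses \<open>F\<close> as the Poisson integral of
  \<open>f\<close>, and differentiability almost everywhere of a primitive of \<open>f\<close> gives the non-tangential limit \<open>f\<close>.

  Testing the Carleson measure on the reproducing kernels \<open>1 / (z + \<i> * s)\<close> bounds \<open>hankel_symbol \<mu>\<close>; it is
  purely imaginary, so \<open>\<bar>\<delta>\<bar> \<ge> \<bar>c\<bar>\<close>. By Fubini and Cauchy's formula \<open>H\<close> satisfies the orthogonality
  relations that characterise \<open>P_plus\<close> for the symbol \<open>\<delta>\<close>; the constant \<open>c\<close> drops out because products of
  two elements of \<open>H2\<close> have integral zero. The outer function is built from \<open>k = sqrt \<bar>\<delta>\<bar>\<close>: it is bounded
  with bounded inverse because \<open>log k\<close> is bounded, and its modulus tends to \<open>k\<close> at every point other than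
  \<open>0\<close>, where \<open>k\<close> is continuous.
\<close>

section \<open>Square-integrable functions\<close>

text \<open>\<open>nt_boundary\<close> and \<open>P_plus\<close> are definite descriptions, so they
  yield nothing until limits and projections are known to exist and to be unique. Hence the
  \<open>L^2\<close> theory is built on the auxiliary relation \<open>L2_boundary\<close> over
  \<open>lborel\<close>, and Fatou's theorem afterwards identifies its functions with
  \<open>nt_boundary\<close> almost everywhere. No projection has to be constructed:
  \<open>H F\<close> itself is the candidate, and Cauchy kernels show that there is no other.

  The factor \<open>i / pi\<close> in the symbol comes from a residue. The function
  \<open>p / (t^2 + p^2)\<close> is half the sum of the Cauchy kernels with poles \<open>i t\<close>
  and \<open>- i t\<close>. Against a product of two boundary functions only the pole
  \<open>i t\<close> contributes, namely \<open>pi i\<close> times the value of the product there,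
  and multiplication with \<open>i / pi\<close> leaves the factor \<open>-1\<close>. The reflection
  in \<open>hankel\<close> turns it into \<open>+1\<close>, because the symbol is odd.\<close>

definition sqint :: "(real \<Rightarrow> complex) \<Rightarrow> bool" where
  "sqint f \<longleftrightarrow> f \<in> borel_measurable borel \<and> integrable lborel (\<lambda>x. (cmod (f x))\<^sup>2)"

definition nsq :: "(real \<Rightarrow> complex) \<Rightarrow> real" where
  "nsq f = (LINT x|lborel. (cmod (f x))\<^sup>2)"

lemma sqint_measurable: "sqint f \<Longrightarrow> f \<in> borel_measurable borel"
  by (simp add: sqint_def)

lemma sqint_integrable: "sqint f \<Longrightarrow> integrable lborel (\<lambda>x. (cmod (f x))\<^sup>2)"
  by (simp add: sqint_def)

lemma nsq_nonneg [simp]: "0 \<le> nsq f"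
  by (simp add: nsq_def)

lemma sqint_mult_integrable:
  assumes "sqint f" "sqint g"
  shows "integrable lborel (\<lambda>x. f x * g x)"
proof (rule Bochner_Integration.integrable_bound)
  show "integrable lborel (\<lambda>x. (cmod (f x))\<^sup>2 + (cmod (g x))\<^sup>2)"
    using assms by (simp add: sqint_def)
  show "(\<lambda>x. f x * g x) \<in> borel_measurable lborel"
    using assms[THEN sqint_measurable] by simp
  have "cmod (f x) * cmod (g x) \<le> (cmod (f x))\<^sup>2 + (cmod (g x))\<^sup>2" for x
    using sum_squares_bound[of "cmod (f x)" "cmod (g x)"] mult_nonneg_nonneg[OF norm_ge_zero norm_ge_zero, of "f x" "g x"]
    by linarith
  then show "AE x in lborel. norm (f x * g x) \<le> norm ((cmod (f x))\<^sup>2 + (cmod (g x))\<^sup>2)"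
    by (simp add: norm_mult)
qed

lemma borel_measurable_cnj' [measurable]:
  "f \<in> borel_measurable M \<Longrightarrow> (\<lambda>x. cnj (f x)) \<in> borel_measurable M"
  by (rule borel_measurable_continuous_on[OF continuous_on_cnj[OF continuous_on_id]])

lemma sqint_cnj: "sqint f \<Longrightarrow> sqint (\<lambda>x. cnj (f x))"
  by (simp add: sqint_def borel_measurable_cnj')

lemma nsq_cnj [simp]: "nsq (\<lambda>x. cnj (f x)) = nsq f"
  by (simp add: nsq_def)

lemma sqint_add:
  assumes "sqint f" "sqint g"
  shows "sqint (\<lambda>x. f x + g x)"
  unfolding sqint_def
proof
  show "(\<lambda>x. f x + g x) \<in> borel_measurable borel"
    using assms[THEN sqint_measurable] by simp
  show "integrable lborel (\<lambda>x. (cmod (f x + g x))\<^sup>2)"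
  proof (rule Bochner_Integration.integrable_bound)
    show "integrable lborel (\<lambda>x. 2 * (cmod (f x))\<^sup>2 + 2 * (cmod (g x))\<^sup>2)"
      using assms by (simp add: sqint_def)
    show "(\<lambda>x. (cmod (f x + g x))\<^sup>2) \<in> borel_measurable lborel"
      using assms[THEN sqint_measurable] by simp
    have "(cmod (f x + g x))\<^sup>2 \<le> 2 * (cmod (f x))\<^sup>2 + 2 * (cmod (g x))\<^sup>2" for x
    proof -
      have "(cmod (f x + g x))\<^sup>2 \<le> (cmod (f x) + cmod (g x))\<^sup>2"
        by (simp add: norm_triangle_ineq power_mono)
      also have "\<dots> \<le> 2 * (cmod (f x))\<^sup>2 + 2 * (cmod (g x))\<^sup>2"
        using sum_squares_bound[of "cmod (f x)" "cmod (g x)"] by (simp add: power2_sum)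
      finally show ?thesis .
    qed
    then show "AE x in lborel. norm ((cmod (f x + g x))\<^sup>2) \<le> norm (2 * (cmod (f x))\<^sup>2 + 2 * (cmod (g x))\<^sup>2)"
      by simp
  qed
qed

lemma sqint_cmult: "sqint f \<Longrightarrow> sqint (\<lambda>x. a * f x)"
  by (auto simp add: sqint_def norm_mult power_mult_distrib)

lemma sqint_diff: "sqint f \<Longrightarrow> sqint g \<Longrightarrow> sqint (\<lambda>x. f x - g x)"
  using sqint_add[of f "\<lambda>x. (-1) * g x"] sqint_cmult[of g "-1"] by simp

lemma sqint_bounded_mult:
  assumes "sqint f" "h \<in> borel_measurable lborel" "AE x in lborel. cmod (h x) \<le> B"
  shows "sqint (\<lambda>x. h x * f x)"
  unfolding sqint_def
proof
  show m[measurable]: "(\<lambda>x. h x * f x) \<in> borel_measurable borel"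
    using sqint_measurable[OF assms(1)] assms(2) by simp
  show "integrable lborel (\<lambda>x. (cmod (h x * f x))\<^sup>2)"
  proof (rule Bochner_Integration.integrable_bound)
    show "integrable lborel (\<lambda>x. B\<^sup>2 * (cmod (f x))\<^sup>2)"
      using assms by (simp add: sqint_def)
    show "(\<lambda>x. (cmod (h x * f x))\<^sup>2) \<in> borel_measurable lborel"
      using m by simp
    show "AE x in lborel. norm ((cmod (h x * f x))\<^sup>2) \<le> norm (B\<^sup>2 * (cmod (f x))\<^sup>2)"
      using assms(3)
      by eventually_elim (simp add: norm_mult power_mult_distrib mult_right_mono power_mono)
  qed
qed

text \<open>Cauchy-Schwarz, carried over from nonnegative integrals; it provides the
  \<open>L^1\<close> bounds on horizontal lines that the contour arguments need.\<close>

lemma integral_cmod_mult_le: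
  assumes "sqint f" "sqint g"
  shows "(LINT x|lborel. cmod (f x * g x)) \<le> sqrt (nsq f) * sqrt (nsq g)"
proof -
  have i: "integrable lborel (\<lambda>x. cmod (f x) * cmod (g x))"
    using integrable_norm[OF sqint_mult_integrable[OF assms]] by (simp add: norm_mult)
  have nn: "(\<integral>\<^sup>+x. (ennreal (cmod (h x)))\<^sup>2 \<partial>lborel) = ennreal (nsq h)" if "sqint h" for h
    using nn_integral_eq_integral[OF sqint_integrable[OF that]]
    by (simp add: nsq_def ennreal_power)
  have "(\<integral>\<^sup>+x. ennreal (cmod (f x)) * ennreal (cmod (g x)) \<partial>lborel)\<^sup>2 \<le> ennreal (nsq f) * ennreal (nsq g)"
    using assms by (subst (1 2) nn[symmetric]) (auto intro!: Cauchy_Schwarz_nn_integral simp: sqint_def)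
  also have "(\<integral>\<^sup>+x. ennreal (cmod (f x)) * ennreal (cmod (g x)) \<partial>lborel)
      = ennreal (LINT x|lborel. cmod (f x) * cmod (g x))"
    using i by (subst nn_integral_eq_integral[symmetric]) (auto simp: ennreal_mult)
  finally have "(LINT x|lborel. cmod (f x) * cmod (g x))\<^sup>2 \<le> nsq f * nsq g"
    by (subst (asm) ennreal_power) (auto simp: ennreal_mult[symmetric])
  then have "(LINT x|lborel. cmod (f x) * cmod (g x)) \<le> sqrt (nsq f * nsq g)"
    by (rule real_le_rsqrt)
  then show ?thesis by (simp add: norm_mult real_sqrt_mult)
qed

text \<open>For two slices of one function in \<open>H2\<close> the cross term is again a squared
  norm, so distances between slices are governed by a single real function of the height.\<close>

lemma nsq_diff:
  assumes "sqint f" "sqint g"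
  shows "nsq (\<lambda>x. f x - g x) = nsq f + nsq g - 2 * Re (LINT x|lborel. cnj (f x) * g x)"
proof -
  have i: "integrable lborel (\<lambda>x. cnj (f x) * g x)"
    using assms by (intro sqint_mult_integrable sqint_cnj)
  have *: "(cmod (a - b))\<^sup>2 = (cmod a)\<^sup>2 + (cmod b)\<^sup>2 - 2 * Re (cnj a * b)" for a b
    unfolding cmod_power2 by (simp add: power2_eq_square algebra_simps)
  have "nsq (\<lambda>x. f x - g x)
      = (LINT x|lborel. ((cmod (f x))\<^sup>2 + (cmod (g x))\<^sup>2) - 2 * Re (cnj (f x) * g x))"
    unfolding nsq_def * ..
  also have "\<dots> = (LINT x|lborel. (cmod (f x))\<^sup>2 + (cmod (g x))\<^sup>2) - (LINT x|lborel. 2 * Re (cnj (f x) * g x))"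
    using assms[THEN sqint_integrable] i
    by (intro Bochner_Integration.integral_diff Bochner_Integration.integrable_add
        integrable_mult_right integrable_Re)
  also have "(LINT x|lborel. 2 * Re (cnj (f x) * g x)) = 2 * Re (LINT x|lborel. cnj (f x) * g x)"
    unfolding integral_mult_right_zero integral_Re[OF i] ..
  also have "(LINT x|lborel. (cmod (f x))\<^sup>2 + (cmod (g x))\<^sup>2) = nsq f + nsq g"
    using assms[THEN sqint_integrable] by (simp add: nsq_def)
  finally show ?thesis .
qed

lemma sqint_reflect:
  assumes "sqint f"
  shows "sqint (\<lambda>x. f (- x))"
  using assms lborel_integrable_real_affine[of "\<lambda>x. (cmod (f x))\<^sup>2" "-1" 0]
  by (auto simp: sqint_def)

section \<open>Contour integrals over horizontal strips\<close>

lemma contour_integral_linepath_same_Im: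
  assumes "c < d"
  shows "contour_integral (linepath (Complex c a) (Complex d a)) f = integral {c..d} (\<lambda>x. f (Complex x a))"
proof -
  define w where "w = \<i> * complex_of_real a"
  have eq: "Complex x a = complex_of_real x + w" for x
    by (simp add: w_def complex_eq_iff)
  have "linepath (Complex c a) (Complex d a) t = linepath (complex_of_real c) (complex_of_real d) t + w" for t
    by (simp add: linepath_def eq scaleR_conv_of_real algebra_simps)
  then have "contour_integral (linepath (Complex c a) (Complex d a)) f
      = contour_integral (linepath (complex_of_real c) (complex_of_real d)) (\<lambda>z. f (z + w))"
    unfolding contour_integral_integral by (simp add: eq)
  also have "\<dots> = integral {c..d} (\<lambda>x. f (Complex x a))"
    using assms by (subst contour_integral_linepath_Reals_eq) (auto simp: eq)
  finally show ?thesis .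
qed

lemma contour_integral_rectpath:
  assumes "a < b" "c < d" and cont: "continuous_on (path_image (rectpath (Complex c a) (Complex d b))) K"
  shows "contour_integral (rectpath (Complex c a) (Complex d b)) K =
    integral {c..d} (\<lambda>x. K (Complex x a)) + \<i> * integral {a..b} (\<lambda>y. K (Complex d y))
    - integral {c..d} (\<lambda>x. K (Complex x b)) - \<i> * integral {a..b} (\<lambda>y. K (Complex c y))"
proof -
  let ?z1 = "Complex c a" and ?z2 = "Complex d a" and ?z3 = "Complex d b" and ?z4 = "Complex c b"
  have pi: "path_image (rectpath ?z1 ?z3) = closed_segment ?z1 ?z2 \<union> closed_segment ?z2 ?z3
      \<union> closed_segment ?z3 ?z4 \<union> closed_segment ?z4 ?z1"
    by (simp add: rectpath_def Let_def path_image_join Un_assoc)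
  have cs: "continuous_on (closed_segment ?z1 ?z2) K" "continuous_on (closed_segment ?z2 ?z3) K"
      "continuous_on (closed_segment ?z3 ?z4) K" "continuous_on (closed_segment ?z4 ?z1) K"
    using cont unfolding pi by (auto elim: continuous_on_subset)
  note ci = cs[THEN contour_integrable_continuous_linepath]
  have "contour_integral (rectpath ?z1 ?z3) K = contour_integral (linepath ?z1 ?z2) K
      + (contour_integral (linepath ?z2 ?z3) K + (contour_integral (linepath ?z3 ?z4) K + contour_integral (linepath ?z4 ?z1) K))"
    using ci by (simp add: rectpath_def Let_def)
  also have "contour_integral (linepath ?z3 ?z4) K = - contour_integral (linepath ?z4 ?z3) K"
    by (rule contour_integral_reverse_linepath[OF cs(3)])
  also have "contour_integral (linepath ?z4 ?z1) K = - contour_integral (linepath ?z1 ?z4) K"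
    by (rule contour_integral_reverse_linepath[OF cs(4)])
  finally show ?thesis
    using assms(1,2) by (simp add: contour_integral_linepath_same_Im contour_integral_linepath_same_Re)
qed

lemma tendsto_integral_symmetric_interval:
  fixes f :: "real \<Rightarrow> 'a::{banach, second_countable_topology}"
  assumes "integrable lborel f"
  shows "((\<lambda>R. LINT x|lborel. indicator {-R..R} x *\<^sub>R f x) \<longlongrightarrow> integral\<^sup>L lborel f) at_top"
proof (rule integral_dominated_convergence_at_top)
  show "f \<in> borel_measurable lborel" "integrable lborel (\<lambda>x. norm (f x))"
    using assms by auto
  show "(\<lambda>x. indicator {-R..R} x *\<^sub>R f x) \<in> borel_measurable lborel" for R
    using assms by auto
  show "\<forall>\<^sub>F R in at_top. AE x in lborel. norm (indicator {-R..R} x *\<^sub>R f x) \<le> norm (f x)"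
    by (auto simp: indicator_def)
  show "AE x in lborel. ((\<lambda>R. indicator {-R..R} x *\<^sub>R f x) \<longlongrightarrow> f x) at_top"
  proof (rule AE_I2)
    fix x :: real
    have "\<forall>\<^sub>F R in at_top. indicator {-R..R} x *\<^sub>R f x = f x"
      using eventually_ge_at_top[of "\<bar>x\<bar>"] by eventually_elim (auto simp: indicator_def)
    then show "((\<lambda>R. indicator {-R..R} x *\<^sub>R f x) \<longlongrightarrow> f x) at_top"
      by (rule tendsto_eventually)
  qed
qed

lemma emeasure_lborel_atLeast: "emeasure lborel {m::real..} = \<infinity>"
proof (rule ccontr)
  assume "\<not> ?thesis"
  then obtain n :: nat where "emeasure lborel {m..} < of_nat n"
    using ennreal_Ex_less_of_nat by (auto simp: less_top)
  moreover have "of_nat n = emeasure lborel {m..m + real n}"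
    by (simp add: ennreal_of_nat_eq_real_of_nat)
  moreover have "\<dots> \<le> emeasure lborel {m..}"
    by (intro emeasure_mono) auto
  ultimately show False by simp
qed

text \<open>The vertical sides of the rectangles cannot stay bounded away from zero, by Tonelli's theorem;
  \<open>u\<close> dominates \<open>K\<close> away from a possible pole.\<close>

lemma strip_contour_integral:
  fixes K u :: "complex \<Rightarrow> complex"
  assumes ab: "a < b"
    and contu: "continuous_on {z. a \<le> Im z \<and> Im z \<le> b} u"
    and uint: "\<And>y. a \<le> y \<Longrightarrow> y \<le> b \<Longrightarrow> integrable lborel (\<lambda>x. u (Complex x y))"
    and ubound: "\<And>y. a \<le> y \<Longrightarrow> y \<le> b \<Longrightarrow> (LINT x|lborel. cmod (u (Complex x y))) \<le> C"
    and Ka: "integrable lborel (\<lambda>x. K (Complex x a))"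
    and Kb: "integrable lborel (\<lambda>x. K (Complex x b))"
    and Ku: "\<And>z. a \<le> Im z \<Longrightarrow> Im z \<le> b \<Longrightarrow> \<bar>Re z\<bar> \<ge> r \<Longrightarrow> cmod (K z) \<le> cmod (u z)"
    and W: "\<And>R. R \<ge> r \<Longrightarrow> (K has_contour_integral W) (rectpath (Complex (-R) a) (Complex R b))"
    and contK: "\<And>R. R \<ge> r \<Longrightarrow> continuous_on (path_image (rectpath (Complex (-R) a) (Complex R b))) K"
    and r: "r > 0"
  shows "(LINT x|lborel. K (Complex x a)) - (LINT x|lborel. K (Complex x b)) = W"
proof (rule ccontr)
  assume neq: "\<not> ?thesis"
  let ?L = "(LINT x|lborel. K (Complex x a)) - (LINT x|lborel. K (Complex x b))"
  define S where "S = (\<lambda>R. (LINT x|lborel. indicator {-R..R} x *\<^sub>R K (Complex x a)) - (LINT x|lborel. indicator {-R..R} x *\<^sub>R K (Complex x b)))"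
  \<comment> \<open>\<open>u\<close> is continuous on the closed strip only; extended by
    \<open>0\<close> it is Borel on the whole plane, as Tonelli's theorem requires.\<close>
  define u' where "u' = (\<lambda>z. indicator {z. a \<le> Im z \<and> Im z \<le> b} z *\<^sub>R u z)"
  have closed: "closed {z. a \<le> Im z \<and> Im z \<le> b}"
    by (auto intro!: closed_Collect_conj closed_Collect_le continuous_intros)
  have u'm [measurable]: "u' \<in> borel_measurable borel"
    unfolding u'_def using closed contu
    by (intro borel_measurable_continuous_on_indicator) auto
  define v where "v = (\<lambda>R. \<integral>\<^sup>+y. ennreal (cmod (u' (Complex R y))) \<partial>lborel)"
  have cm [measurable]: "(\<lambda>p. u' (Complex (fst p) (snd p))) \<in> borel_measurable (borel \<Otimes>\<^sub>M borel)"
  proof -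
    have "(\<lambda>p. Complex (fst p) (snd p)) \<in> borel_measurable (borel \<Otimes>\<^sub>M borel)"
      unfolding borel_prod by (intro borel_measurable_continuous_onI) (auto simp: Complex_eq intro!: continuous_intros)
    then show ?thesis by simp
  qed
  have cm2 [measurable]: "(\<lambda>p. ennreal (cmod (u' (Complex (fst p) (snd p))))) \<in> borel_measurable (lborel \<Otimes>\<^sub>M lborel)"
    using cm by simp
  have vm [measurable]: "v \<in> borel_measurable lborel"
    using lborel.borel_measurable_nn_integral_fst[OF cm2] by (simp add: v_def)
  have "(\<integral>\<^sup>+R. v R \<partial>lborel) = (\<integral>\<^sup>+y. \<integral>\<^sup>+R. ennreal (cmod (u' (Complex R y))) \<partial>lborel \<partial>lborel)"
    unfolding v_def using cm2 by (intro lborel_pair.Fubini'[symmetric]) (simp add: case_prod_beta')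
  also have "\<dots> \<le> (\<integral>\<^sup>+y. ennreal C * indicator {a..b} y \<partial>lborel)"
  proof (rule nn_integral_mono)
    fix y :: real
    show "(\<integral>\<^sup>+R. ennreal (cmod (u' (Complex R y))) \<partial>lborel) \<le> ennreal C * indicator {a..b} y"
    proof (cases "y \<in> {a..b}")
      case True
      then have "(\<integral>\<^sup>+R. ennreal (cmod (u' (Complex R y))) \<partial>lborel) = ennreal (LINT x|lborel. cmod (u (Complex x y)))"
        using uint[of y] by (simp add: u'_def nn_integral_eq_integral)
      then show ?thesis using True ubound[of y] by (simp add: ennreal_leI)
    qed (auto simp: u'_def)
  qed
  also have "\<dots> < \<infinity>"
    by (simp add: nn_integral_cmult_indicator ennreal_mult_less_top emeasure_lborel_Icc_eq)
  finally have vfin: "(\<integral>\<^sup>+R. v R \<partial>lborel) < \<infinity>" .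
  have vfin': "(\<integral>\<^sup>+R. v (-R) \<partial>lborel) = (\<integral>\<^sup>+R. v R \<partial>lborel)"
    using nn_integral_real_affine[of v "-1" 0] by simp
  have side: "ennreal (cmod (integral {a..b} (\<lambda>y. K (Complex R y)))) \<le> v R"
    if "\<bar>R\<bar> \<ge> r" "continuous_on {a..b} (\<lambda>y. K (Complex R y))" for R
  proof -
    have si: "set_integrable lborel {a..b} (\<lambda>y. K (Complex R y))"
      using that(2) by (rule borel_integrable_atLeastAtMost')
    have "cmod (integral {a..b} (\<lambda>y. K (Complex R y))) = cmod (LINT y|lborel. indicator {a..b} y *\<^sub>R K (Complex R y))"
      using set_borel_integral_eq_integral(2)[OF si] by (simp add: set_lebesgue_integral_def)
    also have "ennreal \<dots> \<le> (\<integral>\<^sup>+y. norm (indicator {a..b} y *\<^sub>R K (Complex R y)) \<partial>lborel)"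
      using si unfolding set_integrable_def by (rule integral_norm_bound_ennreal)
    also have "\<dots> \<le> v R"
      unfolding v_def using that(1) Ku
      by (intro nn_integral_mono ennreal_leI) (auto simp: u'_def indicator_def)
    finally show ?thesis .
  qed
  have bound: "ennreal (cmod (S R - W)) \<le> v R + v (-R)" if R: "R \<ge> r" for R
  proof -
    have "R > 0" using R r by simp
    have pi: "path_image (rectpath (Complex (-R) a) (Complex R b)) =
      {z. Re z \<in> {-R, R} \<and> Im z \<in> {a..b}} \<union> {z. Im z \<in> {a, b} \<and> Re z \<in> {-R..R}}"
      using ab \<open>R > 0\<close> by (subst path_image_rectpath) auto
    note ck = contK[OF R, unfolded pi]
    have ch: "continuous_on {-R..R} (\<lambda>x. K (Complex x y))" if "y = a \<or> y = b" for y
      by (rule continuous_on_compose2[OF ck]) (use that in \<open>auto simp: Complex_eq intro!: continuous_intros\<close>)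
    have cv: "continuous_on {a..b} (\<lambda>y. K (Complex x y))" if "x = R \<or> x = -R" for x
      by (rule continuous_on_compose2[OF ck]) (use that in \<open>auto simp: Complex_eq intro!: continuous_intros\<close>)
    have hor: "integral {-R..R} (\<lambda>x. K (Complex x y)) = (LINT x|lborel. indicator {-R..R} x *\<^sub>R K (Complex x y))" if "y = a \<or> y = b" for y
      using set_borel_integral_eq_integral(2)[OF borel_integrable_atLeastAtMost'[OF ch[OF that]]]
      by (simp add: set_lebesgue_integral_def)
    have "W = contour_integral (rectpath (Complex (-R) a) (Complex R b)) K"
      using W[OF R] by (rule contour_integral_unique[symmetric])
    also have "\<dots> = S R + \<i> * integral {a..b} (\<lambda>y. K (Complex R y)) - \<i> * integral {a..b} (\<lambda>y. K (Complex (-R) y))"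
      using \<open>R > 0\<close> ab contK[OF R] by (subst contour_integral_rectpath) (auto simp: hor S_def)
    finally have "S R - W = \<i> * integral {a..b} (\<lambda>y. K (Complex (-R) y)) - \<i> * integral {a..b} (\<lambda>y. K (Complex R y))"
      by simp
    then have "cmod (S R - W) \<le> cmod (integral {a..b} (\<lambda>y. K (Complex (-R) y))) + cmod (integral {a..b} (\<lambda>y. K (Complex R y)))"
      using norm_triangle_ineq4[of "\<i> * integral {a..b} (\<lambda>y. K (Complex (-R) y))" "\<i> * integral {a..b} (\<lambda>y. K (Complex R y))"]
      by (simp add: norm_mult)
    then have "ennreal (cmod (S R - W)) \<le> ennreal (cmod (integral {a..b} (\<lambda>y. K (Complex R y)))) + ennreal (cmod (integral {a..b} (\<lambda>y. K (Complex (-R) y))))"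
      by (simp add: add.commute flip: ennreal_plus)
    also have "\<dots> \<le> v R + v (-R)"
      using R r cv by (intro add_mono side) auto
    finally show ?thesis .
  qed
  \<comment> \<open>If the limit \<open>?L\<close> of the horizontal parts missed \<open>W\<close>,
    then \<open>S R - W\<close>, which consists of the two vertical sides, would exceed
    \<open>e\<close> in modulus for all large \<open>R\<close>, and \<open>v R + v (- R)\<close>
    would have infinite integral.\<close>
  define e where "e = cmod (?L - W) / 2"
  have "e > 0" using neq by (simp add: e_def)
  have "(S \<longlongrightarrow> ?L) at_top"
    unfolding S_def by (intro tendsto_diff tendsto_integral_symmetric_interval Ka Kb)
  then have "((\<lambda>R. cmod (S R - W)) \<longlongrightarrow> cmod (?L - W)) at_top"
    by (intro tendsto_intros)
  moreover have "e < cmod (?L - W)" using \<open>e > 0\<close> by (simp add: e_def)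
  ultimately have "\<forall>\<^sub>F R in at_top. e < cmod (S R - W)"
    by (rule order_tendstoD(1))
  then obtain r1 where r1: "\<And>R. R \<ge> r1 \<Longrightarrow> e < cmod (S R - W)"
    by (auto simp: eventually_at_top_linorder)
  have "\<infinity> = (\<integral>\<^sup>+R. ennreal e * indicator {max r r1..} R \<partial>lborel)"
    using \<open>e > 0\<close> by (simp add: nn_integral_cmult_indicator emeasure_lborel_atLeast ennreal_mult_top)
  also have "\<dots> \<le> (\<integral>\<^sup>+R. v R + v (-R) \<partial>lborel)"
  proof (rule nn_integral_mono)
    fix R :: real
    show "ennreal e * indicator {max r r1..} R \<le> v R + v (-R)"
    proof (cases "R \<ge> max r r1")
      case True
      then have "ennreal e \<le> ennreal (cmod (S R - W))"
        using r1[of R] by (intro ennreal_leI) auto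
      also have "\<dots> \<le> v R + v (-R)"
        using bound[of R] True by auto
      finally show ?thesis using True by simp
    qed auto
  qed
  also have "\<dots> < \<infinity>"
    using vfin vfin' by (subst nn_integral_add) auto
  finally show False by simp
qed

lemma tendsto_const_divide_at_top: "((\<lambda>b. C / (b - c)) \<longlongrightarrow> 0) at_top" for C c :: real
proof -
  have "filterlim (\<lambda>b. - c + b) at_top at_top"
    by (intro filterlim_tendsto_add_at_top[OF tendsto_const] filterlim_ident)
  then show ?thesis
    by (intro tendsto_divide_0[OF tendsto_const] filterlim_at_top_imp_at_infinity) simp
qed

lemma convex_strip: "convex {z. \<alpha> < Im z \<and> Im z < \<beta>}"
proof -
  have "{z. \<alpha> < Im z \<and> Im z < \<beta>} = {z. Im z > \<alpha>} \<inter> {z. Im z < \<beta>}" by auto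
  then show ?thesis by (simp add: convex_Int convex_halfspace_Im_gt convex_halfspace_Im_lt)
qed

lemma open_strip: "open {z. \<alpha> < Im z \<and> Im z < \<beta>}"
  by (auto intro!: open_Collect_conj open_Collect_less continuous_intros)

lemma path_image_rectpath_strip:
  assumes "a \<le> b" "R \<ge> 0" "\<alpha> < a" "b < \<beta>"
  shows "path_image (rectpath (Complex (-R) a) (Complex R b)) \<subseteq> {z. \<alpha> < Im z \<and> Im z < \<beta>}"
  using assms by (subst path_image_rectpath) auto

section \<open>Cauchy's theorem and formula on strips and in the half plane\<close>

lemma strip_shift:
  assumes ab: "a < b" "\<alpha> < a" "b < \<beta>"
    and hol: "u holomorphic_on {z. \<alpha> < Im z \<and> Im z < \<beta>}"
    and uint: "\<And>y. a \<le> y \<Longrightarrow> y \<le> b \<Longrightarrow> integrable lborel (\<lambda>x. u (Complex x y))"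
    and ubound: "\<And>y. a \<le> y \<Longrightarrow> y \<le> b \<Longrightarrow> (LINT x|lborel. cmod (u (Complex x y))) \<le> C"
  shows "(LINT x|lborel. u (Complex x a)) = (LINT x|lborel. u (Complex x b))"
proof -
  have "(LINT x|lborel. u (Complex x a)) - (LINT x|lborel. u (Complex x b)) = 0"
  proof (rule strip_contour_integral[where u = u and r = 1])
    show "continuous_on {z. a \<le> Im z \<and> Im z \<le> b} u"
      using ab by (intro holomorphic_on_imp_continuous_on[OF holomorphic_on_subset[OF hol]]) auto
    fix R :: real assume "1 \<le> R"
    then have sub: "path_image (rectpath (Complex (-R) a) (Complex R b)) \<subseteq> {z. \<alpha> < Im z \<and> Im z < \<beta>}"
      using ab by (intro path_image_rectpath_strip) auto
    show "(u has_contour_integral 0) (rectpath (Complex (-R) a) (Complex R b))"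
      by (rule Cauchy_theorem_convex_simple[OF hol convex_strip _ sub]) auto
    show "continuous_on (path_image (rectpath (Complex (-R) a) (Complex R b))) u"
      by (rule holomorphic_on_imp_continuous_on[OF holomorphic_on_subset[OF hol sub]])
  qed (use ab uint ubound in auto)
  then show ?thesis by simp
qed

lemma
  fixes u :: "complex \<Rightarrow> complex"
  assumes u: "integrable lborel (\<lambda>x. u (Complex x y))" and w: "Im w \<noteq> y"
  shows integrable_slice_divide: "integrable lborel (\<lambda>x. u (Complex x y) / (Complex x y - w))"
    and integral_slice_divide_le: "(LINT x|lborel. cmod (u (Complex x y) / (Complex x y - w)))
      \<le> (LINT x|lborel. cmod (u (Complex x y))) / \<bar>y - Im w\<bar>"
proof -
  have le: "cmod (u (Complex x y) / (Complex x y - w)) \<le> cmod (u (Complex x y)) / \<bar>y - Im w\<bar>" for x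
    using abs_Im_le_cmod[of "Complex x y - w"] w
    by (auto simp: norm_divide intro!: divide_left_mono mult_pos_pos)
  have "(\<lambda>x. Complex x y - w) \<in> borel_measurable borel"
    by (intro borel_measurable_continuous_onI) (auto simp: Complex_eq intro!: continuous_intros)
  then have m: "(\<lambda>x. u (Complex x y) / (Complex x y - w)) \<in> borel_measurable lborel"
    using u by auto
  show 1: "integrable lborel (\<lambda>x. u (Complex x y) / (Complex x y - w))"
  proof (rule Bochner_Integration.integrable_bound[OF _ m])
    show "integrable lborel (\<lambda>x. cmod (u (Complex x y)) / \<bar>y - Im w\<bar>)"
      using u by auto
    show "AE x in lborel. norm (u (Complex x y) / (Complex x y - w)) \<le> norm (cmod (u (Complex x y)) / \<bar>y - Im w\<bar>)"
      using le by (auto intro!: AE_I2)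
  qed
  have "(LINT x|lborel. cmod (u (Complex x y) / (Complex x y - w))) \<le> (LINT x|lborel. cmod (u (Complex x y)) / \<bar>y - Im w\<bar>)"
    using le u 1 by (intro integral_mono) auto
  then show "(LINT x|lborel. cmod (u (Complex x y) / (Complex x y - w)))
      \<le> (LINT x|lborel. cmod (u (Complex x y))) / \<bar>y - Im w\<bar>" by simp
qed

lemma strip_cauchy:
  assumes ab: "a < Im w" "Im w < b" "\<alpha> < a" "b < \<beta>"
    and hol: "u holomorphic_on {z. \<alpha> < Im z \<and> Im z < \<beta>}"
    and uint: "\<And>y. a \<le> y \<Longrightarrow> y \<le> b \<Longrightarrow> integrable lborel (\<lambda>x. u (Complex x y))"
    and ubound: "\<And>y. a \<le> y \<Longrightarrow> y \<le> b \<Longrightarrow> (LINT x|lborel. cmod (u (Complex x y))) \<le> C"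
  shows "(LINT x|lborel. u (Complex x a) / (Complex x a - w)) - (LINT x|lborel. u (Complex x b) / (Complex x b - w))
    = 2 * pi * \<i> * u w"
proof (rule strip_contour_integral[where u = u and r = "\<bar>Re w\<bar> + 1"])
  show "a < b" using ab by simp
  show "continuous_on {z. a \<le> Im z \<and> Im z \<le> b} u"
    using ab by (intro holomorphic_on_imp_continuous_on[OF holomorphic_on_subset[OF hol]]) auto
  show "integrable lborel (\<lambda>x. u (Complex x a) / (Complex x a - w))"
    "integrable lborel (\<lambda>x. u (Complex x b) / (Complex x b - w))"
    using uint ab by (auto intro!: integrable_slice_divide)
  \<comment> \<open>The choice of \<open>r\<close> keeps these points at distance at least
    \<open>1\<close> from the pole, so \<open>u\<close> itself is a majorant of the
    quotient.\<close>
  show "cmod (u z / (z - w)) \<le> cmod (u z)" if "\<bar>Re z\<bar> \<ge> \<bar>Re w\<bar> + 1" for z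
  proof -
    have "1 \<le> cmod (z - w)" using abs_Re_le_cmod[of "z - w"] that by auto
    then have "cmod (u z) / cmod (z - w) \<le> cmod (u z) / 1"
      by (intro divide_left_mono) auto
    then show ?thesis by (simp add: norm_divide)
  qed
  fix R :: real assume R: "\<bar>Re w\<bar> + 1 \<le> R"
  then have sub: "path_image (rectpath (Complex (-R) a) (Complex R b)) \<subseteq> {z. \<alpha> < Im z \<and> Im z < \<beta>}"
    using ab by (intro path_image_rectpath_strip) auto
  have win: "w \<notin> path_image (rectpath (Complex (-R) a) (Complex R b))"
    using ab R by (subst path_image_rectpath) auto
  have "((\<lambda>z. u z / (z - w)) has_contour_integral
      (2 * pi * \<i> * winding_number (rectpath (Complex (-R) a) (Complex R b)) w * u w)) (rectpath (Complex (-R) a) (Complex R b))"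
    using sub win ab by (intro Cauchy_integral_formula_convex_simple[OF convex_strip hol])
      (auto simp: interior_open[OF open_strip])
  moreover have "winding_number (rectpath (Complex (-R) a) (Complex R b)) w = 1"
    using ab R by (intro winding_number_rectpath) (auto simp: in_box_complex_iff)
  ultimately show "((\<lambda>z. u z / (z - w)) has_contour_integral (2 * pi * \<i> * u w)) (rectpath (Complex (-R) a) (Complex R b))"
    by simp
  show "continuous_on (path_image (rectpath (Complex (-R) a) (Complex R b))) (\<lambda>z. u z / (z - w))"
    using win by (intro continuous_intros holomorphic_on_imp_continuous_on[OF holomorphic_on_subset[OF hol sub]]) auto
qed (use uint ubound in auto)

text \<open>The upper edge of the strip is sent to infinity: at height \<open>b\<close> the
  \<open>L^1\<close> norm stays below \<open>C\<close>, while the kernel is at most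
  \<open>1 / (b - Im w')\<close>.\<close>

lemma upper_cauchy:
  assumes hol: "u holomorphic_on upper_half_plane"
    and uint: "\<And>y. y > 0 \<Longrightarrow> integrable lborel (\<lambda>x. u (Complex x y))"
    and ubound: "\<And>y. y > 0 \<Longrightarrow> (LINT x|lborel. cmod (u (Complex x y))) \<le> C"
    and y: "y > 0" and w: "Im w > 0"
  shows "(LINT x|lborel. u (Complex x y) / (complex_of_real x - w)) = 2 * pi * \<i> * u (w + \<i> * y)"
proof -
  \<comment> \<open>Lifting the pole by the height \<open>y\<close> of the line leaves the kernel
    \<open>1 / (x - w)\<close> independent of \<open>y\<close>, which the limit \<open>y\<close> to
    \<open>0\<close> relies on later.\<close>
  define w' where "w' = w + \<i> * complex_of_real y"
  have w': "Im w' = Im w + y" by (simp add: w'_def)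
  have eq: "(LINT x|lborel. u (Complex x y) / (complex_of_real x - w)) = (LINT x|lborel. u (Complex x y) / (Complex x y - w'))"
    by (simp add: w'_def Complex_eq)
  let ?D = "(LINT x|lborel. u (Complex x y) / (Complex x y - w')) - 2 * pi * \<i> * u w'"
  have "0 \<le> (LINT x|lborel. cmod (u (Complex x y)))"
    by (rule Bochner_Integration.integral_nonneg) simp
  then have C: "0 \<le> C" using ubound[OF y] by linarith
  have D: "cmod ?D \<le> C / (b - Im w')" if b: "b > Im w'" for b
  proof -
    have hol': "u holomorphic_on {z. 0 < Im z \<and> Im z < b + 1}"
      using hol by (rule holomorphic_on_subset) (auto simp: upper_half_plane_def)
    have "?D = (LINT x|lborel. u (Complex x b) / (Complex x b - w'))"
      using strip_cauchy[OF _ b y _ hol', of C] w w' y uint ubound by (simp add: algebra_simps)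
    also have "cmod \<dots> \<le> (LINT x|lborel. cmod (u (Complex x b) / (Complex x b - w')))"
      by (rule integral_norm_bound)
    also have "\<dots> \<le> (LINT x|lborel. cmod (u (Complex x b))) / \<bar>b - Im w'\<bar>"
      using b w w' y by (intro integral_slice_divide_le uint) auto
    also have "\<dots> \<le> C / (b - Im w')"
      using b ubound[of b] w w' y by (auto intro!: divide_right_mono)
    finally show ?thesis .
  qed
  have "((\<lambda>b. C / (b - Im w')) \<longlongrightarrow> 0) at_top"
    by (rule tendsto_const_divide_at_top)
  moreover have "\<forall>\<^sub>F b in at_top. cmod ?D \<le> C / (b - Im w')"
    using eventually_gt_at_top[of "Im w'"] by eventually_elim (rule D)
  ultimately have "cmod ?D \<le> 0"
    by (intro tendsto_lowerbound) auto
  then show ?thesis by (simp add: eq w'_def)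
qed

text \<open>The pole lies below the line, so the quotient itself is holomorphic from there upwards.
  Its integral does not change with the height and becomes arbitrarily small at large
  heights.\<close>

lemma upper_cauchy_outside:
  assumes hol: "u holomorphic_on upper_half_plane"
    and uint: "\<And>y. y > 0 \<Longrightarrow> integrable lborel (\<lambda>x. u (Complex x y))"
    and ubound: "\<And>y. y > 0 \<Longrightarrow> (LINT x|lborel. cmod (u (Complex x y))) \<le> C"
    and y: "y > 0" and w: "Im w < 0"
  shows "(LINT x|lborel. u (Complex x y) / (complex_of_real x - w)) = 0"
proof -
  define w' where "w' = w + \<i> * complex_of_real y"
  have w': "Im w' = Im w + y" by (simp add: w'_def)
  have eq: "(LINT x|lborel. u (Complex x y) / (complex_of_real x - w)) = (LINT x|lborel. u (Complex x y) / (Complex x y - w'))"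
    by (simp add: w'_def Complex_eq)
  let ?D = "(LINT x|lborel. u (Complex x y) / (Complex x y - w'))"
  have "0 \<le> (LINT x|lborel. cmod (u (Complex x y)))"
    by (rule Bochner_Integration.integral_nonneg) simp
  then have C: "0 \<le> C" using ubound[OF y] by linarith
  have le: "(LINT x|lborel. cmod (u (Complex x b) / (Complex x b - w'))) \<le> C / (b - Im w')" if "b \<ge> y" for b
  proof -
    have "(LINT x|lborel. cmod (u (Complex x b) / (Complex x b - w'))) \<le> (LINT x|lborel. cmod (u (Complex x b))) / \<bar>b - Im w'\<bar>"
      using that w w' y by (intro integral_slice_divide_le uint) auto
    also have "\<dots> \<le> C / (b - Im w')"
      using that ubound[of b] w w' y by (auto intro!: divide_right_mono)
    finally show ?thesis .
  qed
  have D: "cmod ?D \<le> C / (b - Im w')" if b: "b > y" for b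
  proof -
    \<comment> \<open>The lifted pole \<open>w'\<close> may lie above the real axis, but it stays
      below the line at height \<open>y\<close>; hence the maximum.\<close>
    have hol': "(\<lambda>z. u z / (z - w')) holomorphic_on {z. max 0 (Im w') < Im z \<and> Im z < b + 1}"
      by (intro holomorphic_intros holomorphic_on_subset[OF hol]) (auto simp: upper_half_plane_def)
    have "?D = (LINT x|lborel. u (Complex x b) / (Complex x b - w'))"
    proof (rule strip_shift[OF b _ _ hol'])
      fix v assume v: "y \<le> v" "v \<le> b"
      show "integrable lborel (\<lambda>x. u (Complex x v) / (Complex x v - w'))"
        using v y w w' by (intro integrable_slice_divide uint) auto
      have "C / (v - Im w') \<le> C / (y - Im w')"
        using v w w' C by (intro divide_left_mono mult_pos_pos) linarith+
      then show "(LINT x|lborel. cmod (u (Complex x v) / (Complex x v - w'))) \<le> C / (y - Im w')"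
        using le[OF v(1)] by simp
    qed (use y w w' in auto)
    also have "cmod \<dots> \<le> (LINT x|lborel. cmod (u (Complex x b) / (Complex x b - w')))"
      by (rule integral_norm_bound)
    also have "\<dots> \<le> C / (b - Im w')"
      using b by (intro le) auto
    finally show ?thesis .
  qed
  have "((\<lambda>b. C / (b - Im w')) \<longlongrightarrow> 0) at_top"
    by (rule tendsto_const_divide_at_top)
  moreover have "\<forall>\<^sub>F b in at_top. cmod ?D \<le> C / (b - Im w')"
    using eventually_gt_at_top[of y] by eventually_elim (rule D)
  ultimately have "cmod ?D \<le> 0"
    by (intro tendsto_lowerbound) auto
  then show ?thesis by (simp add: eq)
qed

section \<open>Boundary functions in \<open>L\<^sup>2\<close>\<close>

text \<open>Riesz-Fischer for a family indexed by a real height. The sequence \<open>r\<close> with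
  convergence almost everywhere is part of the result, because it allows the limit to be recognised
  when the family is explicit.\<close>

lemma sqint_complete:
  fixes s :: "real \<Rightarrow> real \<Rightarrow> complex"
  assumes s: "\<And>y. y > 0 \<Longrightarrow> sqint (s y)"
    and cauchy: "\<And>e. e > 0 \<Longrightarrow> \<exists>d>0. \<forall>y y'. 0 < y \<and> y < d \<and> 0 < y' \<and> y' < d \<longrightarrow> nsq (\<lambda>x. s y x - s y' x) < e"
  obtains f r where "sqint f" "((\<lambda>y. nsq (\<lambda>x. s y x - f x)) \<longlongrightarrow> 0) (at_right 0)"
    "\<And>k::nat. r k > 0" "r \<longlonglongrightarrow> 0" "AE x in lborel. (\<lambda>k. s (r k) x) \<longlonglongrightarrow> f x"
proof -
  \<comment> \<open>The rate \<open>(1/8)^k\<close> leaves room for the weight \<open>4^k\<close>: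
    the weighted squared increments still have integrals at most \<open>(1/2)^k\<close>. A finite
    weighted sum at \<open>x\<close> then bounds the increments there by a multiple of
    \<open>(1/2)^k\<close>, which is summable. The condition with \<open>1 / Suc k\<close> forces
    \<open>r\<close> to \<open>0\<close>.\<close>
  define P where "P = (\<lambda>(k::nat) \<rho>::real. 0 < \<rho> \<and> \<rho> < 1 / Suc k \<and>
    (\<forall>y y'. 0 < y \<and> y \<le> \<rho> \<and> 0 < y' \<and> y' \<le> \<rho> \<longrightarrow> nsq (\<lambda>x. s y x - s y' x) < (1/8)^k))"
  have ex: "\<exists>\<rho>'. P k \<rho>' \<and> \<rho>' \<le> \<rho>" if "\<rho> > 0" for k \<rho>
  proof -
    obtain d where d: "d > 0" "\<And>y y'. 0 < y \<Longrightarrow> y < d \<Longrightarrow> 0 < y' \<Longrightarrow> y' < d \<Longrightarrow> nsq (\<lambda>x. s y x - s y' x) < (1/8)^k"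
      using cauchy[of "(1/8)^k"] by auto
    define m where "m = min d (1 / Suc k)"
    have m: "m > 0" "m \<le> d" "m \<le> 1 / Suc k" using d(1) by (auto simp: m_def)
    define \<rho>' where "\<rho>' = min \<rho> (m / 2)"
    have "\<rho>' > 0" "\<rho>' \<le> m / 2" "\<rho>' \<le> \<rho>"
      using that m(1) by (auto simp: \<rho>'_def)
    then have "\<rho>' > 0" "\<rho>' < d" "\<rho>' < 1 / Suc k" "\<rho>' \<le> \<rho>"
      using m by linarith+
    then show ?thesis
      unfolding P_def by (intro exI[of _ \<rho>']) (auto intro!: d(2))
  qed
  have "\<exists>r. \<forall>k. P k (r k) \<and> r (Suc k) \<le> r k"
  proof (rule dependent_nat_choice)
    show "\<exists>x. P 0 x" using ex[of 1 0] by auto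
    show "\<exists>y. P (Suc n) y \<and> y \<le> x" if "P n x" for x n
      using ex[of x "Suc n"] that by (auto simp: P_def)
  qed
  then obtain r where r: "\<And>k. P k (r k)" "\<And>k. r (Suc k) \<le> r k" by blast
  have rpos: "r k > 0" for k using r(1)[of k] by (simp add: P_def)
  have rdec: "decseq r" by (rule decseq_SucI) (rule r(2))
  have rle: "nsq (\<lambda>x. s y x - s y' x) < (1/8)^k" if "0 < y" "y \<le> r k" "0 < y'" "y' \<le> r k" for k y y'
    using r(1)[of k] that by (auto simp: P_def)
  have r0: "r \<longlonglongrightarrow> 0"
  proof (rule tendsto_sandwich[OF _ _ tendsto_const LIMSEQ_inverse_real_of_nat])
    show "\<forall>\<^sub>F k in sequentially. 0 \<le> r k" using rpos by (auto intro: less_imp_le always_eventually)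
    show "\<forall>\<^sub>F k in sequentially. r k \<le> inverse (real (Suc k))"
      using r(1) by (intro always_eventually allI less_imp_le) (auto simp: P_def inverse_eq_divide)
  qed
  have sm [measurable]: "s (r k) \<in> borel_measurable borel" for k
    using s[OF rpos] by (rule sqint_measurable)
  have sqd: "sqint (\<lambda>x. s y x - s y' x)" if "y > 0" "y' > 0" for y y'
    using that by (intro sqint_diff s)
  have nnd: "(\<integral>\<^sup>+x. ennreal ((cmod (s y x - s y' x))\<^sup>2) \<partial>lborel) = ennreal (nsq (\<lambda>x. s y x - s y' x))" if "y > 0" "y' > 0" for y y'
    unfolding nsq_def by (rule nn_integral_eq_integral[OF sqint_integrable[OF sqd[OF that]]]) simp
  define d where "d = (\<lambda>k x. s (r (Suc k)) x - s (r k) x)"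
  have dm [measurable]: "d k \<in> borel_measurable borel" for k
    unfolding d_def by simp
  have "(\<integral>\<^sup>+x. (\<Sum>k. ennreal (4^k * (cmod (d k x))\<^sup>2)) \<partial>lborel) = (\<Sum>k. \<integral>\<^sup>+x. ennreal (4^k * (cmod (d k x))\<^sup>2) \<partial>lborel)"
    by (intro nn_integral_suminf) measurable
  also have "\<dots> \<le> (\<Sum>k. ennreal ((1/2)^k))"
  proof (rule suminf_le)
    fix k
    have "(\<integral>\<^sup>+x. ennreal (4^k * (cmod (d k x))\<^sup>2) \<partial>lborel) = ennreal (4^k) * ennreal (nsq (d k))"
      using rpos unfolding d_def by (subst nnd[symmetric], simp, simp, subst nn_integral_cmult[symmetric])
        (simp_all add: ennreal_mult)
    also have "\<dots> \<le> ennreal (4^k) * ennreal ((1/8)^k)"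
      using rle[of "r (Suc k)" k "r k"] rpos r(2)
      by (intro mult_left_mono ennreal_leI) (auto simp: d_def intro: less_imp_le)
    also have "\<dots> = ennreal ((1/2)^k)"
      by (simp add: ennreal_mult[symmetric] power_mult_distrib[symmetric])
    finally show "(\<integral>\<^sup>+x. ennreal (4^k * (cmod (d k x))\<^sup>2) \<partial>lborel) \<le> ennreal ((1/2)^k)" .
  qed auto
  also have "\<dots> = ennreal (\<Sum>k. (1/2)^k)"
    by (intro suminf_ennreal2 summable_geometric) auto
  also have "\<dots> < \<infinity>" by simp
  finally have "AE x in lborel. (\<Sum>k. ennreal (4^k * (cmod (d k x))\<^sup>2)) \<noteq> \<infinity>"
    by (intro nn_integral_PInf_AE) auto
  then have conv: "AE x in lborel. convergent (\<lambda>k. s (r k) x)"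
  proof eventually_elim
    fix x assume fin: "(\<Sum>k. ennreal (4^k * (cmod (d k x))\<^sup>2)) \<noteq> \<infinity>"
    have "\<exists>c\<ge>0. X = ennreal c" if "X \<noteq> \<infinity>" for X :: ennreal
      using that by (cases X) auto
    from this[OF fin] obtain c where c: "(\<Sum>k. ennreal (4^k * (cmod (d k x))\<^sup>2)) = ennreal c" "c \<ge> 0"
      by blast
    have "cmod (d k x) \<le> sqrt c * (1/2)^k" for k
    proof -
      have "ennreal (4^k * (cmod (d k x))\<^sup>2) \<le> ennreal c"
        using sum_le_suminf[of "\<lambda>k. ennreal (4^k * (cmod (d k x))\<^sup>2)" "{k}"] c(1) by simp
      then have "4^k * (cmod (d k x))\<^sup>2 \<le> c"
        using c(2) by simp
      moreover have "((2::real)^k)\<^sup>2 = 4^k"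
        by (simp add: power2_eq_square flip: power_mult_distrib)
      ultimately have "(2^k * cmod (d k x))\<^sup>2 \<le> c"
        by (simp only: power_mult_distrib)
      then have "2^k * cmod (d k x) \<le> sqrt c" by (rule real_le_rsqrt)
      then show ?thesis by (simp add: field_simps power_divide)
    qed
    then have "summable (\<lambda>k. d k x)"
      by (rule summable_comparison_test'[of "\<lambda>k. sqrt c * (1/2)^k" 0, rotated]) (simp add: summable_mult)
    then have "convergent (\<lambda>n. \<Sum>k<n. d k x)"
      by (simp add: summable_iff_convergent)
    moreover have "(\<Sum>k<n. d k x) = s (r n) x - s (r 0) x" for n
      unfolding d_def by (rule sum_lessThan_telescope)
    ultimately have "convergent (\<lambda>n. s (r n) x - s (r 0) x)" by simp
    then show "convergent (\<lambda>k. s (r k) x)"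
      using convergent_diff_const_right_iff[of "\<lambda>n. s (r n) x" "s (r 0) x"] by simp
  qed
  define f where "f = (\<lambda>x. lim (\<lambda>k. s (r k) x))"
  have fm [measurable]: "f \<in> borel_measurable borel"
    unfolding f_def by measurable
  have lim: "AE x in lborel. (\<lambda>k. s (r k) x) \<longlonglongrightarrow> f x"
    using conv by eventually_elim (simp add: f_def convergent_LIMSEQ_iff)
  \<comment> \<open>The estimate \<open>rle\<close> between two slices passes to the limit
    \<open>f\<close> in the second one by Fatou's lemma; all heights \<open>r j\<close> with
    \<open>j\<close> at least \<open>k\<close> are admissible since \<open>r\<close>
    decreases.\<close>
  have fatou: "(\<integral>\<^sup>+x. ennreal ((cmod (s y x - f x))\<^sup>2) \<partial>lborel) \<le> ennreal ((1/8)^k)" if y: "0 < y" "y \<le> r k" for y k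
  proof -
    have [measurable]: "s y \<in> borel_measurable borel" using s[OF y(1)] by (rule sqint_measurable)
    have "(\<integral>\<^sup>+x. ennreal ((cmod (s y x - f x))\<^sup>2) \<partial>lborel) = (\<integral>\<^sup>+x. liminf (\<lambda>j. ennreal ((cmod (s y x - s (r j) x))\<^sup>2)) \<partial>lborel)"
    proof (rule nn_integral_cong_AE)
      show "AE x in lborel. ennreal ((cmod (s y x - f x))\<^sup>2) = liminf (\<lambda>j. ennreal ((cmod (s y x - s (r j) x))\<^sup>2))"
        using lim
      proof eventually_elim
        fix x assume "(\<lambda>k. s (r k) x) \<longlonglongrightarrow> f x"
        then have "(\<lambda>j. ennreal ((cmod (s y x - s (r j) x))\<^sup>2)) \<longlonglongrightarrow> ennreal ((cmod (s y x - f x))\<^sup>2)"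
          by (intro tendsto_intros)
        then show "ennreal ((cmod (s y x - f x))\<^sup>2) = liminf (\<lambda>j. ennreal ((cmod (s y x - s (r j) x))\<^sup>2))"
          by (intro lim_imp_Liminf[symmetric]) auto
      qed
    qed
    also have "\<dots> \<le> liminf (\<lambda>j. \<integral>\<^sup>+x. ennreal ((cmod (s y x - s (r j) x))\<^sup>2) \<partial>lborel)"
      by (intro nn_integral_liminf) measurable
    also have "\<dots> \<le> ennreal ((1/8)^k)"
    proof (rule Liminf_le)
      show "\<forall>\<^sub>F j in sequentially. (\<integral>\<^sup>+x. ennreal ((cmod (s y x - s (r j) x))\<^sup>2) \<partial>lborel) \<le> ennreal ((1/8)^k)"
        using eventually_ge_at_top[of k]
      proof eventually_elim
        fix j assume "k \<le> j"
        then have "r j \<le> r k" using rdec by (simp add: decseq_def)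
        then show "(\<integral>\<^sup>+x. ennreal ((cmod (s y x - s (r j) x))\<^sup>2) \<partial>lborel) \<le> ennreal ((1/8)^k)"
          using nnd[of y "r j"] rle[of y k "r j"] y rpos[of j] by (auto intro!: ennreal_leI)
      qed
    qed simp
    finally show ?thesis .
  qed
  have sqf: "sqint (\<lambda>x. s y x - f x)" and nsf: "nsq (\<lambda>x. s y x - f x) \<le> (1/8)^k" if y: "0 < y" "y \<le> r k" for y k
  proof -
    have [measurable]: "s y \<in> borel_measurable borel" using s[OF y(1)] by (rule sqint_measurable)
    have i: "integrable lborel (\<lambda>x. (cmod (s y x - f x))\<^sup>2)"
      using fatou[OF y] by (intro integrableI_bounded) (auto simp: le_less_trans)
    then show "sqint (\<lambda>x. s y x - f x)" by (simp add: sqint_def)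
    have "ennreal (nsq (\<lambda>x. s y x - f x)) \<le> ennreal ((1/8)^k)"
      using fatou[OF y] nn_integral_eq_integral[OF i] by (simp add: nsq_def)
    then show "nsq (\<lambda>x. s y x - f x) \<le> (1/8)^k" by simp
  qed
  have "sqint (\<lambda>x. s (r 0) x - (s (r 0) x - f x))"
    using rpos by (intro sqint_diff s sqf[of _ 0]) auto
  then have "sqint f" by simp
  moreover have "((\<lambda>y. nsq (\<lambda>x. s y x - f x)) \<longlongrightarrow> 0) (at_right 0)"
  proof (rule tendstoI)
    fix e :: real assume "e > 0"
    then obtain k where k: "(1/8)^k < e"
      using real_arch_pow_inv[of e "1/8"] by auto
    have "\<forall>\<^sub>F y in at_right 0. y < r k" "\<forall>\<^sub>F y in at_right (0::real). 0 < y"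
      using rpos[of k] by (auto simp: eventually_at_right_less eventually_at_right_field intro!: exI[of _ "r k"])
    then show "\<forall>\<^sub>F y in at_right 0. dist (nsq (\<lambda>x. s y x - f x)) 0 < e"
    proof eventually_elim
      fix y :: real assume "y < r k" "0 < y"
      then show "dist (nsq (\<lambda>x. s y x - f x)) 0 < e"
        using nsf[of y k] k by simp
    qed
  qed
  ultimately show ?thesis using that rpos r0 lim by blast
qed

section \<open>Horizontal slices of Hardy functions\<close>

lemma open_upper_half_plane: "open upper_half_plane"
  unfolding upper_half_plane_def by (rule open_halfspace_Im_gt)

lemma continuous_slice: "continuous_on A (\<lambda>x. Complex x y)"
  by (auto simp: Complex_eq intro!: continuous_intros)

lemma borel_measurable_slice:
  assumes "F holomorphic_on upper_half_plane" "y > 0"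
  shows "(\<lambda>x. F (Complex x y)) \<in> borel_measurable borel"
proof (intro borel_measurable_continuous_onI continuous_on_compose2[OF _ continuous_slice])
  show "continuous_on upper_half_plane F"
    using assms(1) by (rule holomorphic_on_imp_continuous_on)
qed (use assms(2) in \<open>auto simp: upper_half_plane_def\<close>)

lemma H2_holomorphic: "F \<in> H2 \<Longrightarrow> F holomorphic_on upper_half_plane"
  by (simp add: H2_def holo_upper_def)

text \<open>Slices of holomorphic functions are continuous, hence Borel, so passing to the
  completion does not affect their integrals. From here on the work is done over
  \<open>lborel\<close> instead of \<open>lebesgue\<close>.\<close>

lemma H2_lborel_iff:
  assumes "F \<in> holo_upper"
  shows "F \<in> H2 \<longleftrightarrow> (\<exists>M. \<forall>y>0. sqint (\<lambda>x. F (Complex x y)) \<and> nsq (\<lambda>x. F (Complex x y)) \<le> M)"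
proof -
  have hol: "F holomorphic_on upper_half_plane" using assms by (simp add: holo_upper_def)
  have m: "(\<lambda>x. (cmod (F (Complex x y)))\<^sup>2) \<in> borel_measurable lborel" if "y > 0" for y
    using borel_measurable_slice[OF hol that] by simp
  show ?thesis
    unfolding H2_def sqint_def nsq_def using assms borel_measurable_slice[OF hol]
    by (auto simp: integrable_completion[OF m] integral_completion[OF m])
qed

lemma H2_E:
  assumes "F \<in> H2"
  obtains M where "\<And>y. y > 0 \<Longrightarrow> sqint (\<lambda>x. F (Complex x y))" "\<And>y. y > 0 \<Longrightarrow> nsq (\<lambda>x. F (Complex x y)) \<le> M"
  using assms H2_lborel_iff[of F] by (auto simp: H2_def)

lemma H2_slice_sqint: "F \<in> H2 \<Longrightarrow> y > 0 \<Longrightarrow> sqint (\<lambda>x. F (Complex x y))"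
  by (erule H2_E)

text \<open>On the boundary this involution becomes \<open>f \<mapsto> cnj (f (- x))\<close>; it keeps the conjugated factor of a
  scalar product holomorphic.\<close>

definition dagger :: "(complex \<Rightarrow> complex) \<Rightarrow> complex \<Rightarrow> complex" where
  "dagger F z = cnj (F (- cnj z))"

lemma dagger_Complex: "dagger F (Complex x y) = cnj (F (Complex (-x) y))"
proof -
  have "- cnj (Complex x y) = Complex (-x) y" by (simp add: complex_eq_iff)
  then show ?thesis by (simp add: dagger_def)
qed

lemma dagger_holomorphic:
  assumes "F holomorphic_on upper_half_plane"
  shows "dagger F holomorphic_on upper_half_plane"
proof -
  have im: "uminus ` cnj ` upper_half_plane = upper_half_plane"
    unfolding image_image
  proof (intro equalityI subsetI)
    fix z assume "z \<in> upper_half_plane"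
    then show "z \<in> (\<lambda>w. - cnj w) ` upper_half_plane"
      by (intro image_eqI[of _ _ "- cnj z"]) (auto simp: upper_half_plane_def)
  qed (auto simp: upper_half_plane_def)
  have "(F \<circ> uminus) holomorphic_on cnj ` upper_half_plane"
    by (rule holomorphic_on_compose) (use assms in \<open>auto simp: im intro!: holomorphic_intros\<close>)
  then have "cnj \<circ> (F \<circ> uminus) \<circ> cnj holomorphic_on upper_half_plane"
    by (rule holomorphic_on_compose_cnj_cnj) (rule open_upper_half_plane)
  then show ?thesis by (simp add: dagger_def[abs_def] o_def)
qed

lemma nsq_reflect: "nsq (\<lambda>x. f (- x)) = nsq f"
  unfolding nsq_def using lborel_integral_real_affine[of "-1" "\<lambda>x. (cmod (f x))\<^sup>2" 0] by simp

lemma dagger_H2: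
  assumes "F \<in> H2"
  shows "dagger F \<in> H2"
proof -
  obtain M where M: "\<And>y. y > 0 \<Longrightarrow> sqint (\<lambda>x. F (Complex x y))" "\<And>y. y > 0 \<Longrightarrow> nsq (\<lambda>x. F (Complex x y)) \<le> M"
    by (rule H2_E[OF assms]) blast
  have "dagger F \<in> holo_upper"
    using assms dagger_holomorphic[of F] by (auto simp: H2_def holo_upper_def dagger_def upper_half_plane_def)
  then show ?thesis
    using M sqint_cnj[OF sqint_reflect[OF M(1)]] nsq_reflect[of "\<lambda>x. F (Complex x _)"]
    by (subst H2_lborel_iff) (auto simp: dagger_Complex intro!: exI[of _ M])
qed

lemma nsq_eq_inner: "complex_of_real (nsq f) = (LINT x|lborel. cnj (f x) * f x)"
proof -
  have "cnj (f x) * f x = complex_of_real ((cmod (f x))\<^sup>2)" for x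
    by (metis complex_norm_square mult.commute of_real_power)
  then show ?thesis unfolding nsq_def by (simp only: integral_complex_of_real)
qed

text \<open>The integrand is the restriction of a holomorphic function to a horizontal line, and moving the
  line changes \<open>y\<close> and \<open>y'\<close> by opposite amounts.\<close>

lemma H2_slice_inner:
  assumes F: "F \<in> H2" and y: "y > 0" "y' > 0"
  shows "(LINT x|lborel. cnj (F (Complex x y)) * F (Complex x y')) = complex_of_real (nsq (\<lambda>x. F (Complex x ((y + y') / 2))))"
proof -
  obtain M where M: "\<And>y. y > 0 \<Longrightarrow> sqint (\<lambda>x. F (Complex x y))" "\<And>y. y > 0 \<Longrightarrow> nsq (\<lambda>x. F (Complex x y)) \<le> M"
    by (rule H2_E[OF F]) blast
  define \<alpha> where "\<alpha> = y + y'"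
  define K where "K = (\<lambda>z. dagger F (\<i> * \<alpha> - z) * F z)"
  have K: "K (Complex x t) = cnj (F (Complex x (\<alpha> - t))) * F (Complex x t)" for x t
  proof -
    have "\<i> * \<alpha> - Complex x t = Complex (-x) (\<alpha> - t)" by (simp add: complex_eq_iff)
    then show ?thesis by (simp add: K_def dagger_Complex)
  qed
  have hol: "K holomorphic_on {z. 0 < Im z \<and> Im z < \<alpha>}"
  proof -
    have "(dagger F \<circ> (\<lambda>z. \<i> * \<alpha> - z)) holomorphic_on {z. 0 < Im z \<and> Im z < \<alpha>}"
      by (intro holomorphic_on_compose_gen[where t = upper_half_plane] dagger_holomorphic H2_holomorphic F)
        (auto simp: upper_half_plane_def intro!: holomorphic_intros)
    moreover have "F holomorphic_on {z. 0 < Im z \<and> Im z < \<alpha>}"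
      using H2_holomorphic[OF F] by (rule holomorphic_on_subset) (auto simp: upper_half_plane_def)
    ultimately show ?thesis unfolding K_def o_def by (intro holomorphic_intros)
  qed
  have Kint: "integrable lborel (\<lambda>x. K (Complex x t))" if "0 < t" "t < \<alpha>" for t
    unfolding K using that by (intro sqint_mult_integrable sqint_cnj M) auto
  have Kb: "(LINT x|lborel. cmod (K (Complex x t))) \<le> sqrt M * sqrt M" if "0 < t" "t < \<alpha>" for t
  proof -
    have "(LINT x|lborel. cmod (K (Complex x t))) \<le> sqrt (nsq (\<lambda>x. cnj (F (Complex x (\<alpha> - t))))) * sqrt (nsq (\<lambda>x. F (Complex x t)))"
      unfolding K using that by (intro integral_cmod_mult_le sqint_cnj M) auto
    also have "\<dots> \<le> sqrt M * sqrt M"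
      using that M(2)[of t] M(2)[of "\<alpha> - t"] order_trans[OF nsq_nonneg M(2)[of t]] by (intro mult_mono) auto
    finally show ?thesis .
  qed
  have shift: "(LINT x|lborel. K (Complex x a)) = (LINT x|lborel. K (Complex x b))" if "0 < a" "a < b" "b < \<alpha>" for a b
    using that by (intro strip_shift[OF _ _ _ hol, of a b "sqrt M * sqrt M"] Kint Kb) auto
  \<comment> \<open>On the middle line both heights equal \<open>\<alpha> / 2\<close>, and the
    product becomes a squared modulus.\<close>
  have "(LINT x|lborel. K (Complex x y')) = (LINT x|lborel. K (Complex x (\<alpha> / 2)))"
  proof (cases y' "\<alpha> / 2" rule: linorder_cases)
    case less
    then show ?thesis using y by (intro shift) (auto simp: \<alpha>_def)
  next
    case greater
    then show ?thesis using y by (intro shift[symmetric]) (auto simp: \<alpha>_def)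
  qed (simp only:)
  moreover have "\<alpha> - \<alpha> / 2 = \<alpha> / 2" "\<alpha> - y' = y" by (simp, simp add: \<alpha>_def)
  ultimately show ?thesis
    unfolding K by (simp add: nsq_eq_inner flip: \<alpha>_def)
qed

text \<open>By midpoint convexity, a gain from \<open>a\<close> to \<open>b\<close> is repeated in
  every later step of the progression \<open>a + k * (b - a)\<close>, so \<open>m\<close> would
  outgrow the bound \<open>M\<close>.\<close>

lemma bounded_midpoint_convex_antimono:
  fixes m :: "real \<Rightarrow> real"
  assumes mid: "\<And>y y'. y > 0 \<Longrightarrow> y' > 0 \<Longrightarrow> 2 * m ((y + y') / 2) \<le> m y + m y'"
    and bound: "\<And>y. y > 0 \<Longrightarrow> m y \<le> M"
    and ab: "0 < a" "a < b"
  shows "m b \<le> m a"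
proof (rule ccontr)
  assume "\<not> ?thesis"
  then have pos: "m b - m a > 0" by simp
  define t where "t = (\<lambda>k::nat. a + k * (b - a))"
  have tpos: "t k > 0" for k using ab by (auto simp: t_def intro!: add_pos_nonneg)
  have inc: "m b - m a \<le> m (t (Suc k)) - m (t k)" for k
  proof (induction k)
    case 0
    then show ?case by (simp add: t_def)
  next
    case (Suc k)
    have "(t k + t (Suc (Suc k))) / 2 = t (Suc k)"
      by (simp add: t_def field_simps)
    then have "2 * m (t (Suc k)) \<le> m (t k) + m (t (Suc (Suc k)))"
      using mid[OF tpos[of k] tpos[of "Suc (Suc k)"]] by simp
    then show ?case using Suc by simp
  qed
  have lin: "m a + k * (m b - m a) \<le> m (t k)" for k
  proof (induction k)
    case 0
    then show ?case by (simp add: t_def)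
  next
    case (Suc k)
    then show ?case using inc[of k] by (simp add: algebra_simps)
  qed
  obtain k :: nat where "M - m a < k * (m b - m a)"
    using reals_Archimedean3[OF pos] by blast
  then show False using lin[of k] bound[OF tpos[of k]] by linarith
qed

text \<open>Convergence in \<open>L\<^sup>2\<close> of the restrictions of \<open>F\<close> to horizontal lines; the non-tangential limit
  is identified with \<open>f\<close> only later.\<close>

definition L2_boundary :: "(complex \<Rightarrow> complex) \<Rightarrow> (real \<Rightarrow> complex) \<Rightarrow> bool" where
  "L2_boundary F f \<longleftrightarrow> F \<in> H2 \<and> sqint f \<and> ((\<lambda>y. nsq (\<lambda>x. F (Complex x y) - f x)) \<longlongrightarrow> 0) (at_right 0)"

lemma H2_L2_boundary:
  assumes F: "F \<in> H2"
  obtains f r where "L2_boundary F f" "\<And>k::nat. r k > (0::real)" "r \<longlonglongrightarrow> 0"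
    "AE x in lborel. (\<lambda>k. F (Complex x (r k))) \<longlonglongrightarrow> f x"
proof -
  obtain M where M: "\<And>y. y > 0 \<Longrightarrow> sqint (\<lambda>x. F (Complex x y))" "\<And>y. y > 0 \<Longrightarrow> nsq (\<lambda>x. F (Complex x y)) \<le> M"
    by (rule H2_E[OF F]) blast
  define m where "m = (\<lambda>y. nsq (\<lambda>x. F (Complex x y)))"
  \<comment> \<open>Nonnegativity of this expression is midpoint convexity of \<open>m\<close>; its
    smallness near height \<open>0\<close>, once \<open>m\<close> is known to be monotone, is the
    Cauchy condition.\<close>
  have diff: "nsq (\<lambda>x. F (Complex x y) - F (Complex x y')) = m y + m y' - 2 * m ((y + y') / 2)" if "y > 0" "y' > 0" for y y'
    using that M(1) by (subst nsq_diff) (auto simp: m_def H2_slice_inner[OF F])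
  have mid: "2 * m ((y + y') / 2) \<le> m y + m y'" if "y > 0" "y' > 0" for y y'
    using diff[OF that] nsq_nonneg[of "\<lambda>x. F (Complex x y) - F (Complex x y')"] by linarith
  have mM: "m y \<le> M" if "y > 0" for y using M(2)[OF that] by (simp add: m_def)
  have anti: "m b \<le> m a" if "0 < a" "a \<le> b" for a b
    using bounded_midpoint_convex_antimono[of m M a b] mid mM that by (cases "a = b") auto
  define L where "L = Sup (m ` {0<..})"
  have bdd: "bdd_above (m ` {0<..})" using mM by (auto intro!: bdd_aboveI[of _ M])
  have leL: "m y \<le> L" if "y > 0" for y
    unfolding L_def using that by (intro cSup_upper bdd) auto
  have cauchy: "\<exists>d>0. \<forall>y y'. 0 < y \<and> y < d \<and> 0 < y' \<and> y' < d \<longrightarrow> nsq (\<lambda>x. F (Complex x y) - F (Complex x y')) < e" if "e > 0" for e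
  proof -
    \<comment> \<open>Below height \<open>d\<close> the two outer values of \<open>m\<close> are at
      most \<open>L\<close> and the middle one exceeds \<open>L - e / 2\<close>, so the expression
      in \<open>diff\<close> is less than \<open>e\<close>.\<close>
    have "L - e / 2 < Sup (m ` {0<..})" using that by (simp add: L_def)
    then obtain d where d: "d > 0" "L - e / 2 < m d"
      by (subst (asm) less_cSup_iff) (auto simp: bdd)
    have "nsq (\<lambda>x. F (Complex x y) - F (Complex x y')) < e" if "0 < y" "y < d" "0 < y'" "y' < d" for y y'
    proof -
      have "m d \<le> m ((y + y') / 2)" using that by (intro anti) auto
      then show ?thesis using diff[of y y'] leL[of y] leL[of y'] that d by simp
    qed
    then show ?thesis using d(1) by blast
  qed
  obtain f r where "sqint f" "((\<lambda>y. nsq (\<lambda>x. F (Complex x y) - f x)) \<longlongrightarrow> 0) (at_right 0)"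
    "\<And>k::nat. r k > 0" "r \<longlonglongrightarrow> 0" "AE x in lborel. (\<lambda>k. F (Complex x (r k))) \<longlonglongrightarrow> f x"
    by (rule sqint_complete[of "\<lambda>y x. F (Complex x y)"]) (use M(1) cauchy in auto)
  then show ?thesis
    using F by (intro that[of f r]) (auto simp: L2_boundary_def)
qed

section \<open>Cauchy and Poisson formulas\<close>

lemma L2_boundary_H2: "L2_boundary F f \<Longrightarrow> F \<in> H2"
  and L2_boundary_sqint: "L2_boundary F f \<Longrightarrow> sqint f"
  and L2_boundary_tendsto: "L2_boundary F f \<Longrightarrow> ((\<lambda>y. nsq (\<lambda>x. F (Complex x y) - f x)) \<longlongrightarrow> 0) (at_right 0)"
  by (simp_all add: L2_boundary_def)

lemma L2_boundary_cong_AE: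
  assumes F: "L2_boundary F f" and eq: "AE x in lborel. f x = g x" and g: "g \<in> borel_measurable borel"
  shows "L2_boundary F g"
proof -
  note [measurable] = sqint_measurable[OF L2_boundary_sqint[OF F]] g
  have "integrable lborel (\<lambda>x. (cmod (g x))\<^sup>2) \<longleftrightarrow> integrable lborel (\<lambda>x. (cmod (f x))\<^sup>2)"
    using eq by (intro integrable_cong_AE) (auto elim!: eventually_mono)
  then have "sqint g" using L2_boundary_sqint[OF F] g by (simp add: sqint_def)
  moreover have "nsq (\<lambda>x. F (Complex x y) - g x) = nsq (\<lambda>x. F (Complex x y) - f x)" if "y > 0" for y
  proof -
    have [measurable]: "(\<lambda>x. F (Complex x y)) \<in> borel_measurable borel"
      using H2_slice_sqint[OF L2_boundary_H2[OF F] that] by (rule sqint_measurable)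
    show ?thesis
      unfolding nsq_def using eq by (intro integral_cong_AE) (auto elim!: eventually_mono)
  qed
  then have "((\<lambda>y. nsq (\<lambda>x. F (Complex x y) - g x)) \<longlongrightarrow> 0) (at_right 0)"
    using L2_boundary_tendsto[OF F]
    by (subst tendsto_cong[where g = "\<lambda>y. nsq (\<lambda>x. F (Complex x y) - f x)"])
       (auto intro!: eventually_mono[OF eventually_at_right_less])
  ultimately show ?thesis using L2_boundary_H2[OF F] by (simp add: L2_boundary_def)
qed

text \<open>Supplies the \<open>L^1\<close> hypotheses of \<open>upper_cauchy\<close> and
  \<open>upper_cauchy_outside\<close> for a product of two functions in \<open>H2\<close>.\<close>

lemma H2_mult_slice:
  assumes "F \<in> H2" "G \<in> H2"
  obtains C where "\<And>y. y > 0 \<Longrightarrow> integrable lborel (\<lambda>x. F (Complex x y) * G (Complex x y))"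
    "\<And>y. y > 0 \<Longrightarrow> (LINT x|lborel. cmod (F (Complex x y) * G (Complex x y))) \<le> C"
proof -
  obtain M where M: "\<And>y. y > 0 \<Longrightarrow> sqint (\<lambda>x. F (Complex x y))" "\<And>y. y > 0 \<Longrightarrow> nsq (\<lambda>x. F (Complex x y)) \<le> M"
    by (rule H2_E[OF assms(1)]) blast
  obtain N where N: "\<And>y. y > 0 \<Longrightarrow> sqint (\<lambda>x. G (Complex x y))" "\<And>y. y > 0 \<Longrightarrow> nsq (\<lambda>x. G (Complex x y)) \<le> N"
    by (rule H2_E[OF assms(2)]) blast
  have "(LINT x|lborel. cmod (F (Complex x y) * G (Complex x y))) \<le> sqrt M * sqrt N" if "y > 0" for y
  proof -
    have "(LINT x|lborel. cmod (F (Complex x y) * G (Complex x y))) \<le> sqrt (nsq (\<lambda>x. F (Complex x y))) * sqrt (nsq (\<lambda>x. G (Complex x y)))"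
      using that by (intro integral_cmod_mult_le M N)
    also have "\<dots> \<le> sqrt M * sqrt N"
      using M(2)[OF that] N(2)[OF that] order_trans[OF nsq_nonneg M(2)[OF that]] by (intro mult_mono) auto
    finally show ?thesis .
  qed
  then show ?thesis using M(1) N(1) by (intro that[of "sqrt M * sqrt N"] sqint_mult_integrable) auto
qed

text \<open>Products of slices that converge in \<open>L^2\<close> converge in \<open>L^1\<close>,
  by the splitting \<open>F G - f g = (F - f) G + f (G - g)\<close> and Cauchy-Schwarz; the limit
  may therefore be taken under the integral against any bounded kernel.\<close>

lemma L2_boundary_mult_tendsto:
  assumes F: "L2_boundary F f" and G: "L2_boundary G g"
    and k: "k \<in> borel_measurable borel" "\<And>x. cmod (k x) \<le> B"
  shows "((\<lambda>y. LINT x|lborel. F (Complex x y) * G (Complex x y) * k x) \<longlongrightarrow> (LINT x|lborel. f x * g x * k x)) (at_right 0)"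
proof -
  obtain N where N: "\<And>y. y > 0 \<Longrightarrow> sqint (\<lambda>x. G (Complex x y))" "\<And>y. y > 0 \<Longrightarrow> nsq (\<lambda>x. G (Complex x y)) \<le> N"
    by (rule H2_E[OF L2_boundary_H2[OF G]]) blast
  have "0 \<le> cmod (k 0)" by simp
  then have B: "B \<ge> 0" using k(2)[of 0] by linarith
  have sF: "sqint (\<lambda>x. F (Complex x y))" if "y > 0" for y
    using H2_slice_sqint[OF L2_boundary_H2[OF F] that] .
  note sf = L2_boundary_sqint[OF F] and sg = L2_boundary_sqint[OF G]
  have ik: "integrable lborel (\<lambda>x. h x * k x)" if "integrable lborel h" for h
  proof (rule Bochner_Integration.integrable_bound)
    show "integrable lborel (\<lambda>x. B * cmod (h x))" using that by simp
    show "(\<lambda>x. h x * k x) \<in> borel_measurable lborel"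
      using borel_measurable_integrable[OF that] k(1) by simp
    show "AE x in lborel. norm (h x * k x) \<le> norm (B * cmod (h x))"
      using k(2) B by (auto simp: norm_mult mult.commute[of B] intro!: mult_left_mono)
  qed
  define q where "q = (\<lambda>y. B * (sqrt (nsq (\<lambda>x. F (Complex x y) - f x)) * sqrt N + sqrt (nsq f) * sqrt (nsq (\<lambda>x. G (Complex x y) - g x))))"
  have le: "norm ((LINT x|lborel. F (Complex x y) * G (Complex x y) * k x) - (LINT x|lborel. f x * g x * k x)) \<le> q y"
    if y: "y > 0" for y
  proof -
    let ?F = "\<lambda>x. F (Complex x y)" and ?G = "\<lambda>x. G (Complex x y)"
    have sFf: "sqint (\<lambda>x. ?F x - f x)" and sGg: "sqint (\<lambda>x. ?G x - g x)"
      using sF[OF y] N(1)[OF y] sf sg by (auto intro: sqint_diff)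
    have i1: "integrable lborel (\<lambda>x. (?F x - f x) * ?G x)" and i2: "integrable lborel (\<lambda>x. f x * (?G x - g x))"
      using sFf sGg N(1)[OF y] sf by (auto intro: sqint_mult_integrable)
    have "(LINT x|lborel. ?F x * ?G x * k x) - (LINT x|lborel. f x * g x * k x)
      = (LINT x|lborel. ?F x * ?G x * k x - f x * g x * k x)"
      using sF[OF y] N(1)[OF y] sf sg
      by (intro Bochner_Integration.integral_diff[symmetric] ik sqint_mult_integrable)
    also have "\<dots> = (LINT x|lborel. ((?F x - f x) * ?G x + f x * (?G x - g x)) * k x)"
      by (simp add: algebra_simps)
    finally have "norm ((LINT x|lborel. ?F x * ?G x * k x) - (LINT x|lborel. f x * g x * k x))
      = norm (LINT x|lborel. ((?F x - f x) * ?G x + f x * (?G x - g x)) * k x)"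
      by (rule arg_cong)
    also have "norm (LINT x|lborel. ((?F x - f x) * ?G x + f x * (?G x - g x)) * k x)
      \<le> (LINT x|lborel. B * (cmod ((?F x - f x) * ?G x) + cmod (f x * (?G x - g x))))"
    proof (rule order_trans[OF integral_norm_bound integral_mono])
      show "integrable lborel (\<lambda>x. norm (((?F x - f x) * ?G x + f x * (?G x - g x)) * k x))"
        by (intro integrable_norm ik Bochner_Integration.integrable_add i1 i2)
      show "integrable lborel (\<lambda>x. B * (cmod ((?F x - f x) * ?G x) + cmod (f x * (?G x - g x))))"
        by (intro integrable_mult_right Bochner_Integration.integrable_add integrable_norm i1 i2)
      show "norm (((?F x - f x) * ?G x + f x * (?G x - g x)) * k x) \<le> B * (cmod ((?F x - f x) * ?G x) + cmod (f x * (?G x - g x)))" for x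
        by (subst norm_mult, subst mult.commute) (rule mult_mono[OF k(2) norm_triangle_ineq B norm_ge_zero])
    qed
    also have "\<dots> = B * ((LINT x|lborel. cmod ((?F x - f x) * ?G x)) + (LINT x|lborel. cmod (f x * (?G x - g x))))"
      unfolding integral_mult_right_zero
      by (rule arg_cong[OF Bochner_Integration.integral_add[OF integrable_norm[OF i1] integrable_norm[OF i2]]])
    also have "\<dots> \<le> B * (sqrt (nsq (\<lambda>x. ?F x - f x)) * sqrt (nsq ?G) + sqrt (nsq f) * sqrt (nsq (\<lambda>x. ?G x - g x)))"
      using B sFf sGg sf N(1)[OF y] by (intro mult_left_mono add_mono integral_cmod_mult_le)
    also have "\<dots> \<le> q y"
      unfolding q_def using B N(2)[OF y] by (intro mult_left_mono add_mono order_refl) auto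
    finally show ?thesis .
  qed
  have "(q \<longlongrightarrow> B * (sqrt 0 * sqrt N + sqrt (nsq f) * sqrt 0)) (at_right 0)"
    unfolding q_def by (intro tendsto_intros L2_boundary_tendsto[OF F] L2_boundary_tendsto[OF G])
  then have q0: "(q \<longlongrightarrow> 0) (at_right 0)" by simp
  have "\<forall>\<^sub>F y in at_right 0. norm ((LINT x|lborel. F (Complex x y) * G (Complex x y) * k x) - (LINT x|lborel. f x * g x * k x)) \<le> q y"
    using eventually_at_right_less by eventually_elim (rule le)
  then show ?thesis
    by (rule Lim_null_comparison[THEN LIM_zero_cancel]) (rule q0)
qed

lemma
  assumes "Im w \<noteq> 0"
  shows borel_measurable_cauchy_kernel: "(\<lambda>x. 1 / (complex_of_real x - w)) \<in> borel_measurable borel"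
    and cmod_cauchy_kernel_le: "cmod (1 / (complex_of_real x - w)) \<le> 1 / \<bar>Im w\<bar>"
proof -
  have "complex_of_real x - w \<noteq> 0" for x using assms by (auto simp: complex_eq_iff)
  then show "(\<lambda>x. 1 / (complex_of_real x - w)) \<in> borel_measurable borel"
    by (intro borel_measurable_continuous_onI continuous_intros) auto
  have "\<bar>Im w\<bar> \<le> cmod (complex_of_real x - w)"
    using abs_Im_le_cmod[of "complex_of_real x - w"] by simp
  then show "cmod (1 / (complex_of_real x - w)) \<le> 1 / \<bar>Im w\<bar>"
    using assms by (auto simp: norm_divide intro!: divide_left_mono mult_pos_pos)
qed

text \<open>At height \<open>y\<close> the formula produces the value at \<open>w + i y\<close>. As
  \<open>y\<close> tends to \<open>0\<close>, the integral converges by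
  \<open>L2_boundary_mult_tendsto\<close> and the value by continuity at \<open>w\<close>.\<close>

lemma L2_boundary_cauchy:
  assumes F: "L2_boundary F f" and G: "L2_boundary G g" and w: "Im w > 0"
  shows "(LINT x|lborel. f x * g x * (1 / (complex_of_real x - w))) = 2 * pi * \<i> * (F w * G w)"
proof (rule tendsto_unique)
  note FH = L2_boundary_H2[OF F] and GH = L2_boundary_H2[OF G]
  obtain C where C: "\<And>y. y > 0 \<Longrightarrow> integrable lborel (\<lambda>x. F (Complex x y) * G (Complex x y))"
    "\<And>y. y > 0 \<Longrightarrow> (LINT x|lborel. cmod (F (Complex x y) * G (Complex x y))) \<le> C"
    by (rule H2_mult_slice[OF FH GH]) blast
  show "((\<lambda>y. LINT x|lborel. F (Complex x y) * G (Complex x y) * (1 / (complex_of_real x - w)))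
      \<longlongrightarrow> (LINT x|lborel. f x * g x * (1 / (complex_of_real x - w)))) (at_right 0)"
    using w by (intro L2_boundary_mult_tendsto[OF F G, where B = "1 / \<bar>Im w\<bar>"] borel_measurable_cauchy_kernel cmod_cauchy_kernel_le) auto
  have hol: "(\<lambda>z. F z * G z) holomorphic_on upper_half_plane"
    by (intro holomorphic_intros H2_holomorphic FH GH)
  have "w \<in> interior upper_half_plane"
    using w unfolding interior_open[OF open_upper_half_plane] by (simp add: upper_half_plane_def)
  with holomorphic_on_imp_continuous_on[OF hol] have "isCont (\<lambda>z. F z * G z) w"
    by (rule continuous_on_interior)
  then have "((\<lambda>y. F (w + \<i> * complex_of_real y) * G (w + \<i> * complex_of_real y)) \<longlongrightarrow> F w * G w) (at_right 0)"
  proof (rule isCont_tendsto_compose)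
    have "((\<lambda>y. w + \<i> * complex_of_real y) \<longlongrightarrow> w + \<i> * complex_of_real 0) (at_right 0)"
      by (intro tendsto_intros)
    then show "((\<lambda>y. w + \<i> * complex_of_real y) \<longlongrightarrow> w) (at_right 0)" by simp
  qed
  then have "((\<lambda>y. 2 * pi * \<i> * (F (w + \<i> * complex_of_real y) * G (w + \<i> * complex_of_real y))) \<longlongrightarrow> 2 * pi * \<i> * (F w * G w)) (at_right 0)"
    by (intro tendsto_mult_left)
  then show "((\<lambda>y. LINT x|lborel. F (Complex x y) * G (Complex x y) * (1 / (complex_of_real x - w)))
      \<longlongrightarrow> 2 * pi * \<i> * (F w * G w)) (at_right 0)"
  proof (rule Lim_transform_eventually)
    show "\<forall>\<^sub>F y in at_right 0. 2 * pi * \<i> * (F (w + \<i> * complex_of_real y) * G (w + \<i> * complex_of_real y)) =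
      (LINT x|lborel. F (Complex x y) * G (Complex x y) * (1 / (complex_of_real x - w)))"
      using eventually_at_right_less
    proof eventually_elim
      fix y :: real assume "0 < y"
      then show "2 * pi * \<i> * (F (w + \<i> * complex_of_real y) * G (w + \<i> * complex_of_real y)) =
        (LINT x|lborel. F (Complex x y) * G (Complex x y) * (1 / (complex_of_real x - w)))"
        using upper_cauchy[OF hol C _ w, of y] by simp
    qed
  qed
qed simp

lemma L2_boundary_cauchy_outside:
  assumes F: "L2_boundary F f" and G: "L2_boundary G g" and w: "Im w < 0"
  shows "(LINT x|lborel. f x * g x * (1 / (complex_of_real x - w))) = 0"
proof (rule tendsto_unique)
  note FH = L2_boundary_H2[OF F] and GH = L2_boundary_H2[OF G]
  obtain C where C: "\<And>y. y > 0 \<Longrightarrow> integrable lborel (\<lambda>x. F (Complex x y) * G (Complex x y))"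
    "\<And>y. y > 0 \<Longrightarrow> (LINT x|lborel. cmod (F (Complex x y) * G (Complex x y))) \<le> C"
    by (rule H2_mult_slice[OF FH GH]) blast
  show "((\<lambda>y. LINT x|lborel. F (Complex x y) * G (Complex x y) * (1 / (complex_of_real x - w)))
      \<longlongrightarrow> (LINT x|lborel. f x * g x * (1 / (complex_of_real x - w)))) (at_right 0)"
    using w by (intro L2_boundary_mult_tendsto[OF F G, where B = "1 / \<bar>Im w\<bar>"] borel_measurable_cauchy_kernel cmod_cauchy_kernel_le) auto
  have hol: "(\<lambda>z. F z * G z) holomorphic_on upper_half_plane"
    by (intro holomorphic_intros H2_holomorphic FH GH)
  show "((\<lambda>y. LINT x|lborel. F (Complex x y) * G (Complex x y) * (1 / (complex_of_real x - w))) \<longlongrightarrow> 0) (at_right 0)"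
  proof (rule tendsto_eventually)
    show "\<forall>\<^sub>F y in at_right 0. (LINT x|lborel. F (Complex x y) * G (Complex x y) * (1 / (complex_of_real x - w))) = 0"
      using eventually_at_right_less
    proof eventually_elim
      fix y :: real assume "0 < y"
      then show "(LINT x|lborel. F (Complex x y) * G (Complex x y) * (1 / (complex_of_real x - w))) = 0"
        using upper_cauchy_outside[OF hol C _ w, of y] by simp
    qed
  qed
qed simp

text \<open>The limiting case of \<open>L2_boundary_cauchy_outside\<close> in which the pole recedes
  to infinity along the negative imaginary axis.\<close>

lemma L2_boundary_mult_integral:
  assumes F: "L2_boundary F f" and G: "L2_boundary G g"
  shows "(LINT x|lborel. f x * g x) = 0"
proof -
  have fg: "integrable lborel (\<lambda>x. f x * g x)"
    using F G by (intro sqint_mult_integrable L2_boundary_sqint)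
  \<comment> \<open>The Cauchy kernel with pole \<open>- i (n + 1)\<close>, scaled by
    \<open>n + 1\<close>: it is bounded by \<open>1\<close> and tends pointwise to
    \<open>- i\<close>, so dominated convergence recovers the integral of \<open>f * g\<close> up to
    that constant factor.\<close>
  define k where "k = (\<lambda>n x. complex_of_real (Suc n) * (1 / (complex_of_real x - (- \<i> * complex_of_real (Suc n)))))"
  have km: "k n \<in> borel_measurable borel" for n
    unfolding k_def by (intro borel_measurable_times borel_measurable_const borel_measurable_cauchy_kernel) simp
  have kle: "cmod (k n x) \<le> 1" for n x
    using cmod_cauchy_kernel_le[of "- \<i> * complex_of_real (Suc n)" x]
    by (simp add: k_def norm_mult norm_divide divide_simps del: of_nat_Suc)
  have klim: "(\<lambda>n. k n x) \<longlonglongrightarrow> - \<i>" for x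
  proof -
    have "(\<lambda>n. 1 / (complex_of_real x * complex_of_real (inverse (real (Suc n))) + \<i>)) \<longlonglongrightarrow> 1 / (complex_of_real x * complex_of_real 0 + \<i>)"
      by (intro tendsto_intros LIMSEQ_inverse_real_of_nat) auto
    moreover have "1 / (complex_of_real x * complex_of_real (inverse (real (Suc n))) + \<i>) = k n x" for n
    proof -
      have "complex_of_real x - (- \<i> * complex_of_real (Suc n)) \<noteq> 0" by (auto simp: complex_eq_iff)
      moreover have "complex_of_real x * complex_of_real (inverse (real (Suc n))) + \<i> = (complex_of_real x - (- \<i> * complex_of_real (Suc n))) / complex_of_real (Suc n)"
        by (simp add: field_simps del: of_nat_Suc)
      ultimately show ?thesis by (simp add: k_def del: of_nat_Suc)
    qed
    ultimately show ?thesis by simp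
  qed
  have "(\<lambda>n. LINT x|lborel. f x * g x * k n x) \<longlonglongrightarrow> (LINT x|lborel. f x * g x * (- \<i>))"
  proof (rule integral_dominated_convergence)
    show "integrable lborel (\<lambda>x. cmod (f x * g x))" using fg by (rule integrable_norm)
    show "(\<lambda>x. f x * g x * (- \<i>)) \<in> borel_measurable lborel" "(\<lambda>x. f x * g x * k n x) \<in> borel_measurable lborel" for n
      using borel_measurable_integrable[OF fg] km[of n] by simp_all
    show "AE x in lborel. (\<lambda>n. f x * g x * k n x) \<longlonglongrightarrow> f x * g x * (- \<i>)"
      by (intro AE_I2 tendsto_mult_left klim)
    show "AE x in lborel. cmod (f x * g x * k n x) \<le> cmod (f x * g x)" for n
      using kle[of n] by (auto simp: norm_mult intro!: AE_I2 mult_right_le_one_le)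
  qed
  moreover have "(LINT x|lborel. f x * g x * k n x) = 0" for n
  proof -
    have "(LINT x|lborel. f x * g x * k n x) = (LINT x|lborel. complex_of_real (Suc n) * (f x * g x * (1 / (complex_of_real x - (- \<i> * complex_of_real (Suc n))))))"
      by (intro Bochner_Integration.integral_cong) (simp_all add: k_def)
    also have "\<dots> = 0"
      unfolding integral_mult_right_zero by (subst L2_boundary_cauchy_outside[OF F G]) auto
    finally show ?thesis .
  qed
  ultimately have "(LINT x|lborel. f x * g x * (- \<i>)) = 0"
    using LIMSEQ_unique tendsto_const by fastforce
  then show ?thesis by simp
qed

section \<open>Poisson and Cauchy kernels on the real line\<close>

lemma has_bochner_integral_arctan_deriv: "has_bochner_integral lborel (\<lambda>x. 1 / (1 + x\<^sup>2)) pi"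
proof (rule has_bochner_integral_nn_integral)
  have m: "(\<lambda>x::real. 1 / (1 + x\<^sup>2)) \<in> borel_measurable borel" by measurable
  have half: "(\<integral>\<^sup>+x. ennreal (1 / (1 + x\<^sup>2)) * indicator {0..} x \<partial>lborel) = ennreal (pi / 2 - arctan 0)"
    by (rule nn_integral_FTC_atLeast[OF m])
      (auto intro!: derivative_eq_intros tendsto_arctan_at_top simp: inverse_eq_divide)
  have half': "(\<integral>\<^sup>+x. ennreal (1 / (1 + x\<^sup>2)) * indicator {..0} x \<partial>lborel) = ennreal (pi / 2)"
    using half by (subst nn_integral_real_affine[where c = "-1" and t = 0]) (auto simp: indicator_def intro!: nn_integral_cong)
  have "(\<integral>\<^sup>+x. ennreal (1 / (1 + x\<^sup>2)) \<partial>lborel)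
    = (\<integral>\<^sup>+x. ennreal (1 / (1 + x\<^sup>2)) * indicator {0..} x + ennreal (1 / (1 + x\<^sup>2)) * indicator {..0} x \<partial>lborel)"
    by (intro nn_integral_cong_AE eventually_mono[OF AE_lborel_singleton[of 0]]) (auto simp: indicator_def)
  also have "\<dots> = ennreal (pi / 2) + ennreal (pi / 2)"
    using half half' by (subst nn_integral_add) auto
  finally show "(\<integral>\<^sup>+x. ennreal (1 / (1 + x\<^sup>2)) \<partial>lborel) = ennreal pi"
    by (simp flip: ennreal_plus)
qed auto

lemma has_bochner_integral_poisson_kernel:
  assumes s: "s > 0"
  shows "has_bochner_integral lborel (\<lambda>x. 1 / ((x - c)\<^sup>2 + s\<^sup>2)) (pi / s)"
proof -
  let ?f = "\<lambda>x::real. 1 / ((x - c)\<^sup>2 + s\<^sup>2)"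
  have eq: "?f (c + s * x) = (1 / s\<^sup>2) * (1 / (1 + x\<^sup>2))" for x
    using s by (simp add: power_mult_distrib field_simps)
  have "has_bochner_integral lborel (\<lambda>x. ?f (c + s * x)) ((1 / s\<^sup>2) * pi)"
    unfolding eq by (intro has_bochner_integral_mult_right has_bochner_integral_arctan_deriv)
  moreover have "pi / s /\<^sub>R \<bar>s\<bar> = (1 / s\<^sup>2) * pi"
    using s by (simp add: power2_eq_square divide_inverse_commute)
  ultimately show ?thesis
    using lborel_has_bochner_integral_real_affine_iff[of s ?f "pi / s" c] s by simp
qed

lemma cmod_diff_real_square: "(cmod (complex_of_real x - a))\<^sup>2 = (x - Re a)\<^sup>2 + (Im a)\<^sup>2"
  by (simp add: cmod_power2)

lemma
  assumes "Im a \<noteq> 0"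
  shows sqint_cauchy_kernel: "sqint (\<lambda>x. 1 / (complex_of_real x - a))"
    and nsq_cauchy_kernel: "nsq (\<lambda>x. 1 / (complex_of_real x - a)) = pi / \<bar>Im a\<bar>"
proof -
  have eq: "(cmod (1 / (complex_of_real x - a)))\<^sup>2 = 1 / ((x - Re a)\<^sup>2 + \<bar>Im a\<bar>\<^sup>2)" for x
    by (simp add: norm_divide power_divide cmod_diff_real_square)
  have "has_bochner_integral lborel (\<lambda>x. 1 / ((x - Re a)\<^sup>2 + \<bar>Im a\<bar>\<^sup>2)) (pi / \<bar>Im a\<bar>)"
    using assms by (intro has_bochner_integral_poisson_kernel) simp
  then show "sqint (\<lambda>x. 1 / (complex_of_real x - a))" "nsq (\<lambda>x. 1 / (complex_of_real x - a)) = pi / \<bar>Im a\<bar>"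
    using borel_measurable_cauchy_kernel[OF assms] unfolding sqint_def nsq_def eq has_bochner_integral_iff by auto
qed

text \<open>It is cut off to \<open>0\<close> outside the half plane as \<open>holo_upper\<close>
  demands. For \<open>Im a < 0\<close> it is, up to a constant factor, the reproducing kernel at
  \<open>cnj a\<close>.\<close>

definition cauchy_kernel :: "complex \<Rightarrow> complex \<Rightarrow> complex" where
  "cauchy_kernel a z = (if z \<in> upper_half_plane then 1 / (z - a) else 0)"

lemma cauchy_kernel_H2:
  assumes a: "Im a < 0"
  shows "cauchy_kernel a \<in> H2"
proof -
  have "(\<lambda>z. 1 / (z - a)) holomorphic_on upper_half_plane"
    using a by (intro holomorphic_intros) (auto simp: upper_half_plane_def)
  then have "cauchy_kernel a holomorphic_on upper_half_plane"
    by (rule holomorphic_transform) (simp add: cauchy_kernel_def)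
  then have hu: "cauchy_kernel a \<in> holo_upper" by (simp add: holo_upper_def cauchy_kernel_def)
  have "sqint (\<lambda>x. cauchy_kernel a (Complex x y)) \<and> nsq (\<lambda>x. cauchy_kernel a (Complex x y)) \<le> pi / \<bar>Im a\<bar>" if "y > 0" for y
  proof -
    have eq: "cauchy_kernel a (Complex x y) = 1 / (complex_of_real x - (a - \<i> * y))" for x
      using that by (simp add: cauchy_kernel_def upper_half_plane_def Complex_eq)
    have "pi / \<bar>Im (a - \<i> * y)\<bar> \<le> pi / \<bar>Im a\<bar>"
      using that a by (intro divide_left_mono mult_pos_pos) auto
    then show ?thesis
      using that a sqint_cauchy_kernel[of "a - \<i> * y"] nsq_cauchy_kernel[of "a - \<i> * y"] unfolding eq by simp
  qed
  then show ?thesis using hu by (subst H2_lborel_iff) auto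
qed

lemma tendsto_cauchy_kernel:
  assumes a: "Im a < 0" and z: "z \<longlonglongrightarrow> complex_of_real x" "\<And>k::nat. Im (z k) > 0"
  shows "(\<lambda>k. cauchy_kernel a (z k)) \<longlonglongrightarrow> 1 / (complex_of_real x - a)"
proof -
  have "(\<lambda>k. 1 / (z k - a)) \<longlonglongrightarrow> 1 / (complex_of_real x - a)"
    using a by (intro tendsto_intros z) (auto simp: complex_eq_iff)
  then show ?thesis using z(2) by (simp add: cauchy_kernel_def upper_half_plane_def)
qed

lemma tendsto_Complex_vertical:
  assumes "r \<longlonglongrightarrow> 0"
  shows "(\<lambda>k. Complex x (r k)) \<longlonglongrightarrow> complex_of_real x"
proof -
  have "(\<lambda>k. complex_of_real x + \<i> * complex_of_real (r k)) \<longlonglongrightarrow> complex_of_real x + \<i> * complex_of_real 0"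
    by (intro tendsto_intros assms)
  then show ?thesis by (simp add: Complex_eq)
qed

text \<open>The abstract \<open>L^2\<close> limit is recognised along the sequence of heights from
  \<open>H2_L2_boundary\<close>, where the pointwise limit is explicit.\<close>

lemma cauchy_kernel_L2_boundary:
  assumes a: "Im a < 0"
  shows "L2_boundary (cauchy_kernel a) (\<lambda>x. 1 / (complex_of_real x - a))"
proof -
  obtain f r where fr: "L2_boundary (cauchy_kernel a) f" "\<And>k::nat. r k > (0::real)" "r \<longlonglongrightarrow> 0"
    "AE x in lborel. (\<lambda>k. cauchy_kernel a (Complex x (r k))) \<longlonglongrightarrow> f x"
    by (rule H2_L2_boundary[OF cauchy_kernel_H2[OF a]]) blast
  have "AE x in lborel. f x = 1 / (complex_of_real x - a)"
    using fr(4)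
  proof eventually_elim
    fix x assume "(\<lambda>k. cauchy_kernel a (Complex x (r k))) \<longlonglongrightarrow> f x"
    moreover have "(\<lambda>k. cauchy_kernel a (Complex x (r k))) \<longlonglongrightarrow> 1 / (complex_of_real x - a)"
      using fr(2) by (intro tendsto_cauchy_kernel a tendsto_Complex_vertical fr(3)) auto
    ultimately show "f x = 1 / (complex_of_real x - a)" by (rule LIMSEQ_unique)
  qed
  then show ?thesis
    using a by (intro L2_boundary_cong_AE[OF fr(1)] borel_measurable_cauchy_kernel) auto
qed

text \<open>Cauchy's formula applied to the product of \<open>F\<close> with the reproducing kernel at \<open>w\<close>.\<close>

lemma L2_boundary_poisson:
  assumes F: "L2_boundary F f" and w: "Im w > 0"
  shows "F w = complex_of_real (Im w / pi) * (LINT x|lborel. f x / complex_of_real ((x - Re w)\<^sup>2 + (Im w)\<^sup>2))"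
proof -
  have cw: "Im (cnj w) < 0" using w by simp
  have "1 / (complex_of_real x - cnj w) * (1 / (complex_of_real x - w)) = 1 / complex_of_real ((x - Re w)\<^sup>2 + (Im w)\<^sup>2)" for x
  proof -
    have "(complex_of_real x - cnj w) * (complex_of_real x - w) = complex_of_real ((cmod (complex_of_real x - w))\<^sup>2)"
      unfolding complex_norm_square by (simp add: mult.commute)
    then show ?thesis by (simp add: cmod_diff_real_square)
  qed
  then have "(LINT x|lborel. f x / complex_of_real ((x - Re w)\<^sup>2 + (Im w)\<^sup>2)) =
    (LINT x|lborel. f x * (1 / (complex_of_real x - cnj w)) * (1 / (complex_of_real x - w)))"
    by (simp add: mult.assoc)
  also have "\<dots> = 2 * pi * \<i> * (F w * cauchy_kernel (cnj w) w)"
    by (rule L2_boundary_cauchy[OF F cauchy_kernel_L2_boundary[OF cw] w])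
  also have "cauchy_kernel (cnj w) w = 1 / (2 * \<i> * Im w)"
    using w by (simp add: cauchy_kernel_def upper_half_plane_def complex_diff_cnj)
  finally show ?thesis using w by (simp add: field_simps)
qed

section \<open>Non-tangential limits\<close>

lemma has_bochner_integral_FTC_atLeast:
  fixes f :: "real \<Rightarrow> real"
  assumes "f \<in> borel_measurable borel" "\<And>x. a \<le> x \<Longrightarrow> DERIV F x :> f x" "\<And>x. a \<le> x \<Longrightarrow> 0 \<le> f x"
    and lim: "(F \<longlongrightarrow> T) at_top"
  shows "has_bochner_integral lborel (\<lambda>x. indicator {a..} x * f x) (T - F a)"
proof (rule has_bochner_integral_nn_integral)
  have mono: "F a \<le> F x" if "a \<le> x" for x
    using that
  proof (rule DERIV_nonneg_imp_nondecreasing)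
    show "\<exists>y. DERIV F t :> y \<and> 0 \<le> y" if "a \<le> t" for t
      using assms(2,3)[OF that] by blast
  qed
  show "0 \<le> T - F a"
    using tendsto_lowerbound[OF lim eventually_mono[OF eventually_ge_at_top[of a] mono]] by simp
  show "(\<integral>\<^sup>+x. ennreal (indicator {a..} x * f x) \<partial>lborel) = ennreal (T - F a)"
  proof -
    have eq: "ennreal (indicator {a..} x * f x) = ennreal (f x) * indicator {a..} x" for x
      by (simp add: indicator_def)
    show ?thesis
      unfolding eq by (rule nn_integral_FTC_atLeast[OF assms])
  qed
qed (use assms(1,3) in \<open>auto simp: indicator_def\<close>)

section \<open>Primitives of square-integrable functions\<close>

lemma indicator_interval_sqint:
  "sqint (\<lambda>x. indicator {a..b} x)" "nsq (\<lambda>x. indicator {a..b} x) = max 0 (b - a)" for a b :: real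
proof -
  have eq: "(cmod (indicator {a..b} x))\<^sup>2 = indicator {a..b} x" for x :: real
    by (simp add: indicator_def)
  show "sqint (\<lambda>x. indicator {a..b} x)" "nsq (\<lambda>x. indicator {a..b} x) = max 0 (b - a)"
    unfolding sqint_def nsq_def eq by (auto simp: emeasure_lborel_Icc_eq)
qed

lemma sqint_integrable_interval:
  assumes "sqint f"
  shows "integrable lborel (\<lambda>x. indicator {a..b::real} x *\<^sub>R f x)"
proof -
  have "indicator {a..b} x *\<^sub>R f x = indicator {a..b} x * f x" for x
    by (simp add: indicator_def)
  then show ?thesis
    using sqint_mult_integrable[OF indicator_interval_sqint(1) assms] by simp
qed

text \<open>The oriented integral from \<open>0\<close> to \<open>u\<close>: for \<open>u\<close>
  other than \<open>0\<close> exactly one of the two intervals is nonempty. A bounded starting point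
  is chosen because a square-integrable function need not be integrable on a half line.\<close>

definition primitive :: "(real \<Rightarrow> complex) \<Rightarrow> real \<Rightarrow> complex" where
  "primitive f u = (LINT t|lborel. indicator {0..u} t *\<^sub>R f t) - (LINT t|lborel. indicator {u..0} t *\<^sub>R f t)"

lemma primitive_diff:
  assumes f: "sqint f" and ab: "a \<le> b"
  shows "primitive f b - primitive f a = (LINT t|lborel. indicator {a..b} t *\<^sub>R f t)"
proof -
  note i = sqint_integrable_interval[OF f]
  have "primitive f b - primitive f a = (LINT t|lborel. (indicator {0..b} t *\<^sub>R f t - indicator {b..0} t *\<^sub>R f t)
      - (indicator {0..a} t *\<^sub>R f t - indicator {a..0} t *\<^sub>R f t))"
    unfolding primitive_def by (simp add: i)
  also have "\<dots> = (LINT t|lborel. indicator {a..b} t *\<^sub>R f t)"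
  proof (rule integral_cong_AE)
    \<comment> \<open>The closed intervals overlap at their endpoints, so the identity between the
      indicators can fail at \<open>0\<close>, \<open>a\<close> and \<open>b\<close>.\<close>
    show "AE t in lborel. (indicator {0..b} t *\<^sub>R f t - indicator {b..0} t *\<^sub>R f t)
      - (indicator {0..a} t *\<^sub>R f t - indicator {a..0} t *\<^sub>R f t) = indicator {a..b} t *\<^sub>R f t"
      using AE_lborel_singleton[of 0] AE_lborel_singleton[of a] AE_lborel_singleton[of b]
    proof eventually_elim
      fix t assume "t \<noteq> 0" "t \<noteq> a" "t \<noteq> b"
      then show "(indicator {0..b} t *\<^sub>R f t - indicator {b..0} t *\<^sub>R f t)
        - (indicator {0..a} t *\<^sub>R f t - indicator {a..0} t *\<^sub>R f t) = indicator {a..b} t *\<^sub>R f t"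
        using ab by (auto simp: indicator_def)
    qed
  qed (use i in auto)
  finally show ?thesis .
qed

text \<open>Cauchy-Schwarz against the indicator of the interval. It yields continuity of the
  primitive and, for large increments, replaces the missing information from
  differentiability.\<close>

lemma primitive_growth:
  assumes f: "sqint f"
  shows "cmod (primitive f b - primitive f a) \<le> sqrt (nsq f) * sqrt \<bar>b - a\<bar>"
proof -
  have *: "cmod (primitive f b - primitive f a) \<le> sqrt (nsq f) * sqrt \<bar>b - a\<bar>" if "a \<le> b" for a b
  proof -
    have eq: "indicator {a..b} x *\<^sub>R f x = f x * indicator {a..b} x" for x
      by (simp add: indicator_def)
    have "cmod (primitive f b - primitive f a) \<le> (LINT t|lborel. cmod (f t * indicator {a..b} t))"
      unfolding primitive_diff[OF f that] eq by (rule integral_norm_bound)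
    also have "\<dots> \<le> sqrt (nsq f) * sqrt (nsq (\<lambda>t. indicator {a..b} t))"
      by (intro integral_cmod_mult_le f indicator_interval_sqint)
    finally show ?thesis using that by (simp add: indicator_interval_sqint)
  qed
  show ?thesis
  proof (cases "a \<le> b")
    case False
    then show ?thesis
      using *[of b a] by (simp only: norm_minus_commute[of "primitive f b"] abs_minus_commute[of b] linear)
  qed (rule *)
qed

lemma primitive_continuous:
  assumes f: "sqint f"
  shows "continuous_on UNIV (primitive f)"
proof (rule continuous_at_imp_continuous_on, rule ballI)
  fix a :: real
  have "((\<lambda>b. sqrt (nsq f) * sqrt \<bar>b - a\<bar>) \<longlongrightarrow> sqrt (nsq f) * sqrt \<bar>a - a\<bar>) (at a)"
    by (intro tendsto_intros)
  then have "((\<lambda>b. sqrt (nsq f) * sqrt \<bar>b - a\<bar>) \<longlongrightarrow> 0) (at a)" by simp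
  then have "((\<lambda>b. primitive f b - primitive f a) \<longlongrightarrow> 0) (at a)"
    by (rule Lim_null_comparison[rotated]) (simp add: primitive_growth[OF f])
  then show "isCont (primitive f) a"
    unfolding isCont_def by (rule LIM_zero_cancel)
qed

text \<open>Differentiability of \<open>\<phi>\<close> at \<open>x\<close> with derivative
  \<open>l\<close>, multiplied out so that increments of both signs are treated alike and nothing is
  divided by \<open>h\<close>.\<close>

definition small_increment :: "(real \<Rightarrow> complex) \<Rightarrow> real \<Rightarrow> complex \<Rightarrow> bool" where
  "small_increment \<phi> x l \<longleftrightarrow>
    (\<forall>e>0. \<exists>d>0. \<forall>h. \<bar>h\<bar> < d \<longrightarrow> cmod (\<phi> (x + h) - \<phi> x - of_real h * l) \<le> e * \<bar>h\<bar>)"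

text \<open>The library's differentiation theorem is one-sided, so it is applied to the reflected function as well.\<close>

lemma primitive_differentiable_AE:
  assumes f: "sqint f"
  shows "AE x in lborel. small_increment (primitive f) x (f x)"
proof -
  have integral: "g integrable_on {a..b}" "integral {a..b} g = primitive g b - primitive g a" if "sqint g" "a \<le> b" for g a b
  proof -
    have "set_integrable lborel {a..b} g"
      unfolding set_integrable_def by (rule sqint_integrable_interval[OF that(1)])
    from set_borel_integral_eq_integral[OF this]
    show "g integrable_on {a..b}" "integral {a..b} g = primitive g b - primitive g a"
      unfolding primitive_diff[OF that] by (simp_all add: set_lebesgue_integral_def)
  qed
  have ion: "g integrable_on cbox a b" if "sqint g" for g and a b :: real
    using integral(1)[OF that, of a b] by (cases "a \<le> b") auto
  have diff: "\<exists>N. negligible N \<and> (\<forall>x e. x \<notin> N \<longrightarrow> 0 < e \<longrightarrow> (\<exists>d>0. \<forall>h. 0 < h \<and> h < d \<longrightarrow>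
      cmod (primitive g (x + h) - primitive g x - of_real h * g x) \<le> e * h))" if g: "sqint g" for g
  proof -
    obtain N where N: "negligible N" "\<And>x e. \<lbrakk>x \<notin> N; 0 < e\<rbrakk> \<Longrightarrow> \<exists>d>0. \<forall>h. 0 < h \<and> h < d \<longrightarrow>
        norm (integral (cbox x (x + h *\<^sub>R One)) g /\<^sub>R h ^ DIM(real) - g x) < e"
      using integrable_ccontinuous_explicit[of g] ion[OF g] by blast
    show ?thesis
    proof (intro exI[of _ N] conjI allI impI N(1))
      fix x e :: real assume "x \<notin> N" "0 < e"
      from N(2)[OF this] obtain d where d: "d > 0" "\<And>h. 0 < h \<Longrightarrow> h < d \<Longrightarrow>
        norm (integral {x..x + h} g /\<^sub>R h - g x) < e" by auto
      have "cmod (primitive g (x + h) - primitive g x - of_real h * g x) \<le> e * h" if h: "0 < h" "h < d" for h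
      proof -
        have "integral {x..x + h} g - of_real h * g x = of_real h * (integral {x..x + h} g /\<^sub>R h - g x)"
          using h by (simp add: scaleR_conv_of_real field_simps)
        then have "cmod (integral {x..x + h} g - of_real h * g x) = h * norm (integral {x..x + h} g /\<^sub>R h - g x)"
          using h by (simp only: norm_mult norm_of_real)
        also have "\<dots> \<le> h * e" using d(2)[OF h] h by (intro mult_left_mono) auto
        finally show ?thesis using integral(2)[OF g, of x "x + h"] h by (simp add: mult.commute)
      qed
      then show "\<exists>d>0. \<forall>h. 0 < h \<and> h < d \<longrightarrow> cmod (primitive g (x + h) - primitive g x - of_real h * g x) \<le> e * h"
        using d(1) by blast
    qed
  qed
  let ?g = "\<lambda>x. f (- x)"
  note sg = sqint_reflect[OF f]
  have prim_reflect: "primitive ?g u = - primitive f (- u)" for u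
  proof -
    have "(LINT t|lborel. indicator {a..b} t *\<^sub>R ?g t) = (LINT t|lborel. indicator {-b..-a} t *\<^sub>R f t)" for a b :: real
      by (subst lborel_integral_real_affine[where c = "-1" and t = 0])
         (auto intro!: Bochner_Integration.integral_cong simp: indicator_def)
    then show ?thesis by (simp add: primitive_def)
  qed
  obtain N1 where N1: "negligible N1" "\<And>x e. x \<notin> N1 \<Longrightarrow> 0 < e \<Longrightarrow> \<exists>d>0. \<forall>h. 0 < h \<and> h < d \<longrightarrow>
      cmod (primitive f (x + h) - primitive f x - of_real h * f x) \<le> e * h"
    using diff[OF f] by blast
  obtain N2 where N2: "negligible N2" "\<And>x e. x \<notin> N2 \<Longrightarrow> 0 < e \<Longrightarrow> \<exists>d>0. \<forall>h. 0 < h \<and> h < d \<longrightarrow>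
      cmod (primitive ?g (x + h) - primitive ?g x - of_real h * ?g x) \<le> e * h"
    using diff[OF sg] by blast
  have "negligible (uminus ` N2)"
    using N2(1) by (intro negligible_differentiable_image_negligible) (auto intro!: derivative_intros)
  with N1(1) have neg: "negligible (N1 \<union> uminus ` N2)" by (rule negligible_Un)
  have small: "small_increment (primitive f) x (f x)" if x: "x \<notin> N1 \<union> uminus ` N2" for x
    unfolding small_increment_def
  proof (intro allI impI)
    fix e :: real assume e: "e > 0"
    have "- x \<notin> N2" using x by force
    then obtain d2 where d2: "d2 > 0" "\<And>h. 0 < h \<Longrightarrow> h < d2 \<Longrightarrow> cmod (primitive f x - primitive f (x - h) - of_real h * f x) \<le> e * h"
      using N2(2)[OF _ e, of "-x"] by (auto simp: prim_reflect)
    obtain d1 where d1: "d1 > 0" "\<And>h. 0 < h \<Longrightarrow> h < d1 \<Longrightarrow> cmod (primitive f (x + h) - primitive f x - of_real h * f x) \<le> e * h"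
      using N1(2)[OF _ e, of x] x by auto
    have "cmod (primitive f (x + h) - primitive f x - of_real h * f x) \<le> e * \<bar>h\<bar>" if "\<bar>h\<bar> < min d1 d2" for h
    proof (cases h "0::real" rule: linorder_cases)
      case less
      then have "cmod (primitive f x - primitive f (x + h) + of_real h * f x) \<le> e * \<bar>h\<bar>"
        using d2(2)[of "-h"] that by simp
      moreover have "primitive f (x + h) - primitive f x - of_real h * f x = - (primitive f x - primitive f (x + h) + of_real h * f x)"
        by simp
      ultimately show ?thesis by (simp only: norm_minus_cancel)
    qed (use d1(2)[of h] that in auto)
    then show "\<exists>d>0. \<forall>h. \<bar>h\<bar> < d \<longrightarrow> cmod (primitive f (x + h) - primitive f x - of_real h * f x) \<le> e * \<bar>h\<bar>"
      using d1(1) d2(1) by (intro exI[of _ "min d1 d2"]) auto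
  qed
  have "AE x in lebesgue. x \<notin> N1 \<union> uminus ` N2"
    using neg unfolding negligible_iff_null_sets by (rule AE_not_in)
  then have "AE x in lebesgue. small_increment (primitive f) x (f x)"
    by (rule eventually_mono) (rule small)
  then show ?thesis by (simp add: AE_completion_iff)
qed

text \<open>Since \<open>1 / (1 + s\<^sup>2)\<close> is the integral of this weight over \<open>{\<bar>s\<bar>..}\<close>, a Poisson integral becomes a
  weighted mean of increments of the primitive.\<close>

definition layer_weight :: "real \<Rightarrow> real" where
  "layer_weight \<rho> = indicator {0..} \<rho> * (2 * \<rho> / (1 + \<rho>\<^sup>2)\<^sup>2)"

lemma borel_measurable_layer_weight [measurable]: "layer_weight \<in> borel_measurable borel"
  unfolding layer_weight_def by measurable

lemma layer_weight_nonneg: "0 \<le> layer_weight \<rho>"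
  by (auto simp: layer_weight_def indicator_def)

lemma one_plus_square_pos: "(0::real) < 1 + x\<^sup>2"
  by (simp add: add_pos_nonneg)

lemma layer_cake:
  "has_bochner_integral lborel (\<lambda>\<rho>. indicator {\<bar>s\<bar>..} \<rho> * layer_weight \<rho>) (1 / (1 + s\<^sup>2))"
proof -
  have "has_bochner_integral lborel (\<lambda>\<rho>. indicator {\<bar>s\<bar>..} \<rho> * layer_weight \<rho>) (0 - (- 1 / (1 + \<bar>s\<bar>\<^sup>2)))"
  proof (rule has_bochner_integral_FTC_atLeast)
    show "((\<lambda>\<rho>. - 1 / (1 + \<rho>\<^sup>2)) has_real_derivative layer_weight \<rho>) (at \<rho>)" if "\<bar>s\<bar> \<le> \<rho>" for \<rho>
      using that one_plus_square_pos[of \<rho>] by (auto intro!: derivative_eq_intros simp: layer_weight_def power2_eq_square)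
    have "filterlim (\<lambda>\<rho>::real. 1 + \<rho>\<^sup>2) at_top at_top"
      by (intro filterlim_tendsto_add_at_top[OF tendsto_const] filterlim_pow_at_top filterlim_ident) auto
    then show "((\<lambda>\<rho>::real. - 1 / (1 + \<rho>\<^sup>2)) \<longlongrightarrow> 0) at_top"
      by (intro tendsto_divide_0[OF tendsto_const] filterlim_at_top_imp_at_infinity)
  qed (auto simp: layer_weight_nonneg)
  then show ?thesis by simp
qed

text \<open>The normalisation of the weighted mean: a primitive of constant slope \<open>l\<close>
  has increment \<open>2 * \<rho> * l\<close> over \<open>{-\<rho>..\<rho>}\<close>, and
  \<open>pi\<close> cancels the factor \<open>1 / pi\<close> of the Poisson formula.\<close>

lemma layer_weight_moment: "has_bochner_integral lborel (\<lambda>\<rho>. layer_weight \<rho> * (2 * \<rho>)) pi"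
proof -
  have "has_bochner_integral lborel (\<lambda>\<rho>. indicator {0..} \<rho> * (4 * \<rho>\<^sup>2 / (1 + \<rho>\<^sup>2)\<^sup>2)) (pi - 2 * (arctan 0 - 0 / (1 + 0\<^sup>2)))"
  proof (rule has_bochner_integral_FTC_atLeast)
    show "((\<lambda>\<rho>. 2 * (arctan \<rho> - \<rho> / (1 + \<rho>\<^sup>2))) has_real_derivative 4 * \<rho>\<^sup>2 / (1 + \<rho>\<^sup>2)\<^sup>2) (at \<rho>)" for \<rho>
    proof -
      define D where "D = 1 + \<rho>\<^sup>2"
      have D: "D \<noteq> 0" using one_plus_square_pos[of \<rho>] by (simp add: D_def)
      have "2 * (inverse D - (D - \<rho> * (2 * \<rho>)) / (D * D)) = 4 * \<rho>\<^sup>2 / D\<^sup>2"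
        using D by (simp add: field_simps power2_eq_square)
      moreover have "((\<lambda>\<rho>. 2 * (arctan \<rho> - \<rho> / (1 + \<rho>\<^sup>2))) has_real_derivative
          2 * (inverse D - (D - \<rho> * (2 * \<rho>)) / (D * D))) (at \<rho>)"
        using D unfolding D_def by (auto intro!: derivative_eq_intros)
      ultimately show ?thesis by (simp add: D_def)
    qed
    have "filterlim (\<lambda>\<rho>::real. \<rho> + inverse \<rho>) at_top at_top"
      using filterlim_tendsto_add_at_top[OF tendsto_inverse_0_at_top[OF filterlim_ident] filterlim_ident]
      by (simp add: add.commute)
    then have "((\<lambda>\<rho>::real. 1 / (\<rho> + inverse \<rho>)) \<longlongrightarrow> 0) at_top"
      by (intro tendsto_divide_0[OF tendsto_const] filterlim_at_top_imp_at_infinity)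
    moreover have "\<forall>\<^sub>F \<rho>::real in at_top. 1 / (\<rho> + inverse \<rho>) = \<rho> / (1 + \<rho>\<^sup>2)"
      using eventually_gt_at_top[of 0] by eventually_elim (simp add: field_simps power2_eq_square)
    ultimately have "((\<lambda>\<rho>::real. \<rho> / (1 + \<rho>\<^sup>2)) \<longlongrightarrow> 0) at_top"
      by (rule Lim_transform_eventually)
    then have "((\<lambda>\<rho>::real. 2 * (arctan \<rho> - \<rho> / (1 + \<rho>\<^sup>2))) \<longlongrightarrow> 2 * (pi / 2 - 0)) at_top"
      by (intro tendsto_intros tendsto_arctan_at_top)
    then show "((\<lambda>\<rho>::real. 2 * (arctan \<rho> - \<rho> / (1 + \<rho>\<^sup>2))) \<longlongrightarrow> pi) at_top" by simp
  qed auto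
  moreover have "layer_weight \<rho> * (2 * \<rho>) = indicator {0..} \<rho> * (4 * \<rho>\<^sup>2 / (1 + \<rho>\<^sup>2)\<^sup>2)" for \<rho>
    by (simp add: layer_weight_def power2_eq_square)
  ultimately show ?thesis by simp
qed

section \<open>Poisson integrals in terms of increments of a primitive\<close>

lemma sqint_affine:
  assumes "sqint f" "c \<noteq> 0"
  shows "sqint (\<lambda>x. f (t + c * x))"
proof -
  have [measurable]: "f \<in> borel_measurable borel" using assms(1) by (rule sqint_measurable)
  show ?thesis
    using lborel_integrable_real_affine[OF sqint_integrable[OF assms(1)] assms(2), of t]
    unfolding sqint_def by simp
qed

lemma sqint_arctan_deriv: "sqint (\<lambda>s. complex_of_real (1 / (1 + s\<^sup>2)))"
proof -
  have "integrable lborel (\<lambda>s::real. (1 / (1 + s\<^sup>2))\<^sup>2)"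
  proof (rule Bochner_Integration.integrable_bound)
    show "integrable lborel (\<lambda>s::real. 1 / (1 + s\<^sup>2))"
      using has_bochner_integral_arctan_deriv by (simp add: has_bochner_integral_iff)
    have "(1 / (1 + s\<^sup>2))\<^sup>2 \<le> 1 / (1 + s\<^sup>2)" for s :: real
    proof -
      have "1 / (1 + s\<^sup>2) \<le> 1"
        using one_plus_square_pos[of s] by (simp add: divide_le_eq)
      then show ?thesis using power_decreasing[of 1 2 "1 / (1 + s\<^sup>2)"] by simp
    qed
    then have "norm ((1 / (1 + s\<^sup>2))\<^sup>2) \<le> norm (1 / (1 + s\<^sup>2))" for s :: real
      unfolding real_norm_def abs_power2 by (rule order_trans[OF _ abs_ge_self])
    then show "AE s in lborel. norm ((1 / (1 + s\<^sup>2))\<^sup>2) \<le> norm (1 / (1 + s\<^sup>2 :: real))"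
      by (rule AE_I2)
  qed measurable
  moreover have "(cmod (complex_of_real (1 / (1 + s\<^sup>2))))\<^sup>2 = (1 / (1 + s\<^sup>2))\<^sup>2" for s
    by (simp only: norm_of_real power2_abs)
  ultimately show ?thesis
    unfolding sqint_def by (simp only:) measurable
qed

text \<open>Fubini for the representation of \<open>1 / (1 + s^2)\<close> as a weight integrated
  over \<open>\<rho>\<close> from \<open>\<bar>s\<bar>\<close> on: for fixed \<open>\<rho>\<close>
  the remaining condition on \<open>s\<close> describes a symmetric interval.\<close>

lemma layer_cake_integral:
  assumes g: "sqint g"
  shows "(LINT s|lborel. g s / complex_of_real (1 + s\<^sup>2)) =
    (LINT \<rho>|lborel. layer_weight \<rho> *\<^sub>R (LINT s|lborel. indicator {-\<rho>..\<rho>} s *\<^sub>R g s))"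
proof -
  have [measurable]: "g \<in> borel_measurable borel" using g by (rule sqint_measurable)
  define Q :: "real \<Rightarrow> real \<Rightarrow> complex" where "Q = (\<lambda>s \<rho>. (indicator {\<bar>s\<bar>..} \<rho> * layer_weight \<rho>) *\<^sub>R g s)"
  have ind: "indicator {\<bar>s\<bar>..} \<rho> = (if \<bar>s\<bar> \<le> \<rho> then 1 else 0 :: real)" for s \<rho> :: real
    by (simp add: indicator_def)
  have Qm: "case_prod Q \<in> borel_measurable (lborel \<Otimes>\<^sub>M lborel)"
    unfolding Q_def ind by measurable
  have i: "integrable lborel (\<lambda>\<rho>. indicator {\<bar>s\<bar>..} \<rho> * layer_weight \<rho>)"
    and v: "(LINT \<rho>|lborel. indicator {\<bar>s\<bar>..} \<rho> * layer_weight \<rho>) = 1 / (1 + s\<^sup>2)" for s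
    using layer_cake[of s] by (simp_all add: has_bochner_integral_iff)
  have nrm: "norm (Q s \<rho>) = (indicator {\<bar>s\<bar>..} \<rho> * layer_weight \<rho>) * cmod (g s)" for s \<rho>
    by (simp add: Q_def layer_weight_nonneg indicator_def)
  have intQ: "integrable (lborel \<Otimes>\<^sub>M lborel) (case_prod Q)"
  proof (rule lborel_pair.Fubini_integrable[OF Qm])
    have "integrable lborel (\<lambda>s. cmod (g s * complex_of_real (1 / (1 + s\<^sup>2))))"
      by (intro integrable_norm sqint_mult_integrable g sqint_arctan_deriv)
    moreover have "(LINT \<rho>|lborel. norm (case_prod Q (s, \<rho>))) = cmod (g s * complex_of_real (1 / (1 + s\<^sup>2)))" for s
    proof -
      have "\<bar>1 / (1 + s\<^sup>2)\<bar> = 1 / (1 + s\<^sup>2)"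
        using one_plus_square_pos[of s] by simp
      then show ?thesis
        unfolding prod.case nrm integral_mult_left_zero v norm_mult norm_of_real by simp
    qed
    ultimately show "integrable lborel (\<lambda>s. LINT \<rho>|lborel. norm (case_prod Q (s, \<rho>)))" by simp
    show "AE s in lborel. integrable lborel (\<lambda>\<rho>. case_prod Q (s, \<rho>))"
      unfolding Q_def prod.case by (intro AE_I2 integrable_scaleR_left i)
  qed
  have "(LINT s|lborel. g s / complex_of_real (1 + s\<^sup>2)) = (LINT s|lborel. (LINT \<rho>|lborel. Q s \<rho>))"
  proof (rule Bochner_Integration.integral_cong[OF refl])
    fix s
    have "(LINT \<rho>|lborel. Q s \<rho>) = (1 / (1 + s\<^sup>2)) *\<^sub>R g s"
      unfolding Q_def v[symmetric] by (rule integral_scaleR_left) (rule i)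
    then show "g s / complex_of_real (1 + s\<^sup>2) = (LINT \<rho>|lborel. Q s \<rho>)"
      by (simp only: scaleR_conv_of_real of_real_divide) simp
  qed
  also have "\<dots> = (LINT \<rho>|lborel. (LINT s|lborel. Q s \<rho>))"
    by (rule lborel_pair.Fubini_integral[OF intQ, symmetric])
  also have "\<dots> = (LINT \<rho>|lborel. layer_weight \<rho> *\<^sub>R (LINT s|lborel. indicator {-\<rho>..\<rho>} s *\<^sub>R g s))"
  proof (rule Bochner_Integration.integral_cong[OF refl])
    fix \<rho> :: real
    have "Q s \<rho> = layer_weight \<rho> *\<^sub>R (indicator {-\<rho>..\<rho>} s *\<^sub>R g s)" for s
      by (auto simp: Q_def indicator_def)
    then show "(LINT s|lborel. Q s \<rho>) = layer_weight \<rho> *\<^sub>R (LINT s|lborel. indicator {-\<rho>..\<rho>} s *\<^sub>R g s)"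
      by (simp only: integral_scaleR_right)
  qed
  finally show ?thesis .
qed

text \<open>The substitution \<open>t = x + y * s\<close> normalises the Poisson kernel to
  \<open>1 / (1 + s^2)\<close>. The values of \<open>f\<close> then enter only through increments of
  its primitive, so differentiability of the primitive at a single point decides about the limit
  there.\<close>

lemma L2_boundary_layer_cake:
  assumes F: "L2_boundary F f" and y: "y > 0"
  shows "F (Complex x y) = complex_of_real (1 / pi) * (LINT \<rho>|lborel. layer_weight \<rho> *\<^sub>R
    ((primitive f (x + y * \<rho>) - primitive f (x - y * \<rho>)) / complex_of_real y))"
proof -
  note f = L2_boundary_sqint[OF F]
  have "F (Complex x y) = complex_of_real (y / pi) * (LINT t|lborel. f t / complex_of_real ((t - x)\<^sup>2 + y\<^sup>2))"
    using L2_boundary_poisson[OF F, of "Complex x y"] y by simp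
  also have "(LINT t|lborel. f t / complex_of_real ((t - x)\<^sup>2 + y\<^sup>2))
    = y *\<^sub>R (LINT s|lborel. f (x + y * s) / complex_of_real ((x + y * s - x)\<^sup>2 + y\<^sup>2))"
    using y by (subst lborel_integral_real_affine[where c = y and t = x]) auto
  also have "(LINT s|lborel. f (x + y * s) / complex_of_real ((x + y * s - x)\<^sup>2 + y\<^sup>2))
    = (LINT s|lborel. complex_of_real (1 / y\<^sup>2) * (f (x + y * s) / complex_of_real (1 + s\<^sup>2)))"
  proof (rule Bochner_Integration.integral_cong[OF refl])
    fix s
    have "(x + y * s - x)\<^sup>2 + y\<^sup>2 = y\<^sup>2 * (1 + s\<^sup>2)"
      by (simp add: power_mult_distrib algebra_simps)
    then show "f (x + y * s) / complex_of_real ((x + y * s - x)\<^sup>2 + y\<^sup>2) = complex_of_real (1 / y\<^sup>2) * (f (x + y * s) / complex_of_real (1 + s\<^sup>2))"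
      by (simp only: of_real_mult of_real_divide) simp
  qed
  also have "\<dots> = complex_of_real (1 / y\<^sup>2) * (LINT s|lborel. f (x + y * s) / complex_of_real (1 + s\<^sup>2))"
    by (rule integral_mult_right_zero)
  also have "(LINT s|lborel. f (x + y * s) / complex_of_real (1 + s\<^sup>2)) = (LINT \<rho>|lborel. layer_weight \<rho> *\<^sub>R (LINT s|lborel. indicator {-\<rho>..\<rho>} s *\<^sub>R f (x + y * s)))"
    using y by (intro layer_cake_integral sqint_affine f) simp
  also have "\<dots> = (LINT \<rho>|lborel. layer_weight \<rho> *\<^sub>R ((primitive f (x + y * \<rho>) - primitive f (x - y * \<rho>)) / complex_of_real y))"
  proof (rule Bochner_Integration.integral_cong[OF refl])
    fix \<rho> :: real
    show "layer_weight \<rho> *\<^sub>R (LINT s|lborel. indicator {-\<rho>..\<rho>} s *\<^sub>R f (x + y * s)) =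
      layer_weight \<rho> *\<^sub>R ((primitive f (x + y * \<rho>) - primitive f (x - y * \<rho>)) / complex_of_real y)"
    proof (cases "\<rho> \<ge> 0")
      case True
      have eq: "indicator {x - y * \<rho>..x + y * \<rho>} (x + y * s) = (indicator {-\<rho>..\<rho>} s :: real)" for s
      proof -
        have "x - y * \<rho> \<le> x + y * s \<longleftrightarrow> y * (- \<rho>) \<le> y * s" by simp
        also have "\<dots> \<longleftrightarrow> - \<rho> \<le> s" using y by (rule mult_le_cancel_left_pos)
        finally show ?thesis using y by (simp add: indicator_def)
      qed
      have "primitive f (x + y * \<rho>) - primitive f (x - y * \<rho>) = (LINT t|lborel. indicator {x - y * \<rho>..x + y * \<rho>} t *\<^sub>R f t)"
        using True y by (intro primitive_diff f) simp
      also have "\<dots> = y *\<^sub>R (LINT s|lborel. indicator {-\<rho>..\<rho>} s *\<^sub>R f (x + y * s))"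
        using y by (subst lborel_integral_real_affine[where c = y and t = x]) (simp_all add: eq)
      finally show ?thesis using y by (simp add: scaleR_conv_of_real)
    qed (simp add: layer_weight_def)
  qed
  finally show ?thesis using y by (simp add: scaleR_conv_of_real power2_eq_square)
qed

text \<open>Near \<open>x\<close> the linear bound is differentiability. For
  \<open>\<bar>h\<bar> \<ge> d\<close> the square root growth suffices, because there
  \<open>sqrt \<bar>h\<bar> \<le> \<bar>h\<bar> / sqrt d\<close>. A linear bound on all increments
  is needed for a majorant that does not depend on the point of approach.\<close>

lemma small_increment_global:
  assumes s: "small_increment \<phi> x l" and g: "\<And>a b. cmod (\<phi> b - \<phi> a) \<le> K * sqrt \<bar>b - a\<bar>"
  obtains A where "A \<ge> 0" "\<And>h. cmod (\<phi> (x + h) - \<phi> x) \<le> A * \<bar>h\<bar>"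
proof -
  obtain d where d: "d > 0" "\<And>h. \<bar>h\<bar> < d \<Longrightarrow> cmod (\<phi> (x + h) - \<phi> x - of_real h * l) \<le> 1 * \<bar>h\<bar>"
    using s unfolding small_increment_def by (metis zero_less_one)
  have "0 \<le> K * sqrt \<bar>1 - 0\<bar>"
    using g[of 1 0] norm_ge_zero order_trans by blast
  then have K: "K \<ge> 0" by simp
  define A where "A = (1 + cmod l) + K / sqrt d"
  have "cmod (\<phi> (x + h) - \<phi> x) \<le> A * \<bar>h\<bar>" for h
  proof (cases "\<bar>h\<bar> < d")
    case True
    have "cmod (\<phi> (x + h) - \<phi> x) \<le> cmod (\<phi> (x + h) - \<phi> x - of_real h * l) + cmod (of_real h * l)"
      by (metis add.commute diff_add_cancel norm_triangle_ineq)
    also have "\<dots> \<le> (1 + cmod l) * \<bar>h\<bar>"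
      using d(2)[OF True] by (simp add: norm_mult algebra_simps)
    also have "\<dots> \<le> A * \<bar>h\<bar>"
      using K d(1) by (intro mult_right_mono) (auto simp: A_def)
    finally show ?thesis .
  next
    case False
    have "cmod (\<phi> (x + h) - \<phi> x) \<le> K * sqrt \<bar>h\<bar>" using g[of "x + h" x] by simp
    also have "K * sqrt \<bar>h\<bar> \<le> K * (\<bar>h\<bar> / sqrt d)"
    proof (rule mult_left_mono[OF _ K])
      have "sqrt d * sqrt \<bar>h\<bar> \<le> sqrt \<bar>h\<bar> * sqrt \<bar>h\<bar>"
        using False by (intro mult_right_mono) auto
      then show "sqrt \<bar>h\<bar> \<le> \<bar>h\<bar> / sqrt d"
        using d(1) by (simp add: field_simps)
    qed
    also have "\<dots> \<le> A * \<bar>h\<bar>"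
      by (simp add: A_def algebra_simps)
    finally show ?thesis .
  qed
  moreover have "A \<ge> 0" using K d(1) by (simp add: A_def)
  ultimately show ?thesis by (rule that[rotated])
qed

text \<open>In a Stolz angle the distance of \<open>x n\<close> from \<open>x0\<close> is at most
  \<open>a * y n\<close>, so both endpoints \<open>x n + y n * \<rho>\<close> and
  \<open>x n - y n * \<rho>\<close> are within \<open>(a + \<rho>) * y n\<close> of
  \<open>x0\<close>. The error of the linear approximation is small compared with this distance and
  therefore survives the division by \<open>y n\<close>. For tangential approach the distance would
  not be controlled by \<open>y n\<close>.\<close>

lemma L2_boundary_nt_sequence:
  assumes F: "L2_boundary F f" and s: "small_increment (primitive f) x0 l"
    and a: "a > 0" and z: "\<And>n. z n \<in> stolz_angle a x0" "z \<longlonglongrightarrow> complex_of_real x0"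
  shows "(\<lambda>n. F (z n)) \<longlonglongrightarrow> l"
proof -
  note f = L2_boundary_sqint[OF F]
  define \<phi> where "\<phi> = primitive f"
  obtain A where A: "A \<ge> 0" "\<And>h. cmod (\<phi> (x0 + h) - \<phi> x0) \<le> A * \<bar>h\<bar>"
    using small_increment_global[OF s primitive_growth[OF f]] unfolding \<phi>_def by blast
  define x where "x = (\<lambda>n. Re (z n))"
  define y where "y = (\<lambda>n. Im (z n))"
  have y: "y n > 0" and xa: "\<bar>x n - x0\<bar> \<le> a * y n" for n
    using z(1)[of n] by (auto simp: stolz_angle_def x_def y_def)
  have xlim: "x \<longlonglongrightarrow> x0" and ylim: "y \<longlonglongrightarrow> 0"
    using tendsto_Re[OF z(2)] tendsto_Im[OF z(2)] by (auto simp: x_def y_def)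
  define D where "D = (\<lambda>n \<rho>. (\<phi> (x n + y n * \<rho>) - \<phi> (x n - y n * \<rho>)) / complex_of_real (y n))"
  have off: "\<bar>x n - x0 + y n * \<rho>\<bar> \<le> (a + \<rho>) * y n" "\<bar>x n - x0 - y n * \<rho>\<bar> \<le> (a + \<rho>) * y n" if "\<rho> \<ge> 0" for n \<rho>
  proof -
    have "\<bar>y n * \<rho>\<bar> = \<rho> * y n" using that y[of n] by (simp add: abs_mult mult.commute)
    then show "\<bar>x n - x0 + y n * \<rho>\<bar> \<le> (a + \<rho>) * y n" "\<bar>x n - x0 - y n * \<rho>\<bar> \<le> (a + \<rho>) * y n"
      using xa[of n] by (auto simp: distrib_right)
  qed
  have Dlim: "(\<lambda>n. D n \<rho>) \<longlonglongrightarrow> of_real (2 * \<rho>) * l" if \<rho>: "\<rho> \<ge> 0" for \<rho>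
  proof (rule LIMSEQ_I)
    fix e :: real assume e: "e > 0"
    \<comment> \<open>Each of the two endpoints contributes an error of
      \<open>e' * (a + \<rho>) = e / 4\<close> after division by \<open>y n\<close>, which leaves
      \<open>e / 2\<close> in total.\<close>
    define e' where "e' = e / (4 * (a + \<rho>))"
    have e': "e' > 0" using e a \<rho> by (simp add: e'_def)
    obtain d where d: "d > 0" "\<And>h. \<bar>h\<bar> < d \<Longrightarrow> cmod (\<phi> (x0 + h) - \<phi> x0 - of_real h * l) \<le> e' * \<bar>h\<bar>"
      using s e' unfolding small_increment_def \<phi>_def by blast
    have "(\<lambda>n. (a + \<rho>) * y n) \<longlonglongrightarrow> (a + \<rho>) * 0" by (intro tendsto_intros ylim)
    then have "\<forall>\<^sub>F n in sequentially. (a + \<rho>) * y n < d"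
      using d(1) by (intro order_tendstoD(2)) auto
    then obtain N where N: "\<And>n. n \<ge> N \<Longrightarrow> (a + \<rho>) * y n < d"
      by (auto simp: eventually_sequentially)
    have "norm (D n \<rho> - of_real (2 * \<rho>) * l) < e" if n: "n \<ge> N" for n
    proof -
      define p where "p = x n - x0 + y n * \<rho>"
      define q where "q = x n - x0 - y n * \<rho>"
      have pq: "\<bar>p\<bar> \<le> (a + \<rho>) * y n" "\<bar>q\<bar> \<le> (a + \<rho>) * y n"
        using off[OF \<rho>, of n] by (auto simp: p_def q_def)
      have xp: "x n + y n * \<rho> = x0 + p" "x n - y n * \<rho> = x0 + q" "p - q = 2 * \<rho> * y n"
        by (auto simp: p_def q_def)
      have b: "cmod (\<phi> (x0 + h) - \<phi> x0 - of_real h * l) \<le> e' * ((a + \<rho>) * y n)" if "\<bar>h\<bar> \<le> (a + \<rho>) * y n" for h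
        using d(2)[of h] N[OF n] that mult_left_mono[OF that, of e'] e' by linarith
      have "complex_of_real (y n) * (D n \<rho> - of_real (2 * \<rho>) * l) = \<phi> (x0 + p) - \<phi> (x0 + q) - of_real (2 * \<rho> * y n) * l"
        using y[of n] unfolding D_def xp(1,2) by (simp add: field_simps)
      also have "\<dots> = (\<phi> (x0 + p) - \<phi> x0 - of_real p * l) - (\<phi> (x0 + q) - \<phi> x0 - of_real q * l)"
        unfolding xp(3)[symmetric] by (simp add: algebra_simps)
      also have "cmod \<dots> \<le> e' * ((a + \<rho>) * y n) + e' * ((a + \<rho>) * y n)"
        by (rule order_trans[OF norm_triangle_ineq4 add_mono[OF b[OF pq(1)] b[OF pq(2)]]])
      also have "\<dots> = (e / 2) * y n"
      proof -
        have "e / (4 * r) * r = e / 4" if "r \<noteq> 0" for r :: real using that by simp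
        from this[of "a + \<rho>"] have "e' * (a + \<rho>) = e / 4" using a \<rho> by (simp only: e'_def)
        then show ?thesis by (simp flip: mult.assoc)
      qed
      finally have "y n * norm (D n \<rho> - of_real (2 * \<rho>) * l) \<le> y n * (e / 2)"
        using y[of n] by (simp add: norm_mult mult.commute)
      then have "norm (D n \<rho> - of_real (2 * \<rho>) * l) \<le> e / 2"
        using y[of n] by simp
      then show ?thesis using e by linarith
    qed
    then show "\<exists>N. \<forall>n\<ge>N. norm (D n \<rho> - of_real (2 * \<rho>) * l) < e" by blast
  qed
  have Dbound: "cmod (D n \<rho>) \<le> 2 * A * (a + \<rho>)" if \<rho>: "\<rho> \<ge> 0" for n \<rho>
  proof -
    have b: "cmod (\<phi> (x0 + h) - \<phi> x0) \<le> A * ((a + \<rho>) * y n)" if "\<bar>h\<bar> \<le> (a + \<rho>) * y n" for h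
      using A(2)[of h] mult_left_mono[OF that A(1)] by linarith
    have "\<phi> (x n + y n * \<rho>) - \<phi> (x n - y n * \<rho>) = (\<phi> (x0 + (x n - x0 + y n * \<rho>)) - \<phi> x0) - (\<phi> (x0 + (x n - x0 - y n * \<rho>)) - \<phi> x0)"
      by simp
    also have "cmod \<dots> \<le> A * ((a + \<rho>) * y n) + A * ((a + \<rho>) * y n)"
      by (rule order_trans[OF norm_triangle_ineq4 add_mono[OF b[OF off(1)[OF \<rho>]] b[OF off(2)[OF \<rho>]]]])
    finally show ?thesis using y[of n] by (simp add: D_def norm_divide field_simps)
  qed
  have \<phi>m [measurable]: "\<phi> \<in> borel_measurable borel"
    unfolding \<phi>_def by (intro borel_measurable_continuous_onI primitive_continuous f)
  have "(\<lambda>n. LINT \<rho>|lborel. layer_weight \<rho> *\<^sub>R D n \<rho>) \<longlonglongrightarrow> (LINT \<rho>|lborel. layer_weight \<rho> *\<^sub>R (of_real (2 * \<rho>) * l))"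
  proof (rule integral_dominated_convergence)
    \<comment> \<open>The bound on \<open>D\<close> grows linearly in \<open>\<rho>\<close>, whereas
      the weight decays like the inverse cube; with
      \<open>\<rho> * (a + \<rho>) \<le> (a + 1) * (1 + \<rho>^2)\<close> their product is below
      this multiple of \<open>1 / (1 + \<rho>^2)\<close>.\<close>
    show "integrable lborel (\<lambda>\<rho>. 4 * A * (a + 1) * (1 / (1 + \<rho>\<^sup>2)))"
      using has_bochner_integral_arctan_deriv by (intro integrable_mult_right) (simp add: has_bochner_integral_iff)
    show "(\<lambda>\<rho>. layer_weight \<rho> *\<^sub>R (of_real (2 * \<rho>) * l)) \<in> borel_measurable lborel"
      "(\<lambda>\<rho>. layer_weight \<rho> *\<^sub>R D n \<rho>) \<in> borel_measurable lborel" for n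
      unfolding D_def by measurable
    show "AE \<rho> in lborel. (\<lambda>n. layer_weight \<rho> *\<^sub>R D n \<rho>) \<longlonglongrightarrow> layer_weight \<rho> *\<^sub>R (of_real (2 * \<rho>) * l)"
    proof (rule AE_I2)
      fix \<rho> :: real
      show "(\<lambda>n. layer_weight \<rho> *\<^sub>R D n \<rho>) \<longlonglongrightarrow> layer_weight \<rho> *\<^sub>R (of_real (2 * \<rho>) * l)"
        using Dlim[of \<rho>] by (cases "\<rho> \<ge> 0") (auto intro!: tendsto_intros simp: layer_weight_def)
    qed
    show "AE \<rho> in lborel. norm (layer_weight \<rho> *\<^sub>R D n \<rho>) \<le> 4 * A * (a + 1) * (1 / (1 + \<rho>\<^sup>2))" for n
    proof (rule AE_I2)
      fix \<rho> :: real
      show "norm (layer_weight \<rho> *\<^sub>R D n \<rho>) \<le> 4 * A * (a + 1) * (1 / (1 + \<rho>\<^sup>2))"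
      proof (cases "\<rho> \<ge> 0")
        case True
        have le: "\<rho> * (a + \<rho>) \<le> (a + 1) * (1 + \<rho>\<^sup>2)"
        proof -
          have "0 \<le> (\<rho> - 1)\<^sup>2" by simp
          then have "2 * \<rho> \<le> 1 + \<rho>\<^sup>2" by (simp add: power2_diff)
          then have "\<rho> * a \<le> (1 + \<rho>\<^sup>2) * a" using a True by (intro mult_right_mono) auto
          then show ?thesis by (simp add: algebra_simps power2_eq_square)
        qed
        have "norm (layer_weight \<rho> *\<^sub>R D n \<rho>) \<le> layer_weight \<rho> * (2 * A * (a + \<rho>))"
          using Dbound[OF True, of n] layer_weight_nonneg[of \<rho>] by (auto intro!: mult_left_mono)
        also have "\<dots> = 4 * A * (\<rho> * (a + \<rho>)) / (1 + \<rho>\<^sup>2)\<^sup>2"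
          using True by (simp add: layer_weight_def)
        also have "\<dots> \<le> 4 * A * ((a + 1) * (1 + \<rho>\<^sup>2)) / (1 + \<rho>\<^sup>2)\<^sup>2"
          using A(1) le by (intro divide_right_mono mult_left_mono) auto
        also have "\<dots> = 4 * A * (a + 1) * (1 / (1 + \<rho>\<^sup>2))"
          using one_plus_square_pos[of \<rho>] by (simp add: power2_eq_square[of "1 + \<rho>\<^sup>2"])
        finally show ?thesis .
      qed (use A(1) a in \<open>simp add: layer_weight_def\<close>)
    qed
  qed
  moreover have "(LINT \<rho>|lborel. layer_weight \<rho> *\<^sub>R (of_real (2 * \<rho>) * l)) = of_real pi * l"
  proof -
    have "layer_weight \<rho> *\<^sub>R (of_real (2 * \<rho>) * l) = complex_of_real (layer_weight \<rho> * (2 * \<rho>)) * l" for \<rho>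
      by (simp add: scaleR_conv_of_real)
    moreover have "(LINT \<rho>|lborel. complex_of_real (layer_weight \<rho> * (2 * \<rho>)) * l) = complex_of_real (LINT \<rho>|lborel. layer_weight \<rho> * (2 * \<rho>)) * l"
      by (simp only: integral_mult_left_zero integral_complex_of_real)
    ultimately show ?thesis using layer_weight_moment by (simp only: has_bochner_integral_iff)
  qed
  ultimately have "(\<lambda>n. complex_of_real (1 / pi) * (LINT \<rho>|lborel. layer_weight \<rho> *\<^sub>R D n \<rho>)) \<longlonglongrightarrow> complex_of_real (1 / pi) * (of_real pi * l)"
    by (intro tendsto_mult_left) simp
  moreover have "F (z n) = complex_of_real (1 / pi) * (LINT \<rho>|lborel. layer_weight \<rho> *\<^sub>R D n \<rho>)" for n
    using L2_boundary_layer_cake[OF F y, of "x n" n] by (simp add: D_def \<phi>_def x_def y_def)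
  ultimately show ?thesis by simp
qed

text \<open>The points left out are those where the primitive fails to have derivative
  \<open>f x\<close>. This set does not depend on the aperture, so all Stolz angles are handled at
  once.\<close>

theorem L2_boundary_nt_limit:
  assumes F: "L2_boundary F f"
  shows "AE x in lborel. nt_limit F x (f x)"
  using primitive_differentiable_AE[OF L2_boundary_sqint[OF F]]
proof eventually_elim
  fix x assume s: "small_increment (primitive f) x (f x)"
  show "nt_limit F x (f x)"
    unfolding nt_limit_def
  proof (intro allI impI)
    fix a :: real assume a: "a > 0"
    show "(F \<longlongrightarrow> f x) (at (complex_of_real x) within stolz_angle a x)"
      unfolding tendsto_at_iff_sequentially
    proof (intro allI impI)
      fix z assume "\<forall>n. z n \<in> stolz_angle a x - {complex_of_real x}" "z \<longlonglongrightarrow> complex_of_real x"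
      then show "(F \<circ> z) \<longlonglongrightarrow> f x"
        unfolding o_def by (intro L2_boundary_nt_sequence[OF F s a]) auto
    qed
  qed
qed

text \<open>The vertical approach stays in a Stolz angle, so a non-tangential limit is determined by
  it; this gives the uniqueness that the definite description in \<open>nt_boundary\<close>
  requires.\<close>

lemma nt_limit_sequence:
  assumes "nt_limit F x l"
  shows "(\<lambda>n. F (Complex x (inverse (Suc n)))) \<longlonglongrightarrow> l"
proof -
  define w where "w = (\<lambda>n. Complex x (inverse (Suc n)))"
  have "w n \<in> stolz_angle 1 x - {complex_of_real x}" for n
    by (auto simp: w_def stolz_angle_def complex_eq_iff)
  moreover have "w \<longlonglongrightarrow> complex_of_real x"
    unfolding w_def by (intro tendsto_Complex_vertical LIMSEQ_inverse_real_of_nat)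
  moreover have "(F \<longlongrightarrow> l) (at (complex_of_real x) within stolz_angle 1 x)"
    using assms by (simp add: nt_limit_def)
  ultimately have "(F \<circ> w) \<longlonglongrightarrow> l"
    unfolding tendsto_at_iff_sequentially by blast
  then show ?thesis by (simp add: w_def o_def)
qed

lemma nt_boundary_eq:
  assumes "nt_limit F x l"
  shows "nt_boundary F x = l"
  unfolding nt_boundary_def
  by (rule the_equality, rule assms) (rule LIMSEQ_unique[OF nt_limit_sequence nt_limit_sequence[OF assms]])

lemma L2_boundary_nt_boundary:
  assumes "L2_boundary F f"
  shows "AE x in lborel. nt_boundary F x = f x"
  using L2_boundary_nt_limit[OF assms] by eventually_elim (rule nt_boundary_eq)

section \<open>Hankel operators and their Carleson measures\<close>

text \<open>Completeness of Lebesgue measure makes \<open>k\<close> measurable. This matters for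
  integrands built from \<open>nt_boundary\<close>, whose values are unspecified on a null
  set.\<close>

lemma integral_lebesgue_cong_AE:
  fixes h k :: "real \<Rightarrow> complex"
  assumes h: "h \<in> borel_measurable borel" and eq: "AE x in lborel. k x = h x"
  shows "(LINT x|lebesgue. k x) = (LINT x|lborel. h x)"
proof -
  have hl: "h \<in> borel_measurable lborel" using h by simp
  have hm: "h \<in> borel_measurable lebesgue" using hl by (rule measurable_completion)
  have eq': "AE x in lebesgue. k x = h x" using eq by (rule AE_completion)
  then have eq'': "AE x in lebesgue. h x = k x" by eventually_elim simp
  have km: "k \<in> borel_measurable lebesgue" by (rule borel_measurable_AE[OF hm eq''])
  have "(LINT x|lebesgue. k x) = (LINT x|lebesgue. h x)"
    by (rule integral_cong_AE[OF km hm eq'])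
  also have "\<dots> = (LINT x|lborel. h x)" by (rule integral_completion[OF hl])
  finally show "(LINT x|lebesgue. k x) = (LINT x|lborel. h x)" .
qed

lemma L2_inner_cong_AE:
  assumes "f \<in> borel_measurable borel" "g \<in> borel_measurable borel"
    and "AE x in lborel. f' x = f x" "AE x in lborel. g' x = g x"
  shows "L2_inner f' g' = (LINT x|lborel. cnj (f x) * g x)"
  unfolding L2_inner_def
proof (rule integral_lebesgue_cong_AE)
  show "(\<lambda>x. cnj (f x) * g x) \<in> borel_measurable borel"
    using assms(1,2) by (intro borel_measurable_times borel_measurable_cnj')
  show "AE x in lborel. cnj (f' x) * g' x = cnj (f x) * g x"
    using assms(3,4) by eventually_elim simp
qed

lemma H2_boundary_exists:
  assumes "F \<in> H2"
  obtains f where "L2_boundary F f"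
  using H2_L2_boundary[OF assms] by blast

lemma H2_inner_eq:
  assumes "L2_boundary F f" "L2_boundary G g"
  shows "H2_inner F G = (LINT x|lborel. cnj (f x) * g x)"
  unfolding H2_inner_def using assms
  by (intro L2_inner_cong_AE L2_boundary_nt_boundary sqint_measurable L2_boundary_sqint)

lemma H2_norm_eq:
  assumes "L2_boundary F f"
  shows "H2_norm F = sqrt (nsq f)"
  unfolding H2_norm_def H2_inner_eq[OF assms assms] by (simp flip: nsq_eq_inner)

lemma AE_lborel_reflect:
  assumes "AE x in lborel. P (x::real)"
  shows "AE x in lborel. P (- x)"
proof -
  obtain N where N: "{x \<in> space lborel. \<not> P x} \<subseteq> N" "emeasure lborel N = 0" "N \<in> sets lborel"
    using assms by (rule AE_E)
  then have "AE x in lborel. x \<notin> N" by (intro AE_not_in) (auto simp: null_sets_def)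
  then have "AE x in lborel. 0 + (-1) * x \<notin> N"
    using N(3) by (intro AE_borel_affine) auto
  then show ?thesis using N(1) by (auto elim!: eventually_mono)
qed

text \<open>The earlier formula is for products of two boundary functions, while a single one is
  only square-integrable. The Poisson kernel at \<open>w\<close> is a multiple of the difference of
  the Cauchy kernels with poles \<open>w\<close> and \<open>cnj w\<close>, and the second of these
  is itself a boundary function, so its integral against \<open>f\<close> vanishes.\<close>

lemma L2_boundary_cauchy_formula:
  assumes F: "L2_boundary F f" and w: "Im w > 0"
  shows "(LINT x|lborel. f x * (1 / (complex_of_real x - w))) = 2 * pi * \<i> * F w"
proof -
  have cw: "Im (cnj w) < 0" using w by simp
  note f = L2_boundary_sqint[OF F]
  have i: "integrable lborel (\<lambda>x. f x * (1 / (complex_of_real x - a)))" if "Im a \<noteq> 0" for a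
    by (intro sqint_mult_integrable f sqint_cauchy_kernel that)
  have "2 * \<i> * complex_of_real (Im w) * (f x / complex_of_real ((x - Re w)\<^sup>2 + (Im w)\<^sup>2))
    = f x * (1 / (complex_of_real x - w)) - f x * (1 / (complex_of_real x - cnj w))" for x
  proof -
    have nz: "complex_of_real x - w \<noteq> 0" "complex_of_real x - cnj w \<noteq> 0"
      using w by (auto simp: complex_eq_iff)
    have "complex_of_real ((x - Re w)\<^sup>2 + (Im w)\<^sup>2) = (complex_of_real x - w) * (complex_of_real x - cnj w)"
      unfolding cmod_diff_real_square[symmetric] complex_norm_square by simp
    moreover have "2 * \<i> * complex_of_real (Im w) = (complex_of_real x - cnj w) - (complex_of_real x - w)"
      by (simp add: complex_eq_iff)
    ultimately show ?thesis using nz by (simp only:) (simp add: field_simps)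
  qed
  then have "2 * \<i> * complex_of_real (Im w) * (LINT x|lborel. f x / complex_of_real ((x - Re w)\<^sup>2 + (Im w)\<^sup>2))
    = (LINT x|lborel. f x * (1 / (complex_of_real x - w)) - f x * (1 / (complex_of_real x - cnj w)))"
    by (simp only: flip: integral_mult_right_zero)
  also have "\<dots> = (LINT x|lborel. f x * (1 / (complex_of_real x - w))) - (LINT x|lborel. f x * (1 / (complex_of_real x - cnj w)))"
    using w by (intro Bochner_Integration.integral_diff i) auto
  also have "(LINT x|lborel. f x * (1 / (complex_of_real x - cnj w))) = 0"
    by (rule L2_boundary_mult_integral[OF F cauchy_kernel_L2_boundary[OF cw]])
  finally show ?thesis
    using w unfolding L2_boundary_poisson[OF F w] by (simp add: field_simps)
qed

text \<open>Existence is supplied by \<open>F\<close>. For uniqueness, orthogonality is tested on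
  \<open>cauchy_kernel (cnj w)\<close>: by Cauchy's formula this expresses the value of any solution
  at \<open>w\<close> through \<open>p\<close> alone.\<close>

lemma P_plus_eqI:
  assumes F: "F \<in> H2" and p: "sqint p" and pp: "AE x in lborel. p' x = p x"
    and orth: "\<And>G. G \<in> H2 \<Longrightarrow> L2_inner (nt_boundary G) (\<lambda>x. p' x - nt_boundary F x) = 0"
  shows "P_plus p' = F"
  unfolding P_plus_def
proof (rule the_equality)
  show "F \<in> H2 \<and> (\<forall>G\<in>H2. L2_inner (nt_boundary G) (\<lambda>x. p' x - nt_boundary F x) = 0)"
    using F orth by blast
next
  fix E assume E: "E \<in> H2 \<and> (\<forall>G\<in>H2. L2_inner (nt_boundary G) (\<lambda>x. p' x - nt_boundary E x) = 0)"
  have key: "2 * pi * \<i> * A w = (LINT x|lborel. p x * (1 / (complex_of_real x - w)))"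
    if A: "A \<in> H2" and orthA: "\<And>G. G \<in> H2 \<Longrightarrow> L2_inner (nt_boundary G) (\<lambda>x. p' x - nt_boundary A x) = 0" and w: "Im w > 0" for A w
  proof -
    obtain a where a: "L2_boundary A a" by (rule H2_boundary_exists[OF A])
    have cw: "Im (cnj w) < 0" using w by simp
    note kb = cauchy_kernel_L2_boundary[OF cw]
    have i: "integrable lborel (\<lambda>x. h x * (1 / (complex_of_real x - w)))" if "sqint h" for h
      using w by (intro sqint_mult_integrable that sqint_cauchy_kernel) auto
    have "0 = L2_inner (nt_boundary (cauchy_kernel (cnj w))) (\<lambda>x. p' x - nt_boundary A x)"
      using orthA[OF cauchy_kernel_H2[OF cw]] by simp
    also have "\<dots> = (LINT x|lborel. cnj (1 / (complex_of_real x - cnj w)) * (p x - a x))"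
    proof (rule L2_inner_cong_AE)
      show "AE x in lborel. p' x - nt_boundary A x = p x - a x"
        using pp L2_boundary_nt_boundary[OF a] by eventually_elim simp
      show "(\<lambda>x. p x - a x) \<in> borel_measurable borel"
        by (intro sqint_measurable sqint_diff p L2_boundary_sqint[OF a])
      show "(\<lambda>x. 1 / (complex_of_real x - cnj w)) \<in> borel_measurable borel"
        by (intro sqint_measurable L2_boundary_sqint[OF kb])
    qed (rule L2_boundary_nt_boundary[OF kb])
    also have "\<dots> = (LINT x|lborel. p x * (1 / (complex_of_real x - w)) - a x * (1 / (complex_of_real x - w)))"
      by (intro Bochner_Integration.integral_cong refl) (simp add: algebra_simps diff_divide_distrib)
    also have "\<dots> = (LINT x|lborel. p x * (1 / (complex_of_real x - w))) - (LINT x|lborel. a x * (1 / (complex_of_real x - w)))"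
      by (intro Bochner_Integration.integral_diff i p L2_boundary_sqint[OF a])
    finally show ?thesis unfolding L2_boundary_cauchy_formula[OF a w] by simp
  qed
  show "E = F"
  proof
    fix z
    show "E z = F z"
    proof (cases "Im z > 0")
      case True
      have "2 * pi * \<i> * E z = 2 * pi * \<i> * F z"
        using key[of E z] key[of F z] E F orth True by simp
      then show ?thesis by simp
    next
      case False
      then show ?thesis using E F by (auto simp: H2_def holo_upper_def upper_half_plane_def)
    qed
  qed
qed

lemma dagger_L2_boundary:
  assumes G: "L2_boundary G g"
  shows "L2_boundary (dagger G) (\<lambda>x. cnj (g (- x)))"
proof -
  have "nsq (\<lambda>x. dagger G (Complex x y) - cnj (g (- x))) = nsq (\<lambda>x. G (Complex x y) - g x)" for y
  proof -
    have "dagger G (Complex x y) - cnj (g (- x)) = cnj (G (Complex (- x) y) - g (- x))" for x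
      by (simp add: dagger_Complex)
    then have "nsq (\<lambda>x. dagger G (Complex x y) - cnj (g (- x))) = nsq (\<lambda>x. G (Complex (- x) y) - g (- x))"
      by (simp only: nsq_cnj)
    also have "\<dots> = nsq (\<lambda>x. G (Complex x y) - g x)"
      by (rule nsq_reflect[of "\<lambda>x. G (Complex x y) - g x"])
    finally show ?thesis .
  qed
  then show ?thesis
    using G unfolding L2_boundary_def by (auto intro: dagger_H2 sqint_cnj sqint_reflect)
qed

text \<open>Partial fractions separate the kernel of the symbol into a part evaluated by
  \<open>L2_boundary_cauchy\<close> and a part annihilated by
  \<open>L2_boundary_cauchy_outside\<close>.\<close>

lemma conjugate_poisson_kernel_split:
  assumes "t > 0"
  shows "complex_of_real (x / (t\<^sup>2 + x\<^sup>2)) = (1 / 2) * (1 / (complex_of_real x - \<i> * t) + 1 / (complex_of_real x - (- \<i> * t)))"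
proof -
  have nz: "complex_of_real x - \<i> * t \<noteq> 0" "complex_of_real x - (- \<i> * t) \<noteq> 0"
    using assms by (auto simp: complex_eq_iff)
  have "complex_of_real (t\<^sup>2 + x\<^sup>2) = (complex_of_real x - \<i> * t) * (complex_of_real x - (- \<i> * t))"
    by (simp add: power2_eq_square algebra_simps)
  then show ?thesis using nz by (simp only: of_real_divide) (simp add: field_simps)
qed

lemma borel_measurable_conjugate_poisson:
  "(\<lambda>t. x / (t\<^sup>2 + x\<^sup>2)) \<in> borel_measurable borel" for x :: real
  by measurable

text \<open>Compares the kernel of the symbol with \<open>1 / (t + s)^2\<close> at
  \<open>s = \<bar>x\<bar>\<close>, whose integral over a Carleson measure is accessible through
  Cauchy kernels.\<close>

lemma conjugate_poisson_le:
  fixes t x :: real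
  assumes "t > 0"
  shows "\<bar>x / (t\<^sup>2 + x\<^sup>2)\<bar> \<le> 2 * \<bar>x\<bar> * (1 / (t + \<bar>x\<bar>)\<^sup>2)"
proof -
  have "(t + \<bar>x\<bar>)\<^sup>2 \<le> 2 * (t\<^sup>2 + x\<^sup>2)"
    using sum_squares_bound[of t "\<bar>x\<bar>"] by (simp add: power2_sum)
  moreover have "0 < (t + \<bar>x\<bar>)\<^sup>2" "0 < t\<^sup>2 + x\<^sup>2" using assms by (auto intro: add_pos_nonneg)
  ultimately have "1 / (t\<^sup>2 + x\<^sup>2) \<le> 2 * (1 / (t + \<bar>x\<bar>)\<^sup>2)"
    by (simp add: field_simps)
  then have "\<bar>x\<bar> * (1 / (t\<^sup>2 + x\<^sup>2)) \<le> \<bar>x\<bar> * (2 * (1 / (t + \<bar>x\<bar>)\<^sup>2))"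
    by (intro mult_left_mono) auto
  then show ?thesis using \<open>0 < t\<^sup>2 + x\<^sup>2\<close> by (simp add: abs_divide mult.commute)
qed

section \<open>The symbol of a Carleson measure\<close>

locale carleson =
  fixes H :: "(complex \<Rightarrow> complex) \<Rightarrow> (complex \<Rightarrow> complex)" and \<mu> :: "real measure"
  assumes bounded: "H2_bounded_operator H" and carleson: "carleson_measure H \<mu>"
begin

lemma H_H2: "F \<in> H2 \<Longrightarrow> H F \<in> H2"
  using bounded by (simp add: H2_bounded_operator_def)

lemma sets_mu: "sets \<mu> = sets (restrict_space borel {0<..})"
  using carleson by (simp add: carleson_measure_def)

lemma space_mu: "space \<mu> = {0<..}"
  using sets_eq_imp_space_eq[OF sets_mu] by (simp add: space_restrict_space)

lemma measurable_mu: "f \<in> borel_measurable borel \<Longrightarrow> f \<in> borel_measurable \<mu>"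
  using measurable_cong_sets[OF sets_mu refl] measurable_restrict_space1 by blast

lemma inner_mu:
  assumes "F \<in> H2" "G \<in> H2"
  shows "integrable \<mu> (\<lambda>t. cnj (F (\<i> * complex_of_real t)) * G (\<i> * complex_of_real t))"
    "H2_inner F (H G) = (LINT t|\<mu>. cnj (F (\<i> * complex_of_real t)) * G (\<i> * complex_of_real t))"
  using carleson assms by (auto simp: carleson_measure_def)

text \<open>Testing the form on the reproducing kernels \<open>1 / (z + \<i> * s)\<close>.\<close>

lemma kernel_bound:
  obtains B where "B \<ge> 0" "\<And>s. s > 0 \<Longrightarrow> integrable \<mu> (\<lambda>t. 1 / (t + s)\<^sup>2)"
    "\<And>s. s > 0 \<Longrightarrow> (LINT t|\<mu>. 1 / (t + s)\<^sup>2) \<le> B * (pi / s)"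
proof -
  obtain B where B: "\<And>F. F \<in> H2 \<Longrightarrow> H2_norm (H F) \<le> B * H2_norm F"
    using bounded unfolding H2_bounded_operator_def by blast
  \<comment> \<open>The absolute value appears because no sign of \<open>B\<close> is known.
    Cauchy-Schwarz and the operator bound give \<open>\<bar>B\<bar>\<close> times the squared norm
    of the kernel, which is \<open>pi / s\<close>.\<close>
  have main: "integrable \<mu> (\<lambda>t. 1 / (t + s)\<^sup>2) \<and> (LINT t|\<mu>. 1 / (t + s)\<^sup>2) \<le> \<bar>B\<bar> * (pi / s)" if s: "s > 0" for s
  proof -
    define a where "a = - \<i> * complex_of_real s"
    have a: "Im a < 0" using s by (simp add: a_def)
    let ?K = "cauchy_kernel a" and ?k = "\<lambda>x. 1 / (complex_of_real x - a)"
    note KH = cauchy_kernel_H2[OF a] and Kb = cauchy_kernel_L2_boundary[OF a]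
    obtain g where g: "L2_boundary (H ?K) g" by (rule H2_boundary_exists[OF H_H2[OF KH]])
    have eq: "cnj (?K (\<i> * complex_of_real t)) * ?K (\<i> * complex_of_real t) = complex_of_real (1 / (t + s)\<^sup>2)" if "t \<in> space \<mu>" for t
    proof -
      have "t > 0" using that by (simp add: space_mu)
      then have K: "?K (\<i> * complex_of_real t) = 1 / (\<i> * complex_of_real (t + s))"
        by (simp add: cauchy_kernel_def upper_half_plane_def a_def algebra_simps)
      have "cnj (1 / (\<i> * complex_of_real r)) * (1 / (\<i> * complex_of_real r)) = complex_of_real (1 / r\<^sup>2)" for r
        by (cases "r = 0") (simp_all add: power2_eq_square field_simps)
      then show ?thesis unfolding K .
    qed
    have "integrable \<mu> (\<lambda>t. complex_of_real (1 / (t + s)\<^sup>2))"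
      by (rule iffD1[OF Bochner_Integration.integrable_cong[OF refl] inner_mu(1)[OF KH KH]]) (rule eq)
    then have int: "integrable \<mu> (\<lambda>t. 1 / (t + s)\<^sup>2)"
      using complex_of_real_integrable_eq by blast
    have "complex_of_real (LINT t|\<mu>. 1 / (t + s)\<^sup>2) = (LINT t|\<mu>. complex_of_real (1 / (t + s)\<^sup>2))"
      by (rule integral_complex_of_real[symmetric])
    also have "\<dots> = H2_inner ?K (H ?K)"
      unfolding inner_mu(2)[OF KH KH] using eq by (intro Bochner_Integration.integral_cong) auto
    also have "\<dots> = (LINT x|lborel. cnj (?k x) * g x)"
      by (rule H2_inner_eq[OF Kb g])
    finally have "(LINT t|\<mu>. 1 / (t + s)\<^sup>2) \<le> cmod (LINT x|lborel. cnj (?k x) * g x)"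
      by (metis abs_ge_self norm_of_real)
    also have "\<dots> \<le> (LINT x|lborel. cmod (cnj (?k x) * g x))"
      by (rule integral_norm_bound)
    also have "\<dots> \<le> sqrt (nsq (\<lambda>x. cnj (?k x))) * sqrt (nsq g)"
      by (intro integral_cmod_mult_le sqint_cnj L2_boundary_sqint[OF Kb] L2_boundary_sqint[OF g])
    also have "\<dots> = sqrt (nsq ?k) * H2_norm (H ?K)"
      by (simp only: nsq_cnj H2_norm_eq[OF g])
    also have "\<dots> \<le> sqrt (nsq ?k) * (\<bar>B\<bar> * sqrt (nsq ?k))"
    proof (rule mult_left_mono)
      have "H2_norm (H ?K) \<le> B * sqrt (nsq ?k)" using B[OF KH] by (simp only: H2_norm_eq[OF Kb])
      also have "\<dots> \<le> \<bar>B\<bar> * sqrt (nsq ?k)" by (intro mult_right_mono) auto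
      finally show "H2_norm (H ?K) \<le> \<bar>B\<bar> * sqrt (nsq ?k)" .
    qed simp
    also have "\<dots> = \<bar>B\<bar> * nsq ?k"
      using real_sqrt_mult_self[of "nsq ?k"] by (simp add: algebra_simps)
    also have "nsq ?k = pi / s"
      using nsq_cauchy_kernel[of a] a s by (simp add: a_def)
    finally show ?thesis using int by simp
  qed
  show ?thesis by (rule that[of "\<bar>B\<bar>"]) (use main in auto)
qed

lemma kernel_integrable: "s > 0 \<Longrightarrow> integrable \<mu> (\<lambda>t. 1 / (t + s)\<^sup>2)"
  by (rule kernel_bound) blast

text \<open>Needed for Fubini's theorem and for measurability of parameter integrals. On
  \<open>{0<..real n}\<close> the integrable function \<open>1 / (t + 1)^2\<close> is at least
  \<open>1 / (n + 1)^2\<close>, so these intervals have finite measure.\<close>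

lemma sigma_finite_mu: "sigma_finite_measure \<mu>"
proof
  define A where "A = (\<lambda>n::nat. {0<..real n})"
  have A: "A n \<in> sets \<mu>" for n
    unfolding sets_mu A_def by (subst sets_restrict_space_iff) auto
  have fin: "emeasure \<mu> (A n) < \<infinity>" for n
  proof -
    have "emeasure \<mu> (A n) = (\<integral>\<^sup>+t. indicator (A n) t \<partial>\<mu>)" using A by simp
    also have "\<dots> \<le> (\<integral>\<^sup>+t. ennreal ((real n + 1)\<^sup>2 * (1 / (t + 1)\<^sup>2)) \<partial>\<mu>)"
    proof (rule nn_integral_mono)
      fix t
      have "1 \<le> (real n + 1)\<^sup>2 * (1 / (t + 1)\<^sup>2)" if "t \<in> A n"
        using that by (auto simp: A_def intro!: power_mono)
      then show "indicator (A n) t \<le> ennreal ((real n + 1)\<^sup>2 * (1 / (t + 1)\<^sup>2))"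
        by (auto simp: indicator_def simp flip: ennreal_1 intro!: ennreal_leI)
    qed
    also have "\<dots> < \<infinity>"
      using integrable_mult_right[OF kernel_integrable[of 1], of "(real n + 1)\<^sup>2"]
      by (simp add: integrable_iff_bounded)
    finally show ?thesis .
  qed
  show "\<exists>A. countable A \<and> A \<subseteq> sets \<mu> \<and> \<Union>A = space \<mu> \<and> (\<forall>a\<in>A. emeasure \<mu> a \<noteq> \<infinity>)"
  proof (intro exI[of _ "range A"] conjI)
    show "\<Union>(range A) = space \<mu>"
      unfolding space_mu A_def using real_arch_simple by (auto simp: less_imp_le)
  qed (use A fin in \<open>auto simp: less_top\<close>)
qed

lemma integrable_conjugate_poisson:
  assumes "x \<noteq> 0"
  shows "integrable \<mu> (\<lambda>t. x / (t\<^sup>2 + x\<^sup>2))"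
proof (rule Bochner_Integration.integrable_bound)
  show "integrable \<mu> (\<lambda>t. 2 * \<bar>x\<bar> * (1 / (t + \<bar>x\<bar>)\<^sup>2))"
    using assms by (intro integrable_mult_right kernel_integrable) simp
  show "(\<lambda>t. x / (t\<^sup>2 + x\<^sup>2)) \<in> borel_measurable \<mu>"
    by (intro measurable_mu borel_measurable_conjugate_poisson)
  show "AE t in \<mu>. norm (x / (t\<^sup>2 + x\<^sup>2)) \<le> norm (2 * \<bar>x\<bar> * (1 / (t + \<bar>x\<bar>)\<^sup>2))"
    using conjugate_poisson_le by (intro AE_I2) (auto simp: space_mu intro: order_trans)
qed

text \<open>With \<open>s = \<bar>x\<bar>\<close> the numerator of the kernel cancels the
  \<open>1 / s\<close> in \<open>kernel_bound\<close>, so the bound is uniform in \<open>x\<close>.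
  The absolute value inside the integral serves the application of Fubini's theorem.\<close>

lemma conjugate_poisson_bound:
  obtains D where "\<And>x. (LINT t|\<mu>. \<bar>x / (t\<^sup>2 + x\<^sup>2)\<bar>) \<le> D"
proof -
  obtain B where B: "B \<ge> 0" "\<And>s. s > 0 \<Longrightarrow> (LINT t|\<mu>. 1 / (t + s)\<^sup>2) \<le> B * (pi / s)"
    by (rule kernel_bound) blast
  have "(LINT t|\<mu>. \<bar>x / (t\<^sup>2 + x\<^sup>2)\<bar>) \<le> 2 * B * pi" for x
  proof (cases "x = 0")
    case False
    have "(LINT t|\<mu>. \<bar>x / (t\<^sup>2 + x\<^sup>2)\<bar>) \<le> (LINT t|\<mu>. 2 * \<bar>x\<bar> * (1 / (t + \<bar>x\<bar>)\<^sup>2))"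
      using False conjugate_poisson_le
      by (intro integral_mono integrable_abs integrable_conjugate_poisson integrable_mult_right kernel_integrable)
        (auto simp: space_mu)
    also have "\<dots> = 2 * \<bar>x\<bar> * (LINT t|\<mu>. 1 / (t + \<bar>x\<bar>)\<^sup>2)"
      by (rule integral_mult_right_zero)
    also have "\<dots> \<le> 2 * \<bar>x\<bar> * (B * (pi / \<bar>x\<bar>))"
      using False by (intro mult_left_mono B(2)) auto
    finally show ?thesis using False by simp
  qed (use B(1) in simp)
  then show ?thesis by (rule that)
qed

lemma joint_measurable:
  "(\<lambda>(x, t). x / (t\<^sup>2 + x\<^sup>2)) \<in> borel_measurable (lborel \<Otimes>\<^sub>M \<mu>)"
proof -
  have [measurable]: "(\<lambda>t. t) \<in> borel_measurable \<mu>" by (intro measurable_mu) simp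
  have [measurable]: "snd \<in> borel_measurable (lborel \<Otimes>\<^sub>M \<mu>)"
    using measurable_comp[OF measurable_snd[of lborel \<mu>] \<open>(\<lambda>t. t) \<in> borel_measurable \<mu>\<close>] by (simp add: o_def)
  have [measurable]: "fst \<in> borel_measurable (lborel \<Otimes>\<^sub>M \<mu>)"
    using measurable_fst[of lborel \<mu>] by simp
  show ?thesis unfolding case_prod_beta' by measurable
qed

lemma measurable_hankel_symbol: "hankel_symbol \<mu> \<in> borel_measurable borel"
proof -
  interpret sigma_finite_measure \<mu> by (rule sigma_finite_mu)
  have "(\<lambda>x. LINT t|\<mu>. x / (t\<^sup>2 + x\<^sup>2)) \<in> borel_measurable lborel"
    by (intro borel_measurable_lebesgue_integral joint_measurable)
  then show ?thesis unfolding hankel_symbol_def[abs_def] by simp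
qed

lemma hankel_symbol_bound:
  obtains D where "\<And>x. cmod (hankel_symbol \<mu> x) \<le> D"
proof -
  obtain D where D: "\<And>x. (LINT t|\<mu>. \<bar>x / (t\<^sup>2 + x\<^sup>2)\<bar>) \<le> D" by (rule conjugate_poisson_bound) blast
  have "cmod (hankel_symbol \<mu> x) \<le> 1 / pi * D" for x
  proof -
    have "\<bar>LINT t|\<mu>. x / (t\<^sup>2 + x\<^sup>2)\<bar> \<le> D"
      using integral_norm_bound[of \<mu> "\<lambda>t. x / (t\<^sup>2 + x\<^sup>2)"] D[of x] by simp
    then have "1 / pi * \<bar>LINT t|\<mu>. x / (t\<^sup>2 + x\<^sup>2)\<bar> \<le> 1 / pi * D" by (intro mult_left_mono) auto
    then show ?thesis by (simp add: hankel_symbol_def norm_mult norm_divide)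
  qed
  then show ?thesis by (rule that)
qed

lemma hankel_symbol_minus: "hankel_symbol \<mu> (- x) = - hankel_symbol \<mu> x"
  by (simp add: hankel_symbol_def)

lemma Re_hankel_symbol: "Re (hankel_symbol \<mu> x) = 0"
  by (simp add: hankel_symbol_def)

text \<open>The uniform bound on the kernel makes the double integral absolutely convergent. After
  the exchange, the integral over the line is evaluated for each fixed \<open>t\<close> by Cauchy's
  formulas, and only the pole \<open>i t\<close> contributes.\<close>

lemma hankel_symbol_integral:
  assumes F: "L2_boundary F f" and G: "L2_boundary G g"
  shows "(LINT x|lborel. f x * g x * hankel_symbol \<mu> x) =
    - (LINT t|\<mu>. F (\<i> * complex_of_real t) * G (\<i> * complex_of_real t))"
proof -
  interpret mu: sigma_finite_measure \<mu> by (rule sigma_finite_mu)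
  interpret P: pair_sigma_finite lborel \<mu> ..
  define u where "u = (\<lambda>x. f x * g x)"
  have ui: "integrable lborel u"
    unfolding u_def using F G by (intro sqint_mult_integrable L2_boundary_sqint)
  then have um: "u \<in> borel_measurable borel" by (simp add: borel_measurable_integrable[of lborel, simplified])
  define Q where "Q = (\<lambda>x t. u x * complex_of_real (x / (t\<^sup>2 + x\<^sup>2)))"
  have Qm: "case_prod Q \<in> borel_measurable (lborel \<Otimes>\<^sub>M \<mu>)"
  proof -
    have [measurable]: "(\<lambda>p. u (fst p)) \<in> borel_measurable (lborel \<Otimes>\<^sub>M \<mu>)"
      using measurable_compose[OF measurable_fst[of lborel \<mu>], of u borel] um by simp
    have [measurable]: "(\<lambda>p. fst p / ((snd p)\<^sup>2 + (fst p)\<^sup>2)) \<in> borel_measurable (lborel \<Otimes>\<^sub>M \<mu>)"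
      using joint_measurable by (simp add: case_prod_beta')
    show ?thesis unfolding Q_def case_prod_beta' by measurable
  qed
  obtain D where D: "\<And>x. (LINT t|\<mu>. \<bar>x / (t\<^sup>2 + x\<^sup>2)\<bar>) \<le> D" by (rule conjugate_poisson_bound) blast
  have nrm: "(LINT t|\<mu>. norm (case_prod Q (x, t))) = cmod (u x) * (LINT t|\<mu>. \<bar>x / (t\<^sup>2 + x\<^sup>2)\<bar>)" for x
    by (simp only: Q_def prod.case norm_mult norm_of_real integral_mult_right_zero)
  have Qi: "integrable (lborel \<Otimes>\<^sub>M \<mu>) (case_prod Q)"
  proof (rule P.Fubini_integrable[OF Qm])
    show "integrable lborel (\<lambda>x. LINT t|\<mu>. norm (case_prod Q (x, t)))"
    proof (rule Bochner_Integration.integrable_bound)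
      show "integrable lborel (\<lambda>x. cmod (u x) * D)" using ui by simp
      have "(\<lambda>p. norm (case_prod Q p)) \<in> borel_measurable (lborel \<Otimes>\<^sub>M \<mu>)" using Qm by simp
      then show "(\<lambda>x. LINT t|\<mu>. norm (case_prod Q (x, t))) \<in> borel_measurable lborel"
        by (intro mu.borel_measurable_lebesgue_integral) (simp add: case_prod_beta')
      show "AE x in lborel. norm (LINT t|\<mu>. norm (case_prod Q (x, t))) \<le> norm (cmod (u x) * D)"
      proof (rule AE_I2)
        fix x
        have "0 \<le> (LINT t|\<mu>. \<bar>x / (t\<^sup>2 + x\<^sup>2)\<bar>)" by (rule Bochner_Integration.integral_nonneg) simp
        then have "\<bar>LINT t|\<mu>. \<bar>x / (t\<^sup>2 + x\<^sup>2)\<bar>\<bar> \<le> \<bar>D\<bar>" using D[of x] by linarith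
        then show "norm (LINT t|\<mu>. norm (case_prod Q (x, t))) \<le> norm (cmod (u x) * D)"
          unfolding nrm real_norm_def abs_mult by (intro mult_left_mono) auto
      qed
    qed
    show "AE x in lborel. integrable \<mu> (\<lambda>t. case_prod Q (x, t))"
      using AE_lborel_singleton[of 0]
    proof eventually_elim
      fix x :: real assume "x \<noteq> 0"
      then show "integrable \<mu> (\<lambda>t. case_prod Q (x, t))"
        unfolding Q_def prod.case
        by (intro integrable_mult_right integrable_of_real integrable_conjugate_poisson)
    qed
  qed
  have hs: "f x * g x * hankel_symbol \<mu> x = (\<i> / complex_of_real pi) * (LINT t|\<mu>. Q x t)" for x
    unfolding Q_def u_def hankel_symbol_def integral_mult_right_zero integral_complex_of_real by simp
  have inner: "(LINT x|lborel. Q x t) = pi * \<i> * (F (\<i> * complex_of_real t) * G (\<i> * complex_of_real t))" if "t \<in> space \<mu>" for t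
  proof -
    have t: "t > 0" using that by (simp add: space_mu)
    have i: "integrable lborel (\<lambda>x. f x * g x * (1 / (complex_of_real x - w)))" if "Im w \<noteq> 0" for w
    proof (rule Bochner_Integration.integrable_bound)
      show "integrable lborel (\<lambda>x. cmod (u x) * (1 / \<bar>Im w\<bar>))" using ui by simp
      show "(\<lambda>x. f x * g x * (1 / (complex_of_real x - w))) \<in> borel_measurable lborel"
        using um borel_measurable_cauchy_kernel[OF that] by (simp add: u_def)
      show "AE x in lborel. norm (f x * g x * (1 / (complex_of_real x - w))) \<le> norm (cmod (u x) * (1 / \<bar>Im w\<bar>))"
      proof (rule AE_I2)
        fix x
        have "norm (f x * g x * (1 / (complex_of_real x - w))) = cmod (u x) * cmod (1 / (complex_of_real x - w))"
          by (simp only: u_def norm_mult)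
        also have "\<dots> \<le> cmod (u x) * (1 / \<bar>Im w\<bar>)"
          by (rule mult_left_mono[OF cmod_cauchy_kernel_le[OF that] norm_ge_zero])
        finally show "norm (f x * g x * (1 / (complex_of_real x - w))) \<le> norm (cmod (u x) * (1 / \<bar>Im w\<bar>))"
          unfolding real_norm_def by (rule order_trans[OF _ abs_ge_self])
      qed
    qed
    have "(LINT x|lborel. Q x t) = (LINT x|lborel. (1 / 2) * (f x * g x * (1 / (complex_of_real x - \<i> * t)) + f x * g x * (1 / (complex_of_real x - (- \<i> * t)))))"
      unfolding Q_def u_def conjugate_poisson_kernel_split[OF t]
      by (intro Bochner_Integration.integral_cong refl) (simp add: algebra_simps)
    also have "\<dots> = (1 / 2) * ((LINT x|lborel. f x * g x * (1 / (complex_of_real x - \<i> * t))) + (LINT x|lborel. f x * g x * (1 / (complex_of_real x - (- \<i> * t)))))"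
      unfolding integral_mult_right_zero using t
      by (intro arg_cong[where f = "\<lambda>v. 1 / 2 * v"] Bochner_Integration.integral_add i) simp_all
    also have "(LINT x|lborel. f x * g x * (1 / (complex_of_real x - (- \<i> * t)))) = 0"
      using t by (intro L2_boundary_cauchy_outside[OF F G]) simp
    also have "(LINT x|lborel. f x * g x * (1 / (complex_of_real x - \<i> * t))) = 2 * pi * \<i> * (F (\<i> * t) * G (\<i> * t))"
      using t by (intro L2_boundary_cauchy[OF F G]) simp
    finally show ?thesis by simp
  qed
  have "(LINT x|lborel. f x * g x * hankel_symbol \<mu> x) = (\<i> / complex_of_real pi) * (LINT x|lborel. (LINT t|\<mu>. Q x t))"
    unfolding hs by (rule integral_mult_right_zero)
  also have "(LINT x|lborel. (LINT t|\<mu>. Q x t)) = (LINT t|\<mu>. (LINT x|lborel. Q x t))"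
    by (rule P.Fubini_integral[OF Qi, symmetric])
  also have "\<dots> = (LINT t|\<mu>. pi * \<i> * (F (\<i> * complex_of_real t) * G (\<i> * complex_of_real t)))"
    using inner by (intro Bochner_Integration.integral_cong) auto
  also have "\<dots> = pi * \<i> * (LINT t|\<mu>. F (\<i> * complex_of_real t) * G (\<i> * complex_of_real t))"
    by (rule integral_mult_right_zero)
  finally show ?thesis by simp
qed

text \<open>The substitution \<open>x\<close> to \<open>- x\<close> moves the reflection from
  \<open>f\<close> to the other factor, where \<open>cnj (g (- x))\<close> is the boundary function
  of \<open>dagger G\<close>. The integrand is then a product of two boundary functions times the
  symbol at \<open>- x\<close>, and oddness of the symbol compensates the sign in
  \<open>hankel_symbol_integral\<close>.\<close>

lemma hankel_eq:
  assumes d: "\<delta> = (\<lambda>p. hankel_symbol \<mu> p + complex_of_real c)" and FH: "F \<in> H2"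
  shows "hankel \<delta> F = H F"
proof -
  obtain f where f: "L2_boundary F f" by (rule H2_boundary_exists[OF FH])
  obtain hf where hf: "L2_boundary (H F) hf" by (rule H2_boundary_exists[OF H_H2[OF FH]])
  obtain D where D: "\<And>x. cmod (hankel_symbol \<mu> x) \<le> D" by (rule hankel_symbol_bound) blast
  have dm: "\<delta> \<in> borel_measurable borel" unfolding d using measurable_hankel_symbol by simp
  have db: "cmod (\<delta> x) \<le> D + \<bar>c\<bar>" for x
    unfolding d using norm_triangle_ineq[of "hankel_symbol \<mu> x" "complex_of_real c"] D[of x] by simp
  have sp: "sqint (\<lambda>x. \<delta> x * f (- x))"
    using dm db by (intro sqint_bounded_mult[where B = "D + \<bar>c\<bar>"] sqint_reflect L2_boundary_sqint[OF f]) auto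
  have form: "(LINT x|lborel. cnj (g x) * (\<delta> x * f (- x))) = (LINT t|\<mu>. cnj (G (\<i> * complex_of_real t)) * F (\<i> * complex_of_real t))"
    if g: "L2_boundary G g" for G g
  proof -
    define u where "u = (\<lambda>x. cnj (g (- x)) * f x)"
    note dg = dagger_L2_boundary[OF g]
    have ui: "integrable lborel u" unfolding u_def
      by (intro sqint_mult_integrable L2_boundary_sqint[OF f] L2_boundary_sqint[OF dg])
    have uh: "integrable lborel (\<lambda>x. u x * hankel_symbol \<mu> x)"
    proof (rule Bochner_Integration.integrable_bound)
      show "integrable lborel (\<lambda>x. cmod (u x) * D)" using ui by simp
      show "(\<lambda>x. u x * hankel_symbol \<mu> x) \<in> borel_measurable lborel"
        using borel_measurable_integrable[OF ui] measurable_hankel_symbol by simp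
      show "AE x in lborel. norm (u x * hankel_symbol \<mu> x) \<le> norm (cmod (u x) * D)"
        using mult_left_mono[OF order_trans[OF D abs_ge_self]] by (auto simp: norm_mult abs_mult intro!: AE_I2)
    qed
    have "(LINT x|lborel. cnj (g x) * (\<delta> x * f (- x))) = (LINT x|lborel. cnj (g (- x)) * (\<delta> (- x) * f x))"
      by (subst lborel_integral_real_affine[where c = "-1" and t = 0]) auto
    also have "\<dots> = (LINT x|lborel. complex_of_real c * u x - u x * hankel_symbol \<mu> x)"
      by (intro Bochner_Integration.integral_cong refl) (simp add: u_def d hankel_symbol_minus algebra_simps)
    also have "\<dots> = complex_of_real c * (LINT x|lborel. u x) - (LINT x|lborel. u x * hankel_symbol \<mu> x)"
      using ui uh by simp
    also have "(LINT x|lborel. u x) = 0"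
      unfolding u_def by (rule L2_boundary_mult_integral[OF dg f])
    also have "(LINT x|lborel. u x * hankel_symbol \<mu> x) = - (LINT t|\<mu>. dagger G (\<i> * complex_of_real t) * F (\<i> * complex_of_real t))"
      unfolding u_def by (rule hankel_symbol_integral[OF dg f])
    \<comment> \<open>The map \<open>- cnj z\<close> fixes the imaginary axis, so
      \<open>dagger G\<close> is there just the conjugate of \<open>G\<close>.\<close>
    finally show ?thesis by (simp add: dagger_def)
  qed
  show ?thesis
    unfolding hankel_def
  proof (rule P_plus_eqI[OF H_H2[OF FH] sp])
    show "AE x in lborel. \<delta> x * reflect (nt_boundary F) x = \<delta> x * f (- x)"
      using AE_lborel_reflect[OF L2_boundary_nt_boundary[OF f]]
      by eventually_elim (simp add: reflect_def)
    then have ae: "AE x in lborel. \<delta> x * reflect (nt_boundary F) x - nt_boundary (H F) x = \<delta> x * f (- x) - hf x"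
      using L2_boundary_nt_boundary[OF hf] by eventually_elim simp
    fix G assume GH: "G \<in> H2"
    obtain g where g: "L2_boundary G g" by (rule H2_boundary_exists[OF GH])
    note sg = sqint_cnj[OF L2_boundary_sqint[OF g]]
    have "L2_inner (nt_boundary G) (\<lambda>x. \<delta> x * reflect (nt_boundary F) x - nt_boundary (H F) x)
      = (LINT x|lborel. cnj (g x) * (\<delta> x * f (- x) - hf x))"
      by (intro L2_inner_cong_AE ae L2_boundary_nt_boundary[OF g] sqint_measurable[OF L2_boundary_sqint[OF g]]
          sqint_measurable[OF sqint_diff[OF sp L2_boundary_sqint[OF hf]]])
    also have "\<dots> = (LINT x|lborel. cnj (g x) * (\<delta> x * f (- x))) - (LINT x|lborel. cnj (g x) * hf x)"
      unfolding right_diff_distrib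
      by (intro Bochner_Integration.integral_diff sqint_mult_integrable sg sp L2_boundary_sqint[OF hf])
    also have "\<dots> = 0"
      unfolding form[OF g] H2_inner_eq[OF g hf, symmetric] inner_mu(2)[OF GH FH] by simp
    finally show "L2_inner (nt_boundary G) (\<lambda>x. \<delta> x * reflect (nt_boundary F) x - nt_boundary (H F) x) = 0" .
  qed
qed

end

text \<open>Dominated convergence on a neighbourhood in which \<open>\<bar>p\<bar>\<close> is
  bounded and bounded away from \<open>0\<close>. At \<open>0\<close> there can be a jump: Lebesgue
  measure on the half line gives the symbol \<open>(i / 2) * sgn p\<close>.\<close>

lemma (in carleson) continuous_hankel_symbol:
  assumes "x \<noteq> 0"
  shows "isCont (hankel_symbol \<mu>) x"
proof -
  define m where "m = \<bar>x\<bar> / 2"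
  define M where "M = 2 * \<bar>x\<bar>"
  define S where "S = {p::real. m < \<bar>p\<bar> \<and> \<bar>p\<bar> < M}"
  have m: "m > 0" "M > 0" using assms by (auto simp: m_def M_def)
  have S: "open S" "x \<in> S"
    using assms by (auto simp: S_def m_def M_def intro!: open_Collect_conj open_Collect_less continuous_intros)
  have "continuous_on S (\<lambda>p. LINT t|\<mu>. p / (t\<^sup>2 + p\<^sup>2))"
    unfolding continuous_on_sequentially
  proof (intro allI ballI impI, elim conjE)
    fix p q assume q: "q \<in> S" and p: "\<forall>n::nat. p n \<in> S" "p \<longlonglongrightarrow> q"
    show "((\<lambda>p. LINT t|\<mu>. p / (t\<^sup>2 + p\<^sup>2)) \<circ> p) \<longlonglongrightarrow> (LINT t|\<mu>. q / (t\<^sup>2 + q\<^sup>2))"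
      unfolding o_def
    proof (rule integral_dominated_convergence)
      show "(\<lambda>t. q / (t\<^sup>2 + q\<^sup>2)) \<in> borel_measurable \<mu>" "(\<lambda>t. p n / (t\<^sup>2 + (p n)\<^sup>2)) \<in> borel_measurable \<mu>" for n
        by (intro measurable_mu borel_measurable_conjugate_poisson)+
      show "integrable \<mu> (\<lambda>t. 2 * M * (1 / (t + m)\<^sup>2))"
        using m by (intro integrable_mult_right kernel_integrable)
      have "q \<noteq> 0" using q m by (auto simp: S_def)
      then have nz: "t\<^sup>2 + q\<^sup>2 \<noteq> 0" for t by (simp add: add_nonneg_eq_0_iff)
      show "AE t in \<mu>. (\<lambda>n. p n / (t\<^sup>2 + (p n)\<^sup>2)) \<longlonglongrightarrow> q / (t\<^sup>2 + q\<^sup>2)"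
        by (intro AE_I2 tendsto_intros p(2) nz)
      show "AE t in \<mu>. norm (p n / (t\<^sup>2 + (p n)\<^sup>2)) \<le> 2 * M * (1 / (t + m)\<^sup>2)" for n
      proof (rule AE_I2)
        fix t assume "t \<in> space \<mu>"
        then have t: "t > 0" by (simp add: space_mu)
        have pn: "m < \<bar>p n\<bar>" "\<bar>p n\<bar> < M" using p(1) by (auto simp: S_def)
        have "norm (p n / (t\<^sup>2 + (p n)\<^sup>2)) \<le> 2 * \<bar>p n\<bar> * (1 / (t + \<bar>p n\<bar>)\<^sup>2)"
          using conjugate_poisson_le[OF t, of "p n"] by simp
        also have "\<dots> \<le> 2 * M * (1 / (t + m)\<^sup>2)"
          using pn m t by (intro mult_mono divide_left_mono power_mono mult_pos_pos) auto
        finally show "norm (p n / (t\<^sup>2 + (p n)\<^sup>2)) \<le> 2 * M * (1 / (t + m)\<^sup>2)" .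
      qed
    qed
  qed
  then have "continuous_on S (hankel_symbol \<mu>)"
    unfolding hankel_symbol_def[abs_def] by (intro continuous_intros)
  then show ?thesis using S by (simp add: continuous_on_eq_continuous_at)
qed

section \<open>Outer functions with bounded logarithm\<close>

text \<open>The kernel in the definition of an outer function: the second summand makes it integrable and
  does not affect the imaginary part.\<close>

definition herglotz_kernel :: "real \<Rightarrow> complex \<Rightarrow> complex" where
  "herglotz_kernel p z = 1 / (complex_of_real p - z) - complex_of_real (p / (1 + p\<^sup>2))"

text \<open>\<open>\<kappa>\<close> stands for \<open>ln k\<close> in the definition of an outer
  function. Its boundedness makes the exponent converge and keeps the function and its reciprocal
  bounded.\<close>

locale bounded_log =
  fixes \<kappa> :: "real \<Rightarrow> real" and L :: real
  assumes km [measurable]: "\<kappa> \<in> borel_measurable borel" and kL: "\<And>p. \<bar>\<kappa> p\<bar> \<le> L"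
begin

definition J :: "complex \<Rightarrow> complex" where
  "J z = (LINT p|lborel. herglotz_kernel p z * complex_of_real (\<kappa> p))"

text \<open>Over a common denominator the kernel is \<open>(1 + p z) / ((p - z) (1 + p^2))\<close>.
  Writing \<open>1 + p z = z (p - z) + (1 + z^2)\<close> exhibits the decay
  \<open>1 / (1 + p^2)\<close> with a factor bounded in \<open>p\<close>.\<close>

lemma herglotz_kernel_le:
  assumes "Im z > 0"
  shows "cmod (herglotz_kernel p z) \<le> (cmod z + cmod (1 + z\<^sup>2) * (1 / \<bar>Im z\<bar>)) * (1 / (1 + p\<^sup>2))"
proof -
  have nz: "complex_of_real p - z \<noteq> 0" using assms by (auto simp: complex_eq_iff)
  have nz2: "complex_of_real (1 + p\<^sup>2) \<noteq> 0" using one_plus_square_pos[of p] by (simp only: of_real_eq_0_iff)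
  have "herglotz_kernel p z = (z + (1 + z\<^sup>2) * (1 / (complex_of_real p - z))) * complex_of_real (1 / (1 + p\<^sup>2))"
    unfolding herglotz_kernel_def of_real_divide using nz nz2
    by (simp add: divide_simps) (simp add: power2_eq_square algebra_simps)
  also have "cmod \<dots> = cmod (z + (1 + z\<^sup>2) * (1 / (complex_of_real p - z))) * (1 / (1 + p\<^sup>2))"
    unfolding norm_mult[of _ "complex_of_real _"] norm_of_real using one_plus_square_pos[of p] by simp
  also have "\<dots> \<le> (cmod z + cmod (1 + z\<^sup>2) * (1 / \<bar>Im z\<bar>)) * (1 / (1 + p\<^sup>2))"
  proof (rule mult_right_mono)
    have "cmod ((1 + z\<^sup>2) * (1 / (complex_of_real p - z))) \<le> cmod (1 + z\<^sup>2) * (1 / \<bar>Im z\<bar>)"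
      unfolding norm_mult using assms by (intro mult_left_mono cmod_cauchy_kernel_le) auto
    then show "cmod (z + (1 + z\<^sup>2) * (1 / (complex_of_real p - z))) \<le> cmod z + cmod (1 + z\<^sup>2) * (1 / \<bar>Im z\<bar>)"
      by (rule order_trans[OF norm_triangle_ineq add_left_mono])
  qed (use one_plus_square_pos[of p] in simp)
  finally show ?thesis .
qed

lemma J_measurable:
  assumes "Im z > 0"
  shows "(\<lambda>p. herglotz_kernel p z * complex_of_real (\<kappa> p)) \<in> borel_measurable borel"
proof -
  have "(\<lambda>p. 1 / (complex_of_real p - z)) \<in> borel_measurable borel"
    using assms by (intro borel_measurable_cauchy_kernel) simp
  then show ?thesis unfolding herglotz_kernel_def by simp
qed

lemma J_integrable:
  assumes "Im z > 0"
  shows "integrable lborel (\<lambda>p. herglotz_kernel p z * complex_of_real (\<kappa> p))"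
proof (rule Bochner_Integration.integrable_bound)
  define A where "A = cmod z + cmod (1 + z\<^sup>2) * (1 / \<bar>Im z\<bar>)"
  show "integrable lborel (\<lambda>p. A * L * (1 / (1 + p\<^sup>2)))"
    using has_bochner_integral_arctan_deriv by (intro integrable_mult_right) (simp add: has_bochner_integral_iff)
  show "(\<lambda>p. herglotz_kernel p z * complex_of_real (\<kappa> p)) \<in> borel_measurable lborel"
    using J_measurable[OF assms] by simp
  show "AE p in lborel. norm (herglotz_kernel p z * complex_of_real (\<kappa> p)) \<le> norm (A * L * (1 / (1 + p\<^sup>2)))"
  proof (rule AE_I2)
    fix p
    have "norm (herglotz_kernel p z * complex_of_real (\<kappa> p)) \<le> (A * (1 / (1 + p\<^sup>2))) * L"
      unfolding norm_mult norm_of_real A_def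
      by (intro mult_mono herglotz_kernel_le assms kL) auto
    also have "\<dots> = A * L * (1 / (1 + p\<^sup>2))" by (simp only: mult.assoc mult.commute[of L])
    also have "\<dots> \<le> norm (A * L * (1 / (1 + p\<^sup>2)))" unfolding real_norm_def by (rule abs_ge_self)
    finally show "norm (herglotz_kernel p z * complex_of_real (\<kappa> p)) \<le> norm (A * L * (1 / (1 + p\<^sup>2)))" .
  qed
qed

text \<open>In a difference quotient the subtracted term \<open>p / (1 + p^2)\<close> cancels, and a
  product of two Cauchy kernels remains, to which dominated convergence applies.\<close>

lemma J_derivative:
  assumes z: "Im z > 0"
  shows "(J has_field_derivative (LINT p|lborel. (1 / (complex_of_real p - z))\<^sup>2 * complex_of_real (\<kappa> p))) (at z)"
proof -
  \<comment> \<open>For \<open>w\<close> in this ball \<open>cmod (w - z)\<close> is below half of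
    \<open>cmod (p - z)\<close> for every real \<open>p\<close>, which gives the factor
    \<open>2\<close> between the kernels at \<open>w\<close> and \<open>z\<close> and hence a
    majorant independent of \<open>w\<close>.\<close>
  define S where "S = ball z (Im z / 2)"
  have zS: "z \<in> S" "open S" using z by (auto simp: S_def)
  have sq: "integrable lborel (\<lambda>p. (cmod (1 / (complex_of_real p - z)))\<^sup>2)"
    using z by (intro sqint_integrable sqint_cauchy_kernel) simp
  have km': "(\<lambda>p. 1 / (complex_of_real p - w)) \<in> borel_measurable borel" if "Im w > 0" for w
    using that by (intro borel_measurable_cauchy_kernel) simp
  have Sw: "Im w > 0" "cmod (complex_of_real p - z) \<le> 2 * cmod (complex_of_real p - w)" if "w \<in> S" for w p
  proof -
    have d: "cmod (w - z) < Im z / 2" using that by (simp add: S_def dist_norm norm_minus_commute)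
    then show "Im w > 0" using abs_Im_le_cmod[of "w - z"] z by auto
    have "Im z \<le> cmod (complex_of_real p - z)" using abs_Im_le_cmod[of "complex_of_real p - z"] z by simp
    moreover have "cmod (complex_of_real p - z) \<le> cmod (complex_of_real p - w) + cmod (w - z)"
      using norm_triangle_ineq[of "complex_of_real p - w" "w - z"] by simp
    ultimately show "cmod (complex_of_real p - z) \<le> 2 * cmod (complex_of_real p - w)" using d by linarith
  qed
  have quot: "(J w - J z) / (w - z) = (LINT p|lborel. (1 / (complex_of_real p - w)) * (1 / (complex_of_real p - z)) * complex_of_real (\<kappa> p))"
    if w: "w \<in> S - {z}" for w
  proof -
    have "J w - J z = (LINT p|lborel. herglotz_kernel p w * complex_of_real (\<kappa> p) - herglotz_kernel p z * complex_of_real (\<kappa> p))"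
      unfolding J_def using Sw(1)[of w] w z by (intro Bochner_Integration.integral_diff[symmetric] J_integrable) auto
    also have "\<dots> = (LINT p|lborel. (w - z) * ((1 / (complex_of_real p - w)) * (1 / (complex_of_real p - z)) * complex_of_real (\<kappa> p)))"
    proof (rule Bochner_Integration.integral_cong[OF refl])
      fix p
      have "complex_of_real p - w \<noteq> 0" "complex_of_real p - z \<noteq> 0" using Sw(1)[of w] w z by (auto simp: complex_eq_iff)
      then have "1 / (complex_of_real p - w) - 1 / (complex_of_real p - z) = (w - z) * ((1 / (complex_of_real p - w)) * (1 / (complex_of_real p - z)))"
        by (simp add: field_simps)
      then show "herglotz_kernel p w * complex_of_real (\<kappa> p) - herglotz_kernel p z * complex_of_real (\<kappa> p) =
        (w - z) * ((1 / (complex_of_real p - w)) * (1 / (complex_of_real p - z)) * complex_of_real (\<kappa> p))"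
        by (simp add: herglotz_kernel_def left_diff_distrib[symmetric] mult.assoc)
    qed
    also have "\<dots> = (w - z) * (LINT p|lborel. (1 / (complex_of_real p - w)) * (1 / (complex_of_real p - z)) * complex_of_real (\<kappa> p))"
      by (rule integral_mult_right_zero)
    finally show ?thesis using w by simp
  qed
  have "((\<lambda>w. (J w - J z) / (w - z)) \<longlongrightarrow> (LINT p|lborel. (1 / (complex_of_real p - z))\<^sup>2 * complex_of_real (\<kappa> p))) (at z within S)"
    unfolding tendsto_at_iff_sequentially
  proof (intro allI impI)
    fix w assume w: "\<forall>n. w n \<in> S - {z}" "w \<longlonglongrightarrow> z"
    have "(\<lambda>n. LINT p|lborel. (1 / (complex_of_real p - w n)) * (1 / (complex_of_real p - z)) * complex_of_real (\<kappa> p)) \<longlonglongrightarrow>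
      (LINT p|lborel. (1 / (complex_of_real p - z))\<^sup>2 * complex_of_real (\<kappa> p))"
    proof (rule integral_dominated_convergence)
      show "(\<lambda>p. (1 / (complex_of_real p - z))\<^sup>2 * complex_of_real (\<kappa> p)) \<in> borel_measurable lborel"
        using km'[OF z] by simp
      show "(\<lambda>p. (1 / (complex_of_real p - w n)) * (1 / (complex_of_real p - z)) * complex_of_real (\<kappa> p)) \<in> borel_measurable lborel" for n
        using km'[OF z] km'[OF Sw(1), of "w n"] w(1) by simp
      show "integrable lborel (\<lambda>p. 2 * L * (cmod (1 / (complex_of_real p - z)))\<^sup>2)"
        by (intro integrable_mult_right sq)
      show "AE p in lborel. (\<lambda>n. (1 / (complex_of_real p - w n)) * (1 / (complex_of_real p - z)) * complex_of_real (\<kappa> p)) \<longlonglongrightarrow> (1 / (complex_of_real p - z))\<^sup>2 * complex_of_real (\<kappa> p)"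
        unfolding power2_eq_square using z
        by (intro AE_I2 tendsto_intros w(2)) (auto simp: complex_eq_iff)
      show "AE p in lborel. norm ((1 / (complex_of_real p - w n)) * (1 / (complex_of_real p - z)) * complex_of_real (\<kappa> p)) \<le> 2 * L * (cmod (1 / (complex_of_real p - z)))\<^sup>2" for n
      proof (rule AE_I2)
        fix p
        have wn: "w n \<in> S" using w(1) by simp
        have nz: "complex_of_real p - w n \<noteq> 0" "complex_of_real p - z \<noteq> 0" using Sw(1)[OF wn] z by (auto simp: complex_eq_iff)
        have "cmod (1 / (complex_of_real p - w n)) \<le> 2 * cmod (1 / (complex_of_real p - z))"
          using Sw(2)[OF wn, of p] nz by (simp add: norm_divide field_simps)
        then have "cmod (1 / (complex_of_real p - w n)) * cmod (1 / (complex_of_real p - z)) * \<bar>\<kappa> p\<bar>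
          \<le> (2 * cmod (1 / (complex_of_real p - z))) * cmod (1 / (complex_of_real p - z)) * L"
          by (intro mult_mono kL) auto
        also have "\<dots> = 2 * L * (cmod (1 / (complex_of_real p - z)))\<^sup>2"
          by (simp only: power2_eq_square ac_simps)
        finally show "norm ((1 / (complex_of_real p - w n)) * (1 / (complex_of_real p - z)) * complex_of_real (\<kappa> p)) \<le> 2 * L * (cmod (1 / (complex_of_real p - z)))\<^sup>2"
          by (simp only: norm_mult norm_of_real)
      qed
    qed
    then show "((\<lambda>w. (J w - J z) / (w - z)) \<circ> w) \<longlonglongrightarrow> (LINT p|lborel. (1 / (complex_of_real p - z))\<^sup>2 * complex_of_real (\<kappa> p))"
      using w(1) by (simp only: o_def quot)
  qed
  then have "(J has_field_derivative (LINT p|lborel. (1 / (complex_of_real p - z))\<^sup>2 * complex_of_real (\<kappa> p))) (at z within S)"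
    by (simp add: has_field_derivative_iff)
  then show ?thesis using at_within_open[OF zS] by simp
qed

lemma J_holomorphic: "J holomorphic_on upper_half_plane"
  unfolding holomorphic_on_def field_differentiable_def
  using J_derivative by (auto simp: upper_half_plane_def intro: has_field_derivative_at_within)

lemma Im_J:
  assumes y: "y > 0"
  shows "Im (J (Complex x y)) = (LINT s|lborel. \<kappa> (x + y * s) / (1 + s\<^sup>2))"
proof -
  have "Im (herglotz_kernel p (Complex x y) * complex_of_real (\<kappa> p)) = y * \<kappa> p / ((p - x)\<^sup>2 + y\<^sup>2)" for p
    by (simp add: herglotz_kernel_def Im_divide cmod_power2)
  then have "Im (J (Complex x y)) = (LINT p|lborel. y * \<kappa> p / ((p - x)\<^sup>2 + y\<^sup>2))"
    unfolding J_def using J_integrable[of "Complex x y"] y by (subst integral_Im[symmetric]) auto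
  also have "\<dots> = \<bar>y\<bar> *\<^sub>R (LINT s|lborel. y * \<kappa> (x + y * s) / ((x + y * s - x)\<^sup>2 + y\<^sup>2))"
    using y by (intro lborel_integral_real_affine) simp
  also have "\<dots> = (LINT s|lborel. \<bar>y\<bar> * (y * \<kappa> (x + y * s) / ((x + y * s - x)\<^sup>2 + y\<^sup>2)))"
    by (simp only: integral_mult_right_zero real_scaleR_def)
  also have "\<dots> = (LINT s|lborel. \<kappa> (x + y * s) / (1 + s\<^sup>2))"
  proof (rule Bochner_Integration.integral_cong[OF refl])
    fix s
    have "(x + y * s - x)\<^sup>2 + y\<^sup>2 = y\<^sup>2 * (1 + s\<^sup>2)"
      by (simp add: power_mult_distrib algebra_simps)
    then show "\<bar>y\<bar> * (y * \<kappa> (x + y * s) / ((x + y * s - x)\<^sup>2 + y\<^sup>2)) = \<kappa> (x + y * s) / (1 + s\<^sup>2)"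
      using y by (simp add: power2_eq_square)
  qed
  finally show ?thesis .
qed

lemma
  assumes y: "y \<noteq> 0"
  shows poisson_integrable: "integrable lborel (\<lambda>s. \<kappa> (x + y * s) / (1 + s\<^sup>2))"
    and poisson_integral_bound: "\<bar>LINT s|lborel. \<kappa> (x + y * s) / (1 + s\<^sup>2)\<bar> \<le> L * pi"
proof -
  have a: "integrable lborel (\<lambda>s::real. L * (1 / (1 + s\<^sup>2)))" "(LINT s|lborel. L * (1 / (1 + s\<^sup>2))) = L * pi"
    using has_bochner_integral_mult_right[OF has_bochner_integral_arctan_deriv, of L] by (auto simp: has_bochner_integral_iff)
  have le: "norm (\<kappa> (x + y * s) / (1 + s\<^sup>2)) \<le> L * (1 / (1 + s\<^sup>2))" for s
    using divide_right_mono[OF kL[of "x + y * s"], of "1 + s\<^sup>2"] one_plus_square_pos[of s] by (simp add: abs_divide)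
  show i: "integrable lborel (\<lambda>s. \<kappa> (x + y * s) / (1 + s\<^sup>2))"
  proof (rule Bochner_Integration.integrable_bound[OF a(1)])
    show "(\<lambda>s. \<kappa> (x + y * s) / (1 + s\<^sup>2)) \<in> borel_measurable lborel" by measurable
    show "AE s in lborel. norm (\<kappa> (x + y * s) / (1 + s\<^sup>2)) \<le> norm (L * (1 / (1 + s\<^sup>2)))"
      using le by (intro AE_I2) (metis abs_ge_self order_trans real_norm_def)
  qed
  have "norm (LINT s|lborel. \<kappa> (x + y * s) / (1 + s\<^sup>2)) \<le> (LINT s|lborel. norm (\<kappa> (x + y * s) / (1 + s\<^sup>2)))"
    by (rule integral_norm_bound)
  also have "\<dots> \<le> (LINT s|lborel. L * (1 / (1 + s\<^sup>2)))"
    by (intro integral_mono integrable_norm i a(1) le)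
  finally show "\<bar>LINT s|lborel. \<kappa> (x + y * s) / (1 + s\<^sup>2)\<bar> \<le> L * pi" using a(2) by simp
qed

section \<open>The outer function and the modulus of its boundary values\<close>

definition E :: "complex \<Rightarrow> complex" where
  "E z = (if z \<in> upper_half_plane then exp (1 / (complex_of_real pi * \<i>) * J z) else 0)"

lemma cmod_E:
  assumes "Im z > 0"
  shows "cmod (E z) = exp (Im (J z) / pi)"
proof -
  have "Re (1 / (complex_of_real pi * \<i>) * J z) = Im (J z) / pi"
    by (simp add: Re_divide power2_eq_square)
  then show ?thesis using assms by (simp add: E_def upper_half_plane_def)
qed

lemma Im_J_bound:
  assumes "Im z > 0"
  shows "\<bar>Im (J z) / pi\<bar> \<le> L"
proof -
  have "\<bar>Im (J z)\<bar> \<le> L * pi"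
    using Im_J[OF assms, of "Re z"] poisson_integral_bound[of "Im z" "Re z"] assms by simp
  then show ?thesis by (simp add: abs_divide divide_le_eq)
qed

lemma E_holomorphic: "E holomorphic_on upper_half_plane"
proof -
  have "(\<lambda>z. exp (1 / (complex_of_real pi * \<i>) * J z)) holomorphic_on upper_half_plane"
    by (intro holomorphic_intros J_holomorphic)
  then show ?thesis by (rule holomorphic_transform) (simp add: E_def)
qed

text \<open>The reciprocal has the negated exponent. The real part of the exponent is a Poisson mean
  of \<open>\<kappa>\<close>, hence between \<open>- L\<close> and \<open>L\<close>, so both
  functions are bounded by \<open>exp L\<close>.\<close>

lemma E_unit: "E \<in> Hinf_units"
proof -
  define q where "q = (\<lambda>z. if z \<in> upper_half_plane then exp (- (1 / (complex_of_real pi * \<i>) * J z)) else 0)"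
  have qE: "E z * q z = 1" if "z \<in> upper_half_plane" for z
    using that by (simp add: E_def q_def flip: exp_add)
  have "(\<lambda>z. exp (- (1 / (complex_of_real pi * \<i>) * J z))) holomorphic_on upper_half_plane"
    by (intro holomorphic_intros J_holomorphic)
  then have qh: "q holomorphic_on upper_half_plane" by (rule holomorphic_transform) (simp add: q_def)
  have Eb: "cmod (E z) \<le> exp L" and qb: "cmod (q z) \<le> exp L" if "z \<in> upper_half_plane" for z
  proof -
    have z: "Im z > 0" using that by (simp add: upper_half_plane_def)
    note b = Im_J_bound[OF z]
    show "cmod (E z) \<le> exp L" unfolding cmod_E[OF z] exp_le_cancel_iff using b by linarith
    have "cmod (E z) * cmod (q z) = 1" using qE[OF that] by (simp flip: norm_mult)
    then have "cmod (q z) = exp (- (Im (J z) / pi))"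
      unfolding cmod_E[OF z] by (simp add: exp_minus field_simps)
    moreover have "- (Im (J z) / pi) \<le> L" using b by linarith
    ultimately show "cmod (q z) \<le> exp L" by (simp only: exp_le_cancel_iff)
  qed
  have "E \<in> Hinf" using E_holomorphic Eb by (auto simp: Hinf_def holo_upper_def E_def)
  moreover have "q \<in> Hinf" using qh qb by (auto simp: Hinf_def holo_upper_def q_def)
  ultimately show ?thesis using qE by (auto simp: Hinf_units_def)
qed

lemma E_outer: "outer_function E"
  unfolding outer_function_def
proof (intro conjI exI[of _ 1] exI[of _ "\<lambda>p. exp (\<kappa> p)"] allI ballI)
  have km': "(\<lambda>p. exp (\<kappa> p)) \<in> borel_measurable lborel" by measurable
  show "(\<lambda>p. exp (\<kappa> p)) \<in> borel_measurable lebesgue" using km' by (rule measurable_completion)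
  have "integrable lborel (\<lambda>p. \<bar>\<kappa> p\<bar> / (1 + p\<^sup>2))"
    using integrable_norm[OF poisson_integrable[of 1 0]] by (simp add: abs_divide)
  then have "integrable lebesgue (\<lambda>p. \<bar>\<kappa> p\<bar> / (1 + p\<^sup>2))"
    by (subst integrable_completion) auto
  then show "integrable lebesgue (\<lambda>p. \<bar>ln (exp (\<kappa> p))\<bar> / (1 + p\<^sup>2))" by simp
  fix z assume z: "z \<in> upper_half_plane"
  then have "(\<lambda>p. herglotz_kernel p z * complex_of_real (\<kappa> p)) \<in> borel_measurable lborel"
    using J_measurable[of z] by (simp add: upper_half_plane_def)
  then have "J z = (LINT p|lebesgue. herglotz_kernel p z * complex_of_real (\<kappa> p))"
    unfolding J_def by (rule integral_completion[symmetric])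
  then show "E z = 1 * exp (1 / (complex_of_real pi * \<i>) * (LINT p|lebesgue.
      (1 / (complex_of_real p - z) - complex_of_real (p / (1 + p\<^sup>2))) * complex_of_real (ln (exp (\<kappa> p)))))"
    using z by (simp add: E_def herglotz_kernel_def)
qed (auto simp: E_holomorphic)

text \<open>Multiplication by \<open>1 / (z + \<i>)\<close> reduces the existence of boundary values to \<open>H\<^sup>2\<close>.\<close>

lemma E_nt_limit_exists: "AE x in lborel. \<exists>l. nt_limit E x l"
proof -
  define a where "a = - \<i>"
  have a: "Im a < 0" by (simp add: a_def)
  let ?K = "cauchy_kernel a"
  define F where "F = (\<lambda>z. E z * ?K z)"
  have hK: "?K \<in> H2" by (rule cauchy_kernel_H2[OF a])
  obtain M where M: "\<And>y. y > 0 \<Longrightarrow> sqint (\<lambda>x. ?K (Complex x y))" "\<And>y. y > 0 \<Longrightarrow> nsq (\<lambda>x. ?K (Complex x y)) \<le> M"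
    by (rule H2_E[OF hK]) blast
  have "F holomorphic_on upper_half_plane"
    unfolding F_def by (intro holomorphic_intros E_holomorphic H2_holomorphic[OF hK])
  then have Fu: "F \<in> holo_upper" by (simp add: holo_upper_def F_def E_def)
  have Eb: "cmod (E (Complex x y)) \<le> exp L" if "y > 0" for x y
  proof -
    have z: "Im (Complex x y) > 0" using that by simp
    show ?thesis unfolding cmod_E[OF z] exp_le_cancel_iff using Im_J_bound[OF z] by linarith
  qed
  have "sqint (\<lambda>x. F (Complex x y)) \<and> nsq (\<lambda>x. F (Complex x y)) \<le> (exp L)\<^sup>2 * M" if y: "y > 0" for y
  proof
    show s: "sqint (\<lambda>x. F (Complex x y))"
      unfolding F_def using borel_measurable_slice[OF E_holomorphic y] Eb[OF y]
      by (intro sqint_bounded_mult[where B = "exp L"] M(1) y) auto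
    have "nsq (\<lambda>x. F (Complex x y)) \<le> (LINT x|lborel. (exp L)\<^sup>2 * (cmod (?K (Complex x y)))\<^sup>2)"
      unfolding nsq_def
    proof (rule integral_mono)
      show "integrable lborel (\<lambda>x. (cmod (F (Complex x y)))\<^sup>2)" using s by (rule sqint_integrable)
      show "integrable lborel (\<lambda>x. (exp L)\<^sup>2 * (cmod (?K (Complex x y)))\<^sup>2)"
        by (intro integrable_mult_right sqint_integrable M(1) y)
      show "(cmod (F (Complex x y)))\<^sup>2 \<le> (exp L)\<^sup>2 * (cmod (?K (Complex x y)))\<^sup>2" for x
        unfolding F_def norm_mult power_mult_distrib by (intro mult_right_mono power_mono Eb y) auto
    qed
    also have "\<dots> = (exp L)\<^sup>2 * nsq (\<lambda>x. ?K (Complex x y))" unfolding nsq_def by (rule integral_mult_right_zero)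
    also have "\<dots> \<le> (exp L)\<^sup>2 * M" by (intro mult_left_mono M(2) y) simp
    finally show "nsq (\<lambda>x. F (Complex x y)) \<le> (exp L)\<^sup>2 * M" .
  qed
  then have "F \<in> H2" using Fu by (subst H2_lborel_iff) auto
  then obtain f where f: "L2_boundary F f" by (rule H2_boundary_exists)
  show ?thesis
    using L2_boundary_nt_limit[OF f]
  proof eventually_elim
    fix x assume n: "nt_limit F x (f x)"
    have "nt_limit E x (f x * (complex_of_real x - a))"
      unfolding nt_limit_def
    proof (intro allI impI)
      fix b :: real assume "b > 0"
      then have "(F \<longlongrightarrow> f x) (at (complex_of_real x) within stolz_angle b x)"
        using n by (simp add: nt_limit_def)
      then have "((\<lambda>z. F z * (z - a)) \<longlongrightarrow> f x * (complex_of_real x - a)) (at (complex_of_real x) within stolz_angle b x)"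
        by (intro tendsto_intros)
      moreover have "F z * (z - a) = E z" if "z \<in> stolz_angle b x" for z
      proof -
        have "z \<in> upper_half_plane" "z - a \<noteq> 0"
          using that a by (auto simp: stolz_angle_def upper_half_plane_def)
        then show ?thesis by (simp add: F_def cauchy_kernel_def)
      qed
      then have "\<forall>\<^sub>F z in at (complex_of_real x) within stolz_angle b x. F z * (z - a) = E z"
        by (auto simp: eventually_at_filter)
      ultimately show "(E \<longlongrightarrow> f x * (complex_of_real x - a)) (at (complex_of_real x) within stolz_angle b x)"
        by (rule Lim_transform_eventually)
    qed
    then show "\<exists>l. nt_limit E x l" by blast
  qed
qed

text \<open>As the limit is assumed to exist, its modulus can be computed along the vertical. There
  \<open>cmod (E z)\<close> is the exponential of a Poisson mean of \<open>\<kappa>\<close>, and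
  such means converge at a point of continuity.\<close>

lemma cmod_nt_limit_E:
  assumes l: "nt_limit E x l" and cont: "isCont \<kappa> x"
  shows "cmod l = exp (\<kappa> x)"
proof -
  define y where "y = (\<lambda>n::nat. inverse (real (Suc n)))"
  have y: "y n > 0" for n by (simp add: y_def)
  have ylim: "y \<longlonglongrightarrow> 0" unfolding y_def by (rule LIMSEQ_inverse_real_of_nat)
  have "(\<lambda>n. cmod (E (Complex x (y n)))) \<longlonglongrightarrow> cmod l"
    unfolding y_def by (intro tendsto_norm nt_limit_sequence l)
  moreover have "(\<lambda>n. LINT s|lborel. \<kappa> (x + y n * s) / (1 + s\<^sup>2)) \<longlonglongrightarrow> (LINT s|lborel. \<kappa> x / (1 + s\<^sup>2))"
  proof (rule integral_dominated_convergence)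
    show "(\<lambda>s. \<kappa> x / (1 + s\<^sup>2)) \<in> borel_measurable lborel" "(\<lambda>s. \<kappa> (x + y n * s) / (1 + s\<^sup>2)) \<in> borel_measurable lborel" for n
      by measurable
    show "integrable lborel (\<lambda>s::real. L * (1 / (1 + s\<^sup>2)))"
      using has_bochner_integral_arctan_deriv by (intro integrable_mult_right) (simp add: has_bochner_integral_iff)
    show "AE s in lborel. (\<lambda>n. \<kappa> (x + y n * s) / (1 + s\<^sup>2)) \<longlonglongrightarrow> \<kappa> x / (1 + s\<^sup>2)"
    proof (rule AE_I2)
      fix s
      have "(\<lambda>n. x + y n * s) \<longlonglongrightarrow> x + 0 * s" by (intro tendsto_intros ylim)
      then have "(\<lambda>n. \<kappa> (x + y n * s)) \<longlonglongrightarrow> \<kappa> x" by (intro isCont_tendsto_compose[OF cont]) simp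
      then show "(\<lambda>n. \<kappa> (x + y n * s) / (1 + s\<^sup>2)) \<longlonglongrightarrow> \<kappa> x / (1 + s\<^sup>2)"
        using one_plus_square_pos[of s] by (intro tendsto_divide tendsto_const) auto
    qed
    show "AE s in lborel. norm (\<kappa> (x + y n * s) / (1 + s\<^sup>2)) \<le> L * (1 / (1 + s\<^sup>2))" for n
    proof (rule AE_I2)
      fix s
      show "norm (\<kappa> (x + y n * s) / (1 + s\<^sup>2)) \<le> L * (1 / (1 + s\<^sup>2))"
        using divide_right_mono[OF kL[of "x + y n * s"], of "1 + s\<^sup>2"] one_plus_square_pos[of s] by (simp add: abs_divide)
    qed
  qed
  moreover have "(LINT s|lborel. \<kappa> x / (1 + s\<^sup>2)) = \<kappa> x * pi"
    using has_bochner_integral_mult_right[OF has_bochner_integral_arctan_deriv, of "\<kappa> x"] by (simp add: has_bochner_integral_iff)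
  ultimately have 1: "(\<lambda>n. cmod (E (Complex x (y n)))) \<longlonglongrightarrow> cmod l"
    and lim: "(\<lambda>n. LINT s|lborel. \<kappa> (x + y n * s) / (1 + s\<^sup>2)) \<longlonglongrightarrow> \<kappa> x * pi"
    by simp_all
  from lim have 2: "(\<lambda>n. exp ((LINT s|lborel. \<kappa> (x + y n * s) / (1 + s\<^sup>2)) / pi)) \<longlonglongrightarrow> exp (\<kappa> x * pi / pi)"
    by (intro tendsto_exp tendsto_divide tendsto_const) simp_all
  have "(\<lambda>n. cmod (E (Complex x (y n)))) \<longlonglongrightarrow> exp (\<kappa> x * pi / pi)"
    using 2 y by (simp add: cmod_E Im_J)
  from LIMSEQ_unique[OF 1 this] show ?thesis by simp
qed

end

section \<open>The symbol \<open>\<delta>\<close> and its outer factor\<close>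

theorem theorem4p4:
  fixes H :: "(complex \<Rightarrow> complex) \<Rightarrow> (complex \<Rightarrow> complex)"
    and \<mu> :: "real measure"
    and c :: real
    and \<delta> :: "real \<Rightarrow> complex"
  assumes "hankel_operator H"
    and "positive_operator H"
    and "carleson_measure H \<mu>"
    and "c \<noteq> 0"
    and "\<delta> = (\<lambda>p. hankel_symbol \<mu> p + complex_of_real c)"
  shows "\<delta> \<in> Linf
    \<and> (AE p in lebesgue. \<delta> p \<noteq> 0) \<and> (\<lambda>p. 1 / \<delta> p) \<in> Linf
    \<and> (\<forall>F\<in>H2. hankel \<delta> F = H F)
    \<and> (\<exists>g\<in>Hinf_units. outer_function g
          \<and> (AE p in lebesgue. (cmod (nt_boundary g p))\<^sup>2 = cmod (\<delta> p)))"
proof -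
  interpret carleson H \<mu>
    using assms(1,3) by unfold_locales (simp_all add: hankel_operator_def)
  obtain D where D: "\<And>x. cmod (hankel_symbol \<mu> x) \<le> D" by (rule hankel_symbol_bound) blast
  have dm: "\<delta> \<in> borel_measurable borel" unfolding assms(5) using measurable_hankel_symbol by simp
  have upper: "cmod (\<delta> p) \<le> D + \<bar>c\<bar>" for p
    unfolding assms(5) using norm_triangle_ineq[of "hankel_symbol \<mu> p" "complex_of_real c"] D[of p] by simp
  have lower: "\<bar>c\<bar> \<le> cmod (\<delta> p)" for p
    using abs_Re_le_cmod[of "\<delta> p"] by (simp add: assms(5) Re_hankel_symbol)
  have cpos: "\<bar>c\<bar> > 0" using assms(4) by simp
  then have pos: "cmod (\<delta> p) > 0" for p using lower[of p] by linarith
  have nz: "\<delta> p \<noteq> 0" for p using pos[of p] by simp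
  have leb: "h \<in> borel_measurable lebesgue" if "h \<in> borel_measurable borel" for h :: "real \<Rightarrow> complex"
    using that by (intro measurable_completion) simp
  have 1: "\<delta> \<in> Linf" using leb[OF dm] upper by (auto simp: Linf_def intro!: exI[of _ "D + \<bar>c\<bar>"])
  have "cmod (1 / \<delta> p) \<le> 1 / \<bar>c\<bar>" for p
    unfolding norm_divide norm_one
    by (rule divide_left_mono[OF lower zero_le_one mult_pos_pos[OF pos cpos]])
  then have 2: "(\<lambda>p. 1 / \<delta> p) \<in> Linf"
    using leb[of "\<lambda>p. 1 / \<delta> p"] dm by (auto simp: Linf_def intro!: exI[of _ "1 / \<bar>c\<bar>"])
  \<comment> \<open>Half of the logarithm, because the square of the boundary modulus has to equal
    \<open>cmod (\<delta> p)\<close>.\<close>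
  define \<kappa> where "\<kappa> = (\<lambda>p. ln (cmod (\<delta> p)) / 2)"
  \<comment> \<open>\<open>ln (cmod (\<delta> p))\<close> lies between
    \<open>ln \<bar>c\<bar>\<close> and \<open>ln (D + \<bar>c\<bar>)\<close>, both of unknown sign;
    the sum of the absolute values bounds it on either side.\<close>
  define L where "L = \<bar>ln \<bar>c\<bar>\<bar> + \<bar>ln (D + \<bar>c\<bar>)\<bar>"
  interpret bounded_log \<kappa> L
  proof
    show "\<kappa> \<in> borel_measurable borel" unfolding \<kappa>_def using dm by simp
    show "\<bar>\<kappa> p\<bar> \<le> L" for p
    proof -
      have "ln \<bar>c\<bar> \<le> ln (cmod (\<delta> p))" using lower[of p] assms(4) pos[of p] by simp
      moreover have "0 < D + \<bar>c\<bar>" using upper[of p] pos[of p] by linarith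
      then have "ln (cmod (\<delta> p)) \<le> ln (D + \<bar>c\<bar>)"
        using ln_le_cancel_iff[OF pos[of p]] upper[of p] by blast
      ultimately have "\<bar>ln (cmod (\<delta> p))\<bar> \<le> L" unfolding L_def by linarith
      then show ?thesis by (simp add: \<kappa>_def)
    qed
  qed
  have "AE p in lborel. (cmod (nt_boundary E p))\<^sup>2 = cmod (\<delta> p)"
    using E_nt_limit_exists AE_lborel_singleton[of 0]
  proof eventually_elim
    fix p :: real assume "\<exists>l. nt_limit E p l" and p: "p \<noteq> 0"
    then obtain l where l: "nt_limit E p l" by blast
    have "isCont \<delta> p" unfolding assms(5) using continuous_hankel_symbol[OF p] by (intro continuous_intros)
    then have "isCont \<kappa> p" unfolding \<kappa>_def using pos[of p] by (intro continuous_intros) auto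
    then have "cmod l = exp (\<kappa> p)" by (rule cmod_nt_limit_E[OF l])
    moreover have "(exp (\<kappa> p))\<^sup>2 = cmod (\<delta> p)"
      using pos[of p] by (simp add: \<kappa>_def flip: exp_double)
    ultimately show "(cmod (nt_boundary E p))\<^sup>2 = cmod (\<delta> p)" by (simp add: nt_boundary_eq[OF l])
  qed
  then have 3: "AE p in lebesgue. (cmod (nt_boundary E p))\<^sup>2 = cmod (\<delta> p)" by (rule AE_completion)
  show ?thesis
    using 1 2 3 nz hankel_eq[OF assms(5)] E_unit E_outer by auto
qed

end
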